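(* Let $X$ be either the circle $\mathrm{S}^1=\mathbb{R}/\mathbb{Z}$ or the closed interval $[0,1]$. Let $\Gamma$ be a finitely generated nilpotent group of orientation-preserving $C^1$ diffeomorphisms of $X$, and let $\mathcal{G}$ be a finite generating set of $\Gamma$. Then for every $\varepsilon>0$ there exists a homeomorphism $\varphi: X\to X$ such that for every $g\in\mathcal{G}$, both $\varphi\circ g\circ\varphi^{-1}$ and $\varphi\circ g^{-1}\circ\varphi^{-1}$ are $C^1$ diffeomorphisms of $X$ whose derivative is $\le e^{\varepsilon}$ at every point of $X$.
   Context: A topological conjugate of $\Gamma$ is a group $\varphi\Gamma\varphi^{-1}$ with $\varphi$ a homeomorphism of $X$ (not assumed differentiable). *)

theory Defs
  imports "HOL-Analysis.Analysis" "HOL-Algebra.Bij" "HOL-Algebra.Generated_Groups"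
begin

fun lower_central :: "('a, 'b) monoid_scheme \<Rightarrow> nat \<Rightarrow> 'a set" where
  "lower_central G 0 = carrier G"
| "lower_central G (Suc n) =
     generate G (\<Union>h \<in> lower_central G n. \<Union>k \<in> carrier G.
       {h \<otimes>\<^bsub>G\<^esub> k \<otimes>\<^bsub>G\<^esub> (inv\<^bsub>G\<^esub> h) \<otimes>\<^bsub>G\<^esub> (inv\<^bsub>G\<^esub> k)})"

definition nilpotent_group :: "('a, 'b) monoid_scheme \<Rightarrow> bool" where
  "nilpotent_group G \<longleftrightarrow> group G \<and> (\<exists>n. lower_central G n = {\<one>\<^bsub>G\<^esub>})"

quotient_type circle = real / "\<lambda>x y. x - y \<in> \<int>"
  morphisms rep_circle to_circle
proof (rule equivpI)
  show "reflp (\<lambda>x y::real. x - y \<in> \<int>)" by (simp add: reflp_def)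
  show "symp (\<lambda>x y::real. x - y \<in> \<int>)"
    by (metis (mono_tags, lifting) Ints_minus minus_diff_eq sympI)
  show "transp (\<lambda>x y::real. x - y \<in> \<int>)"
  proof (rule transpI)
    fix x y z :: real assume "x - y \<in> \<int>" "y - z \<in> \<int>"
    then have "(x - y) + (y - z) \<in> \<int>" by (rule Ints_add)
    then show "x - z \<in> \<int>" by simp
  qed
qed

instantiation circle :: topological_space
begin

definition open_circle :: "circle set \<Rightarrow> bool" where
  "open_circle U \<longleftrightarrow> open (to_circle -` U)"

instance
  by standard (auto simp: open_circle_def vimage_Union)

end

lemma to_circle_eq_iff: "to_circle x = to_circle y \<longleftrightarrow> x - y \<in> \<int>"
  by (rule circle.abs_eq_iff)

text \<open>
  A derivative relation \<open>D f d x\<close> reads ``\<open>f\<close> has derivative \<open>d\<close> at \<open>x\<close>''.  On the circle the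
  derivative is that of a local lift \<open>F\<close> to \<open>\<real>\<close>, i.e. the derivative in the
  charts given by local inverses of the projection.  It is only required that \<open>F\<close> lifts \<open>f\<close> near
  \<open>t\<close>; its differentiability at \<open>t\<close> makes \<open>d\<close> unique.
\<close>

definition interval_deriv :: "(real \<Rightarrow> real) \<Rightarrow> real \<Rightarrow> real \<Rightarrow> bool" where
  "interval_deriv f d x \<longleftrightarrow> (f has_real_derivative d) (at x within {0..1})"

definition circle_deriv :: "(circle \<Rightarrow> circle) \<Rightarrow> real \<Rightarrow> circle \<Rightarrow> bool" where
  "circle_deriv f d x \<longleftrightarrow>
     (\<exists>t F. to_circle t = x \<and>
            (\<forall>\<^sub>F s in nhds t. to_circle (F s) = f (to_circle s)) \<and>
            (F has_real_derivative d) (at t))"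

lemma interval_deriv_unique:
  assumes "interval_deriv f d x" "interval_deriv f e x" "x \<in> {0..1}"
  shows "d = e"
proof -
  have "at x within {0..1::real} \<noteq> bot"
    using assms(3) by (simp add: trivial_limit_within islimpt_Icc)
  then show ?thesis
    using assms(1,2) has_field_derivative_unique
    unfolding interval_deriv_def by blast
qed

lemma circle_deriv_unique:
  assumes "circle_deriv f d x" "circle_deriv f e x"
  shows "d = e"
proof -
  obtain t F where F: "to_circle t = x" "\<forall>\<^sub>F s in nhds t. to_circle (F s) = f (to_circle s)"
      "(F has_real_derivative d) (at t)"
    using assms(1) unfolding circle_deriv_def by blast
  obtain u G where G: "to_circle u = x" "\<forall>\<^sub>F s in nhds u. to_circle (G s) = f (to_circle s)"
      "(G has_real_derivative e) (at u)"
    using assms(2) unfolding circle_deriv_def by blast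
  define k where "k = u - t"
  have k: "k \<in> \<int>" "u = t + k"
    using F(1) G(1) to_circle_eq_iff[of u t] by (auto simp: k_def)
  define H where "H = (\<lambda>s. F s - G (s + k))"
  have "filterlim (\<lambda>s. s + k) (nhds (t + k)) (nhds t)"
    by (intro tendsto_intros filterlim_ident)
  then have ev: "\<forall>\<^sub>F s in nhds t. to_circle (G (s + k)) = f (to_circle (s + k))"
    using G(2) unfolding k(2) by (auto dest: eventually_compose_filterlim)
  have per: "to_circle (s + k) = to_circle s" for s
    using k(1) by (simp add: to_circle_eq_iff)
  have int: "\<forall>\<^sub>F s in nhds t. H s \<in> \<int>"
    using F(2) ev by eventually_elim (metis H_def per to_circle_eq_iff)
  have dG: "((\<lambda>s. G (s + k)) has_real_derivative e) (at t)"
    using G(3) k(2) by (simp add: DERIV_shift)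
  have dH: "(H has_real_derivative (d - e)) (at t)"
    unfolding H_def by (intro derivative_intros F(3) dG)
  then have "isCont H t" by (rule DERIV_isCont)
  then have lim: "(H \<longlongrightarrow> H t) (nhds t)"
    by (simp add: isCont_def tendsto_nhds_iff)
  have "\<forall>\<^sub>F s in nhds t. dist (H s) (H t) < 1"
    using lim by (rule tendstoD) simp
  then have "\<forall>\<^sub>F s in nhds t. H s = H t"
    using int
  proof eventually_elim
    case (elim s)
    have "H t \<in> \<int>" using int by (rule eventually_nhds_x_imp_x)
    with elim(2) obtain a b where "H s = of_int a" "H t = of_int b" by (auto elim!: Ints_cases)
    with elim(1) show ?case by (simp add: dist_real_def flip: of_int_diff of_int_abs)
  qed
  then have "((\<lambda>_. H t) has_real_derivative (d - e)) (at t)"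
    using dH by (subst DERIV_cong_ev[OF refl _ refl, of _ H]) (auto elim: eventually_mono)
  then have "d - e = 0"
    using DERIV_const DERIV_unique by blast
  then show ?thesis by simp
qed

definition C1_map ::
  "'a::topological_space set \<Rightarrow> (('a \<Rightarrow> 'a) \<Rightarrow> real \<Rightarrow> 'a \<Rightarrow> bool) \<Rightarrow> ('a \<Rightarrow> 'a) \<Rightarrow> bool" where
  "C1_map X D f \<longleftrightarrow>
     f \<in> X \<rightarrow> X \<and> (\<exists>f'. continuous_on X f' \<and> (\<forall>x\<in>X. D f (f' x) x))"

definition C1_diffeo ::
  "'a::topological_space set \<Rightarrow> (('a \<Rightarrow> 'a) \<Rightarrow> real \<Rightarrow> 'a \<Rightarrow> bool) \<Rightarrow> ('a \<Rightarrow> 'a) \<Rightarrow> bool" where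
  "C1_diffeo X D f \<longleftrightarrow> bij_betw f X X \<and> C1_map X D f \<and> C1_map X D (inv_into X f)"

definition orientation_preserving ::
  "'a set \<Rightarrow> (('a \<Rightarrow> 'a) \<Rightarrow> real \<Rightarrow> 'a \<Rightarrow> bool) \<Rightarrow> ('a \<Rightarrow> 'a) \<Rightarrow> bool" where
  "orientation_preserving X D f \<longleftrightarrow> (\<forall>x\<in>X. \<exists>d>0. D f d x)"

end

theory Submission
  imports Defs
begin

text \<open>
  Let the group \<open>G\<close> act on the circle by \<open>C\<^sup>1\<close> diffeomorphisms with lifts \<open>L g\<close> and derivatives \<open>D g\<close>. The
  conjugating homeomorphism is an average of the group elements themselves:
  \<open>\<phi> x = (\<Sum>\<^sub>\<infinity>g\<in>carrier G. w g * (L g x - L g 0))\<close>, with a summable weight \<open>w\<close> that varies slowly with the word length. Composing \<open>\<phi>\<close> with a generator \<open>s\<close>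
  replaces \<open>w g\<close> by \<open>w (g s\<^sup>-\<^sup>1)\<close>, up to an additive constant. So the difference quotients of the conjugate of \<open>s\<close> are averages of
  the ratios \<open>w (g s\<^sup>-\<^sup>1) / w g\<close> and are bounded by \<open>exp \<epsilon>\<close>. A summable weight of this kind exists because
  nilpotent groups have polynomial growth (\<open>nilpotent_poly_growth\<close>).

  It remains to see that these quotients converge when both points tend to the same point \<open>x\<close>, which
  makes the conjugate \<open>C\<^sup>1\<close>. Here the weight is chosen such that \<open>w (g s\<^sup>-\<^sup>1) / w g\<close> tends to \<open>1\<close> at infinity
  in the group, while \<open>w\<close> is still summable against the suprema of the derivatives \<open>D g\<close> away from the finite
  orbits (\<open>weight_exists\<close>). There are three cases.

  If the orbit of \<open>x\<close> is infinite, the derivatives of group elements grow subexponentially near \<open>x\<close>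
  (\<open>subexponential_derivatives\<close>), and the series may be differentiated term by term. Exponential growth
  would, by hyperbolic times and the contraction principle, produce a hyperbolic fixed point of some
  group element close to the orbit of \<open>x\<close>. But in a nilpotent group every hyperbolic fixed point of an
  element has a finite orbit (\<open>hyperbolic_orbit_finite\<close>): if \<open>h\<close> is hyperbolic at \<open>x\<close> and, say, commutes with
  \<open>g\<close>, then all \<open>g\<^sup>n x\<close> are fixed points of \<open>h\<close> with the same derivative, and there are only finitely many of those.
  If the orbit of \<open>x\<close> is finite and some element fixing \<open>x\<close> has derivative different from \<open>1\<close>, then the
  averaged derivative is infinite at \<open>x\<close>. The average of the ratios is then governed by elements far out
  in the group and tends to \<open>1\<close>. If the orbit is finite and all elements fixing \<open>x\<close> have derivative \<open>1\<close>, an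
  additional average over a transversal of the stabilizer makes the derivative at \<open>x\<close> the same for all
  group elements; then the total weights in numerator and denominator agree, and the limit is again \<open>1\<close>
  (\<open>weighted_quotient_tendsto_1\<close>).

  The interval is reduced to the circle by doubling: its diffeomorphisms become odd circle
  diffeomorphisms, and the construction then yields an odd \<open>\<phi>\<close>.
\<close>

section \<open>Polynomial growth of nilpotent groups\<close>

definition gprod :: "('a, 'b) monoid_scheme \<Rightarrow> 'a list \<Rightarrow> 'a" where
  "gprod G xs = foldr (\<otimes>\<^bsub>G\<^esub>) xs \<one>\<^bsub>G\<^esub>"

text \<open>
  Words are monoid words, without inverses: for growth it is then enough to know how a letter is
  moved past another one, and inverses are handled by listing them among the letters.
\<close>

definition words :: "('a, 'b) monoid_scheme \<Rightarrow> 'a set \<Rightarrow> nat \<Rightarrow> 'a set" where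
  "words G S n = gprod G ` {xs. set xs \<subseteq> S \<and> length xs \<le> n}"

declare lower_central.simps(2) [simp del]

context group
begin

lemma gprod_Nil [simp]: "gprod G [] = \<one>"
  by (simp add: gprod_def)

lemma gprod_Cons [simp]: "gprod G (x # xs) = x \<otimes> gprod G xs"
  by (simp add: gprod_def)

lemma gprod_closed: "set xs \<subseteq> carrier G \<Longrightarrow> gprod G xs \<in> carrier G"
  by (induction xs) auto

lemma gprod_append:
  "set xs \<subseteq> carrier G \<Longrightarrow> set ys \<subseteq> carrier G \<Longrightarrow> gprod G (xs @ ys) = gprod G xs \<otimes> gprod G ys"
  by (induction xs) (auto simp: gprod_closed m_assoc)

lemma words_mono: "S \<subseteq> S' \<Longrightarrow> n \<le> n' \<Longrightarrow> words G S n \<subseteq> words G S' n'"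
  by (force simp: words_def)

lemma words_finite: "finite S \<Longrightarrow> finite (words G S n)"
  unfolding words_def by (intro finite_imageI finite_lists_length_le)

lemma words_mult:
  assumes "S \<subseteq> carrier G" "x \<in> words G S m" "y \<in> words G S n"
  shows "x \<otimes> y \<in> words G S (m + n)"
proof -
  obtain xs ys where "x = gprod G xs" "set xs \<subseteq> S" "length xs \<le> m"
    "y = gprod G ys" "set ys \<subseteq> S" "length ys \<le> n"
    using assms(2,3) by (auto simp: words_def)
  then have "x \<otimes> y = gprod G (xs @ ys)" "set (xs @ ys) \<subseteq> S" "length (xs @ ys) \<le> m + n"
    using assms(1) by (auto intro: gprod_append[symmetric])
  then show ?thesis unfolding words_def by blast
qed

lemma words_one: "\<one> \<in> words G S n"
  unfolding words_def by (rule image_eqI[of _ _ "[]"]) auto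

lemma words_letter: "x \<in> S \<Longrightarrow> S \<subseteq> carrier G \<Longrightarrow> x \<in> words G S (Suc n)"
  unfolding words_def by (rule image_eqI[of _ _ "[x]"]) auto

lemma lower_central_subgroup: "subgroup (lower_central G n) G"
proof (induction n)
  case 0 then show ?case by (simp add: subgroup_self)
next
  case (Suc n)
  then have "lower_central G n \<subseteq> carrier G" by (rule subgroup.subset)
  then show ?case by (auto simp: lower_central.simps(2) intro!: generate_is_subgroup)
qed

lemma lower_central_carrier: "x \<in> lower_central G n \<Longrightarrow> x \<in> carrier G"
  using subgroup.mem_carrier[OF lower_central_subgroup] .

lemma lower_central_comm:
  assumes "h \<in> lower_central G n" "k \<in> carrier G"
  shows "h \<otimes> k \<otimes> inv h \<otimes> inv k \<in> lower_central G (Suc n)"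
  using assms by (auto simp: lower_central.simps(2) intro!: generate.incl)

lemma lower_central_comm':
  assumes "h \<in> lower_central G n" "k \<in> carrier G"
  shows "k \<otimes> h \<otimes> inv k \<otimes> inv h \<in> lower_central G (Suc n)"
proof -
  have "inv (h \<otimes> k \<otimes> inv h \<otimes> inv k) \<in> lower_central G (Suc n)"
    using lower_central_comm[OF assms] subgroup.m_inv_closed[OF lower_central_subgroup] by blast
  then show ?thesis
    using assms(2) lower_central_carrier[OF assms(1)] by (simp add: inv_mult_group m_assoc)
qed

lemma lower_central_one: "\<one> \<in> lower_central G n"
  by (rule subgroup.one_closed[OF lower_central_subgroup])

lemma lower_central_Suc: "lower_central G (Suc n) \<subseteq> lower_central G n"
proof (induction n)
  case 0 then show ?case using subgroup.subset[OF lower_central_subgroup] by fastforce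
next
  case (Suc n)
  show ?case
    unfolding lower_central.simps(2)[of G "Suc n"]
  proof (rule generate_subgroup_incl[OF _ lower_central_subgroup])
    show "(\<Union>h\<in>lower_central G (Suc n). \<Union>k\<in>carrier G. {h \<otimes> k \<otimes> inv h \<otimes> inv k}) \<subseteq> lower_central G (Suc n)"
      using Suc lower_central_comm by blast
  qed
qed

lemma lower_central_antimono: "m \<le> n \<Longrightarrow> lower_central G n \<subseteq> lower_central G m"
  by (rule lift_Suc_antimono_le[of "lower_central G"]) (use lower_central_Suc in auto)

lemma lower_central_conj:
  assumes "h \<in> lower_central G n" "k \<in> carrier G"
  shows "k \<otimes> h \<otimes> inv k \<in> lower_central G n"
proof -
  have "k \<otimes> h \<otimes> inv k \<otimes> inv h \<in> lower_central G n"
    using lower_central_comm'[OF assms] lower_central_Suc by blast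
  then have "k \<otimes> h \<otimes> inv k \<otimes> inv h \<otimes> h \<in> lower_central G n"
    using assms(1) subgroup.m_closed[OF lower_central_subgroup] by blast
  then show ?thesis
    using assms(2) lower_central_carrier[OF assms(1)] by (simp add: m_assoc)
qed

definition comm_by :: "'a \<Rightarrow> 'a \<Rightarrow> 'a" where
  "comm_by a b = inv b \<otimes> (inv a \<otimes> b \<otimes> a)"

abbreviation "iter_comm a k b \<equiv> (comm_by a ^^ k) b"
abbreviation "conj_pow a j b \<equiv> inv (a [^] (j::nat)) \<otimes> b \<otimes> a [^] j"

lemma comm_by_closed: "a \<in> carrier G \<Longrightarrow> b \<in> carrier G \<Longrightarrow> comm_by a b \<in> carrier G"
  by (simp add: comm_by_def)

lemma comm_by_lower:
  assumes "a \<in> carrier G" "b \<in> lower_central G n"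
  shows "comm_by a b \<in> lower_central G (Suc n)"
proof -
  have b: "b \<in> carrier G" "inv b \<in> lower_central G n"
    using assms(2) lower_central_carrier subgroup.m_inv_closed[OF lower_central_subgroup] by auto
  from lower_central_comm[OF b(2), of "inv a"] assms(1) b(1)
  show ?thesis by (simp add: comm_by_def m_assoc)
qed

lemma iter_comm_lower:
  assumes "a \<in> carrier G" "b \<in> lower_central G n"
  shows "iter_comm a k b \<in> lower_central G (n + k)"
  by (induction k) (use assms comm_by_lower in auto)

lemma conj_pow_mult:
  assumes "a \<in> carrier G" "b \<in> carrier G" "c \<in> carrier G"
  shows "conj_pow a j (b \<otimes> c) = conj_pow a j b \<otimes> conj_pow a j c"
proof -
  have *: "a [^] j \<otimes> (inv (a [^] j) \<otimes> z) = z" if "z \<in> carrier G" for z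
    using assms that by (simp add: m_assoc[symmetric])
  show ?thesis using assms by (simp add: m_assoc *)
qed

lemma conj_pow_Suc:
  assumes "a \<in> carrier G" "b \<in> carrier G"
  shows "conj_pow a (Suc j) b = conj_pow a j b \<otimes> conj_pow a j (comm_by a b)"
proof -
  have "a [^] Suc j = a \<otimes> a [^] j" using assms nat_pow_Suc2 by auto
  then have "conj_pow a (Suc j) b = conj_pow a j (inv a \<otimes> b \<otimes> a)"
    using assms by (simp add: inv_mult_group m_assoc)
  also have "inv a \<otimes> b \<otimes> a = b \<otimes> comm_by a b"
    using assms by (simp add: comm_by_def m_assoc[symmetric])
  finally show ?thesis using assms conj_pow_mult comm_by_closed by simp
qed

text \<open>
  Since \<open>b\<^sub>k\<close> conjugated by \<open>a\<close> is \<open>b\<^sub>k b\<^sub>k\<^sub>+\<^sub>1\<close> for the iterated commutators \<open>b\<^sub>k\<close> of \<open>b\<close> with \<open>a\<close>, the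
  word lengths satisfy Pascal's recurrence. Nilpotency cuts the sequence off at \<open>c\<close>, so the length is
  polynomial in the number \<open>j\<close> of conjugations.
\<close>

lemma conj_pow_words:
  assumes a: "a \<in> carrier G" and b: "b \<in> carrier G"
    and c: "iter_comm a c b = \<one>" and kc: "k \<le> c"
  shows "conj_pow a j (iter_comm a k b) \<in> words G ((\<lambda>k. iter_comm a k b) ` {..<c}) ((j + 1) ^ (c - k))"
  using kc
proof (induction j arbitrary: k)
  have cl: "iter_comm a k b \<in> carrier G" for k
    by (induction k) (use a b comm_by_closed in auto)
  let ?S = "(\<lambda>k. iter_comm a k b) ` {..<c}"
  have S: "?S \<subseteq> carrier G" using cl by auto
  { case 0
    show ?case
    proof (cases "k = c")
      case True then show ?thesis using c words_one by simp
    next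
      case False
      then have "iter_comm a k b \<in> ?S" using 0 by simp
      then have "iter_comm a k b \<in> words G ?S (Suc 0)" by (rule words_letter[OF _ S])
      moreover have "conj_pow a 0 (iter_comm a k b) = iter_comm a k b" using cl by simp
      ultimately show ?thesis by simp
    qed
  next
    case (Suc j)
    show ?case
    proof (cases "k = c")
      case True then show ?thesis using c a words_one by simp
    next
      case False
      then have k: "k \<le> c" "Suc k \<le> c" using Suc by auto
      have eq: "conj_pow a (Suc j) (iter_comm a k b) = conj_pow a j (iter_comm a k b) \<otimes> conj_pow a j (iter_comm a (Suc k) b)"
        using conj_pow_Suc[OF a cl] by simp
      obtain p where p: "c - k = Suc p" "c - Suc k = p" using k by (cases "c - k") auto
      have "(j+1) ^ Suc p + (j+1) ^ p = (j+2) * (j+1) ^ p" by simp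
      also have "\<dots> \<le> (j+2) * (j+2) ^ p" by (intro mult_left_mono power_mono) auto
      also have "\<dots> = (Suc j + 1) ^ Suc p" by simp
      finally have le: "(j+1) ^ Suc p + (j+1) ^ p \<le> (Suc j + 1) ^ Suc p" .
      have "conj_pow a j (iter_comm a k b) \<otimes> conj_pow a j (iter_comm a (Suc k) b) \<in> words G ?S ((j+1) ^ Suc p + (j+1) ^ p)"
        using words_mult[OF S Suc.IH[OF k(1)] Suc.IH[OF k(2)]] unfolding p .
      then show ?thesis unfolding eq p(1) by (rule subsetD[OF words_mono[OF order_refl le]])
    qed }
qed

text \<open>
  Collection of one letter: every \<open>a\<close> is moved to the far left, which conjugates the letters it
  passes. No letter is passed more often than the word is long.
\<close>

lemma words_push:
  assumes a: "a \<in> carrier G" and B: "B \<subseteq> carrier G"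
    and w: "set w \<subseteq> insert a B"
  shows "\<exists>m ys. m \<le> length w \<and> length ys \<le> length w \<and>
     set ys \<subseteq> {conj_pow a j b |j b. j \<le> length w \<and> b \<in> B} \<and> gprod G w = a [^] m \<otimes> gprod G ys"
  using w
proof (induction w rule: rev_induct)
  case Nil then show ?case by (intro exI[of _ 0] exI[of _ "[]"]) auto
next
  case (snoc x w)
  let ?K = "\<lambda>n. {conj_pow a j b |j b. j \<le> n \<and> b \<in> B}"
  have "set w \<subseteq> insert a B" using snoc.prems by simp
  from snoc.IH[OF this] obtain m ys where *: "m \<le> length w" "length ys \<le> length w"
     "set ys \<subseteq> ?K (length w)" "gprod G w = a [^] m \<otimes> gprod G ys"
    by blast
  have "y \<in> carrier G" if "y \<in> set ys" for y
  proof -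
    obtain j b where "y = conj_pow a j b" "b \<in> B" using *(3) \<open>y \<in> set ys\<close> by blast
    then show ?thesis using a B by auto
  qed
  then have ys: "set ys \<subseteq> carrier G" by blast
  have w: "set w \<subseteq> carrier G" "x \<in> carrier G" using snoc.prems a B by auto
  have eq: "gprod G (w @ [x]) = a [^] m \<otimes> gprod G ys \<otimes> x"
    using gprod_append[of w "[x]"] w *(4) by simp
  note sub = *(3)
  show ?case
  proof (cases "x = a")
    case True
    have *: "gprod G ys \<otimes> a = a \<otimes> gprod G (map (conj_pow a 1) ys)" if "set ys \<subseteq> carrier G" for ys
      using that
    proof (induction ys)
      case (Cons y ys)
      then have "gprod G (y # ys) \<otimes> a = y \<otimes> (gprod G ys \<otimes> a)"
        using a by (simp add: m_assoc gprod_closed)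
      also have "\<dots> = y \<otimes> (a \<otimes> gprod G (map (conj_pow a 1) ys))" using Cons by simp
      also have "\<dots> = a \<otimes> (conj_pow a 1 y \<otimes> gprod G (map (conj_pow a 1) ys))"
      proof -
        have "gprod G (map (conj_pow a 1) ys) \<in> carrier G" by (rule gprod_closed) (use a Cons in auto)
        then show ?thesis using a Cons by (simp add: m_assoc[symmetric])
      qed
      finally show ?case by simp
    qed (use a in auto)
    have "gprod G (w @ [x]) = a [^] m \<otimes> (gprod G ys \<otimes> a)"
      using eq True a ys by (simp add: m_assoc gprod_closed)
    also have "\<dots> = a [^] m \<otimes> (a \<otimes> gprod G (map (conj_pow a 1) ys))" using *[OF ys] by simp
    also have "\<dots> = a [^] Suc m \<otimes> gprod G (map (conj_pow a 1) ys)"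
    proof -
      have "gprod G (map (conj_pow a 1) ys) \<in> carrier G" by (rule gprod_closed) (use a ys in auto)
      then show ?thesis using a by (simp add: m_assoc)
    qed
    finally have "gprod G (w @ [x]) = a [^] Suc m \<otimes> gprod G (map (conj_pow a 1) ys)" .
    moreover have "set (map (conj_pow a 1) ys) \<subseteq> {conj_pow a j b |j b. j \<le> length (w @ [x]) \<and> b \<in> B}"
    proof
      fix z assume "z \<in> set (map (conj_pow a 1) ys)"
      then obtain y where y: "y \<in> set ys" "z = conj_pow a 1 y" by auto
      then obtain j b where "j \<le> length w" "b \<in> B" "y = conj_pow a j b" using sub by blast
      then have jb: "j \<le> length w" "b \<in> B" "z = conj_pow a 1 (conj_pow a j b)" using y by auto
      have bc: "b \<in> carrier G" using jb B by auto
      have "conj_pow a 1 (conj_pow a j b) = conj_pow a (Suc j) b" using a bc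
        by (simp add: inv_mult_group m_assoc)
      then show "z \<in> {conj_pow a j b |j b. j \<le> length (w @ [x]) \<and> b \<in> B}" using jb
        by (intro CollectI exI[of _ "Suc j"] exI[of _ b]) simp
    qed
    ultimately show ?thesis using \<open>m \<le> length w\<close> \<open>length ys \<le> length w\<close>
      by (intro exI[of _ "Suc m"] exI[of _ "map (conj_pow a 1) ys"] conjI) simp_all
  next
    case False
    then have "x \<in> B" using snoc.prems by auto
    have "x \<in> ?K (length (w @ [x]))"
      using \<open>x \<in> B\<close> w by (intro CollectI exI[of _ 0] exI[of _ x]) simp
    moreover have "?K (length w) \<subseteq> ?K (length (w @ [x]))" by force
    moreover have "gprod G (w @ [x]) = a [^] m \<otimes> gprod G (ys @ [x])"
      using eq ys w a gprod_append[of ys "[x]"] by (simp add: m_assoc gprod_closed)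
    ultimately show ?thesis using *(1-3)
      by (intro exI[of _ m] exI[of _ "ys @ [x]"] conjI) auto
  qed
qed

definition poly_growth :: "'a set \<Rightarrow> bool" where
  "poly_growth S \<longleftrightarrow> (\<exists>C d. \<forall>n. card (words G S n) \<le> C * (n + 1) ^ d)"

lemma poly_growth_mono:
  assumes "poly_growth S'" "S \<subseteq> S'" "finite S'"
  shows "poly_growth S"
proof -
  obtain C d where Cd: "\<And>n. card (words G S' n) \<le> C * (n + 1) ^ d"
    using assms(1) unfolding poly_growth_def by blast
  have "card (words G S n) \<le> C * (n + 1) ^ d" for n
    using card_mono[OF words_finite[OF assms(3)] words_mono[OF assms(2) order_refl], of n] Cd[of n]
    by (rule order_trans)
  then show ?thesis unfolding poly_growth_def by blast
qed

lemma words_collect: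
  assumes "S' \<subseteq> carrier G" "\<And>y. y \<in> set ys \<Longrightarrow> y \<in> words G S' N"
  shows "gprod G ys \<in> words G S' (length ys * N)"
  using assms(2)
proof (induction ys)
  case (Cons y ys)
  then have "y \<otimes> gprod G ys \<in> words G S' (N + length ys * N)"
    by (intro words_mult assms(1)) auto
  then show ?case by simp
qed (use words_one in simp)

text \<open>
  The inductive step of the growth estimate. Removing the letter \<open>a\<close> costs only a power of \<open>a\<close> in
  front and the adjunction of iterated commutators, which lie deeper in the lower central series.
\<close>

lemma poly_growth_step:
  assumes a: "a \<in> carrier G" and B: "B \<subseteq> carrier G" "finite B"
    and c: "\<And>b. b \<in> B \<Longrightarrow> iter_comm a c b = \<one>"
    and S': "poly_growth (\<Union>b\<in>B. (\<lambda>k. iter_comm a k b) ` {..<c})"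
  shows "poly_growth (insert a B)"
proof -
  let ?S = "\<Union>b\<in>B. (\<lambda>k. iter_comm a k b) ` {..<c}"
  have cl: "iter_comm a k b \<in> carrier G" if "b \<in> B" for k b
    by (induction k) (use a B that comm_by_closed in auto)
  have S: "?S \<subseteq> carrier G" "finite ?S" using cl B by auto
  obtain C d where Cd: "\<And>n. card (words G ?S n) \<le> C * (n + 1) ^ d"
    using S' by (auto simp: poly_growth_def)
  have sub: "words G (insert a B) n \<subseteq> (\<lambda>(m, y). a [^] m \<otimes> y) ` ({..n} \<times> words G ?S (n * (n + 1) ^ c))" for n
  proof
    fix x assume "x \<in> words G (insert a B) n"
    then obtain w where w: "set w \<subseteq> insert a B" "length w \<le> n" "x = gprod G w"
      by (auto simp: words_def)
    obtain m ys where *: "m \<le> length w" "length ys \<le> length w"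
      "set ys \<subseteq> {conj_pow a j b |j b. j \<le> length w \<and> b \<in> B}" "gprod G w = a [^] m \<otimes> gprod G ys"
      using words_push[OF a B(1) w(1)] by blast
    have "y \<in> words G ?S ((n + 1) ^ c)" if y: "y \<in> set ys" for y
    proof -
      obtain j b where jb: "j \<le> length w" "b \<in> B" "y = conj_pow a j b" using subsetD[OF *(3) y] by blast
      have "y \<in> words G ((\<lambda>k. iter_comm a k b) ` {..<c}) ((j + 1) ^ (c - 0))"
        using conj_pow_words[OF a _ c, of b 0 j] jb B by auto
      moreover have "(j + 1) ^ (c - 0) \<le> (n + 1) ^ c" using jb w by (auto intro!: power_mono)
      ultimately show ?thesis using words_mono[of "(\<lambda>k. iter_comm a k b) ` {..<c}" ?S] jb(2) by blast
    qed
    then have "gprod G ys \<in> words G ?S (length ys * (n + 1) ^ c)" by (rule words_collect[OF S(1)])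
    moreover have "length ys * (n + 1) ^ c \<le> n * (n + 1) ^ c" using *(2) w(2) by simp
    ultimately have "gprod G ys \<in> words G ?S (n * (n + 1) ^ c)" using words_mono[OF order_refl] by blast
    moreover have "m \<le> n" using * w by simp
    ultimately show "x \<in> (\<lambda>(m, y). a [^] m \<otimes> y) ` ({..n} \<times> words G ?S (n * (n + 1) ^ c))"
      using * w by force
  qed
  have "card (words G (insert a B) n) \<le> C * (n + 1) ^ (1 + (c + 1) * d)" for n
  proof -
    have fin: "finite ({..n} \<times> words G ?S (n * (n + 1) ^ c))" using words_finite[OF S(2)] by auto
    have "card (words G (insert a B) n) \<le> card ({..n} \<times> words G ?S (n * (n + 1) ^ c))"
      using surj_card_le[OF fin sub] .
    also have "\<dots> = (n + 1) * card (words G ?S (n * (n + 1) ^ c))" by (simp add: card_cartesian_product)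
    also have "\<dots> \<le> (n + 1) * (C * (n * (n + 1) ^ c + 1) ^ d)" by (intro mult_left_mono Cd) simp
    also have "\<dots> \<le> (n + 1) * (C * ((n + 1) ^ (c + 1)) ^ d)"
      by (intro mult_left_mono power_mono) auto
    also have "\<dots> = C * (n + 1) ^ (1 + (c + 1) * d)"
      by (simp only: power_mult[symmetric] power_add[of "n + 1" 1] power_one_right mult_ac)
    finally show ?thesis .
  qed
  then show ?thesis unfolding poly_growth_def by blast
qed

text \<open>
  Downward induction along the lower central series. Within one level the letters outside the next
  level are eliminated one at a time, so that finally all letters lie in the next level.
\<close>

lemma nilpotent_poly_growth:
  assumes c: "lower_central G c = {\<one>}" and "i \<le> c" "finite S" "S \<subseteq> lower_central G i"
  shows "poly_growth S"
  using assms(2-)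
proof (induction i arbitrary: S rule: inc_induct)
  case base
  have eq: "gprod G xs = \<one>" if "set xs \<subseteq> {\<one>}" for xs using that by (induction xs) auto
  have "words G S n \<subseteq> {\<one>}" for n using base c eq by (fastforce simp: words_def)
  then have "card (words G S n) \<le> 1 * (n + 1) ^ 0" for n
    using card_mono[of "{\<one>}" "words G S n"] by simp
  then show ?case unfolding poly_growth_def by blast
next
  case (step i)
  have "\<forall>A B. card A = m \<longrightarrow> finite A \<longrightarrow> finite B \<longrightarrow> A \<subseteq> lower_central G i \<longrightarrow>
         B \<subseteq> lower_central G (Suc i) \<longrightarrow> poly_growth (A \<union> B)" for m
  proof (induction m)
    case 0 then show ?case using step.IH by auto
  next
    case (Suc m)
    show ?case
    proof (intro allI impI)
      fix A B assume A: "card A = Suc m" "finite A" "A \<subseteq> lower_central G i"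
        and B: "finite B" "B \<subseteq> lower_central G (Suc i)"
      then obtain a A' where A': "A = insert a A'" "a \<notin> A'" "card A' = m" by (meson card_eq_SucD)
      have sub: "A' \<subseteq> lower_central G i" "B \<subseteq> lower_central G i" "a \<in> carrier G"
        using A' A B lower_central_Suc lower_central_carrier by blast+
      have c1: "iter_comm a c b = \<one>" if "b \<in> A' \<union> B" for b
      proof -
        have "iter_comm a c b \<in> lower_central G (i + c)" using sub that by (intro iter_comm_lower) auto
        then show ?thesis using lower_central_antimono[of c "i + c"] c by auto
      qed
      let ?S = "\<Union>b\<in>A' \<union> B. (\<lambda>k. iter_comm a k b) ` {..<c}"
      let ?B = "(\<Union>b\<in>A' \<union> B. (\<lambda>k. iter_comm a k b) ` {1..<c}) \<union> B"
      have "iter_comm a k b \<in> lower_central G (Suc i)" if "b \<in> A' \<union> B" "k \<ge> 1" for b k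
      proof -
        have "iter_comm a k b \<in> lower_central G (i + k)" using sub that by (intro iter_comm_lower) auto
        then show ?thesis using lower_central_antimono[of "Suc i" "i + k"] that by auto
      qed
      then have "?B \<subseteq> lower_central G (Suc i)" using B by auto
      then have "poly_growth (A' \<union> ?B)"
        using Suc.IH[rule_format, OF A'(3) _ _ sub(1), of ?B] A(2) A'(1) B(1) by simp
      moreover have "?S \<subseteq> A' \<union> ?B"
      proof
        fix x assume "x \<in> ?S"
        then obtain b k where bk: "b \<in> A' \<union> B" "k < c" "x = iter_comm a k b" by auto
        show "x \<in> A' \<union> ?B"
        proof (cases k)
          case 0 then show ?thesis using bk by auto
        next
          case (Suc k') then have "k \<in> {1..<c}" using bk by auto
          then show ?thesis using bk by blast
        qed
      qed
      moreover have "finite (A' \<union> ?B)" using A(2) A'(1) B(1) by simp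
      ultimately have S: "poly_growth ?S" by (rule poly_growth_mono)
      have "poly_growth (insert a (A' \<union> B))"
      proof (rule poly_growth_step[OF sub(3) _ _ _ S])
        show "A' \<union> B \<subseteq> carrier G" using sub(1,2) lower_central_carrier by blast
        show "finite (A' \<union> B)" using A(2) A'(1) B(1) by simp
        show "iter_comm a c b = \<one>" if "b \<in> A' \<union> B" for b using c1[OF that] .
      qed
      then show "poly_growth (A \<union> B)" using A' by simp
    qed
  qed
  from this[of "card S", rule_format, of S "{}"] step.prems show ?case by simp
qed

end

section \<open>Hyperbolic fixed points in nilpotent groups\<close>

text \<open>
  The dynamics enters the group-theoretic part only through this interface: \<open>l g x\<close> stands for the
  logarithm of the derivative of \<open>g\<close> at \<open>x\<close>. The last assumption holds for \<open>C\<^sup>1\<close> diffeomorphisms of the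
  circle because an accumulation point of fixed points has derivative \<open>1\<close>.
\<close>

locale cocycle_action = group G for G (structure) +
  fixes X :: "'x set" and act :: "'a \<Rightarrow> 'x \<Rightarrow> 'x" and l :: "'a \<Rightarrow> 'x \<Rightarrow> real" and c :: nat
  assumes act_closed: "g \<in> carrier G \<Longrightarrow> x \<in> X \<Longrightarrow> act g x \<in> X"
    and act_mult: "g \<in> carrier G \<Longrightarrow> h \<in> carrier G \<Longrightarrow> x \<in> X \<Longrightarrow> act (g \<otimes> h) x = act g (act h x)"
    and act_one: "x \<in> X \<Longrightarrow> act \<one> x = x"
    and l_mult: "g \<in> carrier G \<Longrightarrow> h \<in> carrier G \<Longrightarrow> x \<in> X \<Longrightarrow> l (g \<otimes> h) x = l g (act h x) + l h x"
    and nilp: "lower_central G c = {\<one>}"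
    and hyp_finite: "h \<in> carrier G \<Longrightarrow> d \<noteq> 0 \<Longrightarrow> finite {x \<in> X. act h x = x \<and> l h x = d}"
begin

lemma l_one: "x \<in> X \<Longrightarrow> l \<one> x = 0"
  using l_mult[of \<one> \<one> x] act_one by simp

lemma act_inv: "g \<in> carrier G \<Longrightarrow> x \<in> X \<Longrightarrow> act (inv g) (act g x) = x"
  using act_mult[of "inv g" g x] act_one by simp

lemma act_inj: "g \<in> carrier G \<Longrightarrow> x \<in> X \<Longrightarrow> y \<in> X \<Longrightarrow> act g x = act g y \<Longrightarrow> x = y"
  by (metis act_inv)

lemma l_pow:
  assumes "h \<in> carrier G" "x \<in> X" "act h x = x"
  shows "act (h [^] (n::nat)) x = x \<and> l (h [^] n) x = of_nat n * l h x"
  by (induction n) (use assms in \<open>auto simp: act_one l_one act_mult l_mult algebra_simps\<close>)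

lemma l_conj:
  assumes "h \<in> carrier G" "g \<in> carrier G" "x \<in> X" "act h x = x"
  shows "act (g \<otimes> h \<otimes> inv g) (act g x) = act g x" "l (g \<otimes> h \<otimes> inv g) (act g x) = l h x"
proof -
  have "act (g \<otimes> h \<otimes> inv g) (act g x) = act (g \<otimes> h \<otimes> inv g \<otimes> g) x"
    using assms by (subst act_mult) auto
  also have "g \<otimes> h \<otimes> inv g \<otimes> g = g \<otimes> h" using assms by (simp add: m_assoc)
  finally show "act (g \<otimes> h \<otimes> inv g) (act g x) = act g x" using assms act_mult by simp
  have "l (g \<otimes> h \<otimes> inv g \<otimes> g) x = l (g \<otimes> h \<otimes> inv g) (act g x) + l g x"
    using assms by (intro l_mult) auto
  moreover have "g \<otimes> h \<otimes> inv g \<otimes> g = g \<otimes> h" using assms by (simp add: m_assoc)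
  ultimately show "l (g \<otimes> h \<otimes> inv g) (act g x) = l h x" using l_mult[of g h x] assms by simp
qed

lemma act_pow_add:
  assumes "h \<in> carrier G" "x \<in> X"
  shows "act (h [^] (m + n :: nat)) x = act (h [^] m) (act (h [^] n) x)"
  using assms by (simp add: act_mult flip: nat_pow_mult)

text \<open>
  An injective self-map of a set with \<open>n\<close> elements has order dividing \<open>n!\<close>; this gives one exponent
  that serves for all orbits of the same size.
\<close>

lemma act_fact_card:
  assumes h: "h \<in> carrier G" and A: "finite A" "A \<subseteq> X" "act h ` A \<subseteq> A" and x: "x \<in> A"
  shows "act (h [^] (fact (card A) :: nat)) x = x"
proof -
  have in_A: "act (h [^] k) x \<in> A" for k :: nat
  proof (induction k)
    case 0 then show ?case using act_one A x by auto
  next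
    case (Suc k)
    have "act (h [^] Suc k) x = act h (act (h [^] k) x)"
      using act_pow_add[OF h, of x 1 k] A x h by auto
    then show ?case using Suc A by auto
  qed
  have "\<not> inj_on (\<lambda>k::nat. act (h [^] k) x) {0..card A}"
  proof
    assume "inj_on (\<lambda>k::nat. act (h [^] k) x) {0..card A}"
    then have "card {0..card A} \<le> card A" by (rule card_inj_on_le) (use in_A A in auto)
    then show False by simp
  qed
  then obtain i j :: nat where ij: "i < j" "j \<le> card A" "act (h [^] i) x = act (h [^] j) x"
    unfolding inj_on_def by (metis atLeastAtMost_iff linorder_neqE_nat)
  have "act (h [^] i) (act (h [^] (j - i)) x) = act (h [^] i) x"
    using act_pow_add[OF h, of x i "j - i"] ij A x by auto
  then have fx: "act (h [^] (j - i)) x = x"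
    using act_inj[of "h [^] i"] h act_closed A x by (metis (no_types, lifting) nat_pow_closed subsetD)
  have "(j - i) dvd fact (card A)" using ij by (intro dvd_fact) auto
  then obtain q where q: "fact (card A) = (j - i) * q" by auto
  have "(h [^] (j - i)) [^] q = h [^] (fact (card A) :: nat)" using h q by (simp add: nat_pow_pow)
  then show ?thesis using l_pow[of "h [^] (j - i)" x q] fx h A x by auto
qed

text \<open>
  The heart of the argument, by downward induction on \<open>j\<close>. Let \<open>O\<close> be the orbit of \<open>x\<close> under the term
  \<open>j + 1\<close> of the series, finite by induction. For \<open>g\<close> in the term \<open>j\<close>, the element \<open>h\<close> permutes the set
  \<open>g O\<close>, because it commutes with \<open>g\<close> up to the term \<open>j + 1\<close>. Hence a fixed power of \<open>h\<close> fixes \<open>g x\<close>. It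
  differs from its conjugate by \<open>g\<close> by a deeper element fixing \<open>g x\<close>, whose cocycle vanishes there by
  the hypothesis on the term \<open>i + 1\<close>. So the power has at \<open>g x\<close> the same non-zero cocycle value as at
  \<open>x\<close>, and only finitely many points qualify.
\<close>

lemma orbit_finite_step:
  assumes A: "\<And>k x. k \<in> lower_central G (Suc i) \<Longrightarrow> x \<in> X \<Longrightarrow> act k x = x \<Longrightarrow> l k x = 0"
    and h: "h \<in> lower_central G i" and x: "x \<in> X" "act h x = x" "l h x \<noteq> 0" and j: "j \<le> c"
  shows "finite ((\<lambda>g. act g x) ` lower_central G j) \<and>
    (j < c \<longrightarrow> (\<exists>M>0. \<forall>g\<in>lower_central G j.
       act (h [^] (M::nat)) (act g x) = act g x \<and> l (h [^] M) (act g x) = M * l h x))"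
  using j
proof (induction j rule: inc_induct)
  case base then show ?case using nilp by simp
next
  case (step j)
  note hc = lower_central_carrier[OF h]
  define O' where "O' = (\<lambda>g. act g x) ` lower_central G (Suc j)"
  have O': "finite O'" "O' \<subseteq> X" using step.IH x lower_central_carrier act_closed by (auto simp: O'_def)
  define M :: nat where "M = fact (card O')"
  have M: "act (h [^] M) (act g x) = act g x \<and> l (h [^] M) (act g x) = M * l h x"
    if g: "g \<in> lower_central G j" for g
  proof -
    note gc = lower_central_carrier[OF g]
    let ?A = "act g ` O'"
    have "act h ` ?A \<subseteq> ?A"
    proof clarify
      fix y assume "y \<in> O'"
      then obtain k where k: "k \<in> lower_central G (Suc j)" "y = act k x" by (auto simp: O'_def)
      note kc = lower_central_carrier[OF k(1)]
      have "inv g \<in> lower_central G j" by (rule subgroup.m_inv_closed[OF lower_central_subgroup g])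
      then have cm: "inv h \<otimes> inv g \<otimes> inv (inv h) \<otimes> inv (inv g) \<in> lower_central G (Suc j)"
        using hc by (intro lower_central_comm') auto
      define k' where "k' = inv h \<otimes> inv g \<otimes> h \<otimes> g \<otimes> k"
      have k': "k' \<in> lower_central G (Suc j)"
        using subgroup.m_closed[OF lower_central_subgroup cm k(1)] hc gc by (simp add: k'_def)
      have k'': "h \<otimes> k' \<otimes> inv h \<in> lower_central G (Suc j)"
        by (rule lower_central_conj[OF k' hc])
      note k'c = lower_central_carrier[OF k']
      have *: "a \<otimes> (inv a \<otimes> z) = z" "inv a \<otimes> (a \<otimes> z) = z" if "a \<in> carrier G" "z \<in> carrier G" for a z
        using that by (simp_all flip: m_assoc)
      have "g \<otimes> (h \<otimes> k' \<otimes> inv h) \<otimes> h = h \<otimes> g \<otimes> k"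
        using hc gc kc by (simp add: k'_def m_assoc *)
      then have "act (h \<otimes> g \<otimes> k) x = act (g \<otimes> (h \<otimes> k' \<otimes> inv h) \<otimes> h) x" by simp
      also have "\<dots> = act g (act (h \<otimes> k' \<otimes> inv h) x)"
        using hc gc k'c x by (simp add: act_mult act_closed)
      finally have "act h (act g y) = act g (act (h \<otimes> k' \<otimes> inv h) x)"
        using hc gc kc x k by (simp add: act_mult act_closed)
      then show "act h (act g y) \<in> ?A" using k'' by (auto simp: O'_def)
    qed
    moreover have "act g x \<in> ?A"
      using act_one x lower_central_one by (force simp: O'_def)
    moreover have "card ?A = card O'"
      using O' gc act_inj by (intro card_image inj_onI) blast
    moreover have "finite ?A" "?A \<subseteq> X" using O' gc act_closed by auto
    ultimately have fx: "act (h [^] M) (act g x) = act g x"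
      using act_fact_card[OF hc, of ?A "act g x"] by (simp add: M_def)
    have hM: "h [^] M \<in> lower_central G i"
      using h by (induction M) (auto simp: lower_central_one subgroup.m_closed[OF lower_central_subgroup])
    have fM: "act (h [^] M) x = x" "l (h [^] M) x = M * l h x" using l_pow[OF hc x(1,2)] by auto
    let ?k = "g \<otimes> h [^] M \<otimes> inv g \<otimes> inv (h [^] M)"
    have k: "?k \<in> lower_central G (Suc i)" by (rule lower_central_comm'[OF hM gc])
    note kc = lower_central_carrier[OF k]
    have gx: "act g x \<in> X" using act_closed gc x by auto
    note lc = l_conj[OF _ gc x(1) fM(1)]
    have eq: "?k \<otimes> h [^] M = g \<otimes> h [^] M \<otimes> inv g" using hc gc by (simp add: m_assoc)
    have "act (?k \<otimes> h [^] M) (act g x) = act ?k (act (h [^] M) (act g x))"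
      using gx kc hc by (intro act_mult) auto
    then have "act ?k (act g x) = act g x" using eq lc(1) fx hc by auto
    then have "l ?k (act g x) = 0" using A[OF k gx] by blast
    moreover have "l (?k \<otimes> h [^] M) (act g x) = l ?k (act (h [^] M) (act g x)) + l (h [^] M) (act g x)"
      using gx kc hc by (intro l_mult) auto
    ultimately have "l (h [^] M) (act g x) = M * l h x" using eq lc(2) fx fM hc by auto
    then show ?thesis using fx by blast
  qed
  have "M > 0" by (simp add: M_def)
  have "(\<lambda>g. act g x) ` lower_central G j \<subseteq> {y \<in> X. act (h [^] M) y = y \<and> l (h [^] M) y = M * l h x}"
    using M act_closed lower_central_carrier x by auto
  moreover have "finite {y \<in> X. act (h [^] M) y = y \<and> l (h [^] M) y = M * l h x}"
    using hc x \<open>M > 0\<close> by (intro hyp_finite) auto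
  ultimately show ?case using M \<open>M > 0\<close> finite_subset by blast
qed

text \<open>
  A non-zero value would give a finite orbit along which a power of \<open>k\<close> has constant non-zero cocycle.
  But the sum of the cocycle over a finite orbit is a homomorphism to \<open>\<real>\<close>, which kills commutators.
\<close>

lemma deep_cocycle_trivial:
  assumes "1 \<le> i" "i \<le> c" "k \<in> lower_central G i" "x \<in> X" "act k x = x"
  shows "l k x = 0"
  using assms(2,1,3-)
proof (induction i arbitrary: k x rule: inc_induct)
  case base then show ?case using nilp l_one by auto
next
  case (step i)
  show ?case
  proof (rule ccontr)
    assume ne: "l k x \<noteq> 0"
    define Or where "Or = (\<lambda>g. act g x) ` carrier G"
    have "0 < c" using step by auto
    with orbit_finite_step[of i k x 0] step ne obtain M :: nat where M: "M > 0"
      "\<forall>g\<in>carrier G. act (k [^] M) (act g x) = act g x \<and> l (k [^] M) (act g x) = M * l k x"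
      and fin: "finite Or"
      unfolding Or_def by (metis (no_types, lifting) One_nat_def le0 le_SucI lower_central.simps(1))
    have OX: "Or \<subseteq> X" using step.prems act_closed by (auto simp: Or_def)
    define L where "L = (\<lambda>g. \<Sum>y\<in>Or. l g y)"
    have bij: "bij_betw (act g) Or Or" if g: "g \<in> carrier G" for g
    proof -
      have "act g ` Or \<subseteq> Or"
        using g step.prems by (auto simp: Or_def act_mult[symmetric])
      moreover have "inj_on (act g) Or" using OX act_inj[OF g] by (intro inj_onI) blast
      ultimately show ?thesis using endo_inj_surj[OF fin] by (simp add: bij_betw_def)
    qed
    have L_mult: "L (g \<otimes> h) = L g + L h" if "g \<in> carrier G" "h \<in> carrier G" for g h
    proof -
      have "L (g \<otimes> h) = (\<Sum>y\<in>Or. l g (act h y) + l h y)"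
        unfolding L_def using that OX by (intro sum.cong) (auto simp: l_mult)
      also have "\<dots> = (\<Sum>y\<in>Or. l g (act h y)) + L h" by (simp add: sum.distrib L_def)
      also have "(\<Sum>y\<in>Or. l g (act h y)) = L g"
        unfolding L_def by (rule sum.reindex_bij_betw[OF bij[OF that(2)]])
      finally show ?thesis .
    qed
    have L_one: "L \<one> = 0" using L_mult[of \<one> \<one>] by simp
    have L_inv: "L (inv g) = - L g" if "g \<in> carrier G" for g
      using L_mult[of g "inv g"] L_one that by simp
    have L0: "L g = 0" if "g \<in> lower_central G 1" for g
    proof -
      have "g \<in> generate G (\<Union>h \<in> carrier G. \<Union>k \<in> carrier G. {h \<otimes> k \<otimes> inv h \<otimes> inv k})"
        using that by (simp add: lower_central.simps(2))
      then have "g \<in> carrier G \<and> L g = 0"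
        by (induction rule: generate.induct) (auto simp: L_one L_mult L_inv)
      then show ?thesis by simp
    qed
    have kc: "k \<in> carrier G" using step.prems lower_central_carrier by blast
    have "k [^] M \<in> lower_central G i"
      using step.prems(2) by (induction M) (auto simp: lower_central_one subgroup.m_closed[OF lower_central_subgroup])
    then have "L (k [^] M) = 0" using L0 lower_central_antimono[of 1 i] step.prems by auto
    moreover have "L (k [^] M) = (\<Sum>y\<in>Or. M * l k x)"
      unfolding L_def using M by (intro sum.cong) (auto simp: Or_def)
    moreover have "x \<in> Or" using step.prems act_one by (force simp: Or_def)
    ultimately show False using fin M ne by (auto simp: card_eq_0_iff)
  qed
qed

lemma hyperbolic_orbit_finite:
  assumes "h \<in> carrier G" "x \<in> X" "act h x = x" "l h x \<noteq> 0"
  shows "finite ((\<lambda>g. act g x) ` carrier G)"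
proof (cases "c = 0")
  case True
  then show ?thesis using nilp by simp
next
  case False
  have "l k y = 0" if "k \<in> lower_central G (Suc 0)" "y \<in> X" "act k y = y" for k y
    using deep_cocycle_trivial[of 1 k y] that False by auto
  from orbit_finite_step[OF this, where h = h and x = x and j = 0] show ?thesis using assms by auto
qed

end

section \<open>Lifts of circle diffeomorphisms and finite orbits\<close>

lemma frac_eq_frac_iff: "frac x = frac y \<longleftrightarrow> x - y \<in> \<int>" for x y :: real
proof
  assume "frac x = frac y"
  then have "x - y = of_int (\<lfloor>x\<rfloor> - \<lfloor>y\<rfloor>)" by (simp add: frac_def)
  then show "x - y \<in> \<int>" by simp
next
  assume "x - y \<in> \<int>"
  then obtain k where "x = y + of_int k" by (auto elim!: Ints_cases simp: algebra_simps)
  then show "frac x = frac y" by (simp add: frac_def)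
qed

lemma continuous_Ints_constant:
  fixes f :: "real \<Rightarrow> real"
  assumes "continuous_on UNIV f" "\<And>x. f x \<in> \<int>"
  shows "\<exists>k::int. \<forall>x. f x = k"
proof -
  have "f constant_on UNIV"
  proof (rule continuous_discrete_range_constant[OF connected_UNIV assms(1)])
    fix x
    show "\<exists>e>0. \<forall>y. y \<in> UNIV \<and> f y \<noteq> f x \<longrightarrow> e \<le> norm (f y - f x)"
    proof (intro exI[of _ 1] conjI allI impI)
      fix y assume "y \<in> UNIV \<and> f y \<noteq> f x"
      then have "f y - f x \<in> \<int>" "f y - f x \<noteq> 0" using assms(2) by auto
      then show "1 \<le> norm (f y - f x)" using Ints_nonzero_abs_ge1[of "f y - f x"] by simp
    qed simp
  qed
  then obtain a where a: "\<And>x. f x = a" by (auto simp: constant_on_def)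
  then have "a \<in> \<int>" using assms(2)[of 0] by simp
  then obtain k where "a = of_int k" by (rule Ints_cases)
  then show ?thesis using a by auto
qed

lemma strictly_increasing_of_deriv:
  fixes f :: "real \<Rightarrow> real"
  assumes "\<And>x. (f has_real_derivative f' x) (at x)" "\<And>x. f' x > 0" "x < y"
  shows "f x < f y"
  using DERIV_pos_imp_increasing[OF assms(3), of f] assms(1,2) by blast

lemma translation_int:
  fixes f :: "real \<Rightarrow> real"
  assumes per: "\<And>x. f (x + 1) = f x + 1"
  shows "f (x + of_int k) = f x + of_int k"
proof -
  have nat: "f (x + real n) = f x + real n" for x n
  proof (induction n)
    case (Suc n)
    have e: "y + real (Suc n) = y + real n + 1" for y by simp
    show ?case unfolding e per Suc by (rule refl)
  qed simp
  show ?thesis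
  proof (cases "k \<ge> 0")
    case True
    define n where "n = nat k"
    have "of_int k = (of_nat n :: real)" using True by (simp add: n_def)
    then show ?thesis by (simp only: nat)
  next
    case False
    define n where "n = nat (- k)"
    have k: "of_int k = - (of_nat n :: real)" using False by (simp add: n_def)
    show ?thesis using nat[of "x - of_nat n" n] unfolding k by simp
  qed
qed

text \<open>
  Each group element acts on \<open>\<real>/\<int>\<close> by an orientation-preserving \<open>C\<^sup>1\<close> diffeomorphism with a chosen lift
  \<open>L g\<close> to the line. The lifts compose only up to integer translations, so that no choice of a lifted
  group has to be made.
\<close>

locale lifted_group = group G for G (structure) +
  fixes S :: "'a set" and L D :: "'a \<Rightarrow> real \<Rightarrow> real" and c :: nat
  assumes nilp: "lower_central G c = {\<one>}"
    and S_fin: "finite S" and S_sub: "S \<subseteq> carrier G" and S_inv: "s \<in> S \<Longrightarrow> inv s \<in> S"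
    and S_gen: "generate G S = carrier G"
    and L_deriv: "g \<in> carrier G \<Longrightarrow> (L g has_real_derivative D g x) (at x)"
    and D_cont: "g \<in> carrier G \<Longrightarrow> continuous_on UNIV (D g)"
    and D_pos: "g \<in> carrier G \<Longrightarrow> D g x > 0"
    and L_period: "g \<in> carrier G \<Longrightarrow> L g (x + 1) = L g x + 1"
    and L_mult: "g \<in> carrier G \<Longrightarrow> h \<in> carrier G \<Longrightarrow> L (g \<otimes> h) x - L g (L h x) \<in> \<int>"
begin

lemma L_cont: assumes g: "g \<in> carrier G" shows "continuous_on A (L g)"
  by (rule DERIV_continuous_on[where D = "D g"], rule has_field_derivative_at_within[OF L_deriv[OF g]])

lemma L_mono: assumes g: "g \<in> carrier G" and "x < y" shows "L g x < L g y"
  by (rule strictly_increasing_of_deriv[OF L_deriv[OF g] D_pos[OF g] assms(2)])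

lemma L_mono_iff: assumes "g \<in> carrier G" shows "L g x < L g y \<longleftrightarrow> x < y"
  using L_mono[OF assms, of x y] L_mono[OF assms, of y x] by (cases x y rule: linorder_cases) auto

lemma L_inj: assumes "g \<in> carrier G" shows "L g x = L g y \<longleftrightarrow> x = y"
  using L_mono[OF assms, of x y] L_mono[OF assms, of y x] by (cases x y rule: linorder_cases) auto

lemma L_int: "g \<in> carrier G \<Longrightarrow> L g (x + of_int k) = L g x + of_int k"
  using translation_int[of "L g"] L_period by blast

lemma D_int: "g \<in> carrier G \<Longrightarrow> D g (x + of_int k) = D g x"
proof -
  assume g: "g \<in> carrier G"
  have "((\<lambda>x. L g (x + of_int k)) has_real_derivative D g (x + of_int k)) (at x)"
    by (rule DERIV_shift[THEN iffD1, OF L_deriv[OF g]])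
  moreover have "((\<lambda>x. L g (x + of_int k)) has_real_derivative D g x) (at x)"
    unfolding L_int[OF g] using L_deriv[OF g, of x] by (auto intro!: derivative_eq_intros)
  ultimately show ?thesis by (rule DERIV_unique)
qed

lemma D_frac: "g \<in> carrier G \<Longrightarrow> D g (frac x) = D g x"
  using D_int[of g x "- \<lfloor>x\<rfloor>"] by (simp add: frac_def)

lemma L_cong: "g \<in> carrier G \<Longrightarrow> x - y \<in> \<int> \<Longrightarrow> L g x - L g y \<in> \<int>"
proof -
  assume g: "g \<in> carrier G" and "x - y \<in> \<int>"
  then obtain k where "x = y + of_int k" by (auto elim!: Ints_cases simp: algebra_simps)
  then show ?thesis using L_int[OF g, of y k] by simp
qed

lemma D_cong: "g \<in> carrier G \<Longrightarrow> x - y \<in> \<int> \<Longrightarrow> D g x = D g y"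
proof -
  assume g: "g \<in> carrier G" and "x - y \<in> \<int>"
  then obtain k where "x = y + of_int k" by (auto elim!: Ints_cases simp: algebra_simps)
  then show ?thesis using D_int[OF g, of y k] by simp
qed

lemma L_mult_const:
  assumes "g \<in> carrier G" "h \<in> carrier G"
  shows "\<exists>k::int. \<forall>x. L (g \<otimes> h) x = L g (L h x) + k"
proof -
  have "continuous_on UNIV (\<lambda>x. L (g \<otimes> h) x - L g (L h x))"
    by (intro continuous_intros L_cont continuous_on_compose2[OF L_cont[OF assms(1), of UNIV] L_cont]) (use assms in auto)
  from continuous_Ints_constant[OF this L_mult[OF assms]]
  obtain k :: int where k: "\<forall>x. L (g \<otimes> h) x - L g (L h x) = k" by blast
  have "L (g \<otimes> h) x = L g (L h x) + k" for x using spec[OF k, of x] by simp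
  then show ?thesis by blast
qed

lemma D_mult:
  assumes "g \<in> carrier G" "h \<in> carrier G"
  shows "D (g \<otimes> h) x = D g (L h x) * D h x"
proof -
  obtain k :: int where k: "\<And>x. L (g \<otimes> h) x = L g (L h x) + k" using L_mult_const[OF assms] by blast
  have "((\<lambda>x. L g (L h x)) has_real_derivative D g (L h x) * D h x) (at x)"
    by (rule DERIV_chain2[OF L_deriv[OF assms(1)] L_deriv[OF assms(2)]])
  then have "((\<lambda>x. L g (L h x) + k) has_real_derivative D g (L h x) * D h x) (at x)"
    by (auto intro!: derivative_eq_intros)
  then have "(L (g \<otimes> h) has_real_derivative D g (L h x) * D h x) (at x)"
    unfolding k[abs_def] .
  then show ?thesis using L_deriv[of "g \<otimes> h" x] assms DERIV_unique by blast
qed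

lemma L_one_const: "\<exists>k::int. \<forall>x. L \<one> x = x + k"
proof -
  obtain k :: int where k: "\<And>x. L (\<one> \<otimes> \<one>) x = L \<one> (L \<one> x) + k" using L_mult_const[OF one_closed one_closed] by blast
  have "L \<one> x = x + of_int (- k)" for x
  proof -
    have "L \<one> (L \<one> x) = L \<one> (x + of_int (- k))" using k[of x] L_int[of \<one> x "-k"] by simp
    then show ?thesis using L_inj[of \<one>] by blast
  qed
  then show ?thesis by blast
qed

lemma D_one: "D \<one> x = 1"
proof -
  obtain k :: int where k: "\<And>x. L \<one> x = x + k" using L_one_const by blast
  have "(L \<one> has_real_derivative 1) (at x)" unfolding k[abs_def] by (auto intro!: derivative_eq_intros)
  then show ?thesis using L_deriv[of \<one> x] DERIV_unique by blast
qed

lemma L_inv_const: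
  assumes g: "g \<in> carrier G"
  shows "\<exists>k::int. \<forall>x. L (inv g) (L g x) = x + k"
proof -
  obtain k :: int where k: "\<And>x. L (inv g \<otimes> g) x = L (inv g) (L g x) + k" using L_mult_const[of "inv g" g] g by (meson inv_closed)
  obtain m :: int where m: "\<And>x. L \<one> x = x + m" using L_one_const by blast
  have "L (inv g) (L g x) = x + of_int (m - k)" for x using k[of x] m[of x] g by simp
  then show ?thesis by blast
qed

lemma D_inv: "g \<in> carrier G \<Longrightarrow> D (inv g) (L g x) = 1 / D g x"
  using D_mult[of "inv g" g x] D_one[of x] D_pos[of g x] by (simp add: field_simps)

lemma L_surj: assumes g: "g \<in> carrier G" obtains x where "L g x = y"
proof -
  obtain k :: int where k: "\<And>x. L (inv (inv g)) (L (inv g) x) = x + k" using L_inv_const[of "inv g"] g by (meson inv_closed)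
  have "L g (L (inv g) y + of_int (- k)) = y" using k[of y] L_int[OF g, of "L (inv g) y" "-k"] g by simp
  then show thesis using that by blast
qed

definition act :: "'a \<Rightarrow> real \<Rightarrow> real" where "act g x = frac (L g x)"

lemma act_eq_iff: "act g x = act h y \<longleftrightarrow> L g x - L h y \<in> \<int>"
  by (simp add: act_def frac_eq_frac_iff)

lemma act_one: "act \<one> x = frac x"
proof -
  obtain k :: int where "\<And>x. L \<one> x = x + k" using L_one_const by blast
  then show ?thesis by (simp add: act_def)
qed

lemma act_frac: "g \<in> carrier G \<Longrightarrow> act g (frac x) = act g x"
proof -
  assume g: "g \<in> carrier G"
  have "frac x - x \<in> \<int>" by (simp add: frac_def)
  then show ?thesis using L_cong[OF g] act_eq_iff by blast
qed

lemma act_mult: "g \<in> carrier G \<Longrightarrow> h \<in> carrier G \<Longrightarrow> act (g \<otimes> h) x = act g (act h x)"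
  using L_mult[of g h x] act_frac[of g "L h x"] by (metis act_def frac_eq_frac_iff)

text \<open>
  At an accumulation point of fixed points the difference quotients along these points equal \<open>1\<close>, so
  the derivative is \<open>1\<close>; by continuity its logarithm is also \<open>d\<close>.
\<close>

lemma hyperbolic_fixed_finite:
  assumes h: "h \<in> carrier G" and d: "d \<noteq> 0"
  shows "finite {x \<in> {0..<1}. act h x = x \<and> ln (D h x) = d}"
proof (rule ccontr)
  let ?A = "{x \<in> {0..<1}. act h x = x \<and> ln (D h x) = d}"
  assume "infinite ?A"
  moreover have "?A \<subseteq> {0..1}" by auto
  ultimately obtain p where "p islimpt ?A"
    using compact_Icc[of 0 "1::real"] unfolding compact_eq_Bolzano_Weierstrass by blast
  then obtain X where X: "\<And>n. X n \<in> ?A - {p}" "X \<longlonglongrightarrow> p" unfolding islimpt_sequential by blast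
  have cD: "isCont (D h) p" using D_cont[OF h] by (simp add: continuous_on_eq_continuous_at)
  have "(\<lambda>n. D h (X n)) \<longlonglongrightarrow> D h p" using isCont_tendsto_compose[OF cD X(2)] .
  moreover have "D h (X n) = exp d" for n using X(1)[of n] D_pos[OF h, of "X n"] by auto
  ultimately have Dp: "D h p = exp d" by (simp add: LIMSEQ_const_iff)
  let ?f = "\<lambda>x. L h x - x"
  have cL: "isCont ?f p"
    using L_cont[OF h, of UNIV] by (intro continuous_intros) (simp add: continuous_on_eq_continuous_at)
  have lim: "(\<lambda>n. ?f (X n)) \<longlonglongrightarrow> ?f p" using isCont_tendsto_compose[OF cL X(2)] .
  have int: "?f (X n) \<in> \<int>" for n
  proof -
    have "frac (L h (X n)) = frac (X n)" using X(1)[of n] by (auto simp: act_def frac_eq)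
    then show ?thesis by (simp add: frac_eq_frac_iff)
  qed
  have intp: "?f p \<in> \<int>" using closed_sequentially[OF closed_Ints _ lim] int by auto
  have "\<forall>\<^sub>F n in sequentially. dist (?f (X n)) (?f p) < 1" using tendstoD[OF lim] by simp
  then have "\<forall>\<^sub>F n in sequentially. (L h (X n) - L h p) / (X n - p) = 1"
  proof eventually_elim
    case (elim n)
    have "?f (X n) - ?f p \<in> \<int>" using int intp by (rule Ints_diff)
    then have "?f (X n) = ?f p" using elim Ints_nonzero_abs_less1[of "?f (X n) - ?f p"] by (simp add: dist_real_def)
    then show ?case using X(1)[of n] by (simp add: field_simps)
  qed
  then have "(\<lambda>n. (L h (X n) - L h p) / (X n - p)) \<longlonglongrightarrow> 1" by (rule tendsto_eventually)
  moreover have "(\<lambda>n. (L h (X n) - L h p) / (X n - p)) \<longlonglongrightarrow> D h p"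
  proof -
    have "((\<lambda>x. (L h x - L h p) / (x - p)) \<longlongrightarrow> D h p) (at p)"
      using L_deriv[OF h, of p] by (simp add: has_field_derivative_iff)
    then show ?thesis using X by (auto simp: tendsto_at_iff_sequentially o_def)
  qed
  ultimately have "D h p = 1" using LIMSEQ_unique by blast
  then show False using Dp d by simp
qed

sublocale frac_action: cocycle_action G "{0..<1}" act "\<lambda>g x. ln (D g x)" c
proof
  fix g x assume "x \<in> {0..<(1::real)}"
  then show "act \<one> x = x"
    by (simp add: act_one)
next
  fix g h x assume "g \<in> carrier G" "h \<in> carrier G" "x \<in> {0..<(1::real)}"
  then show "ln (D (g \<otimes> h) x) = ln (D g (act h x)) + ln (D h x)"
    using D_mult D_pos by (simp add: act_def D_frac ln_mult_pos)
qed (auto simp: act_def[abs_def] frac_lt_1 nilp act_mult[unfolded act_def] intro: hyperbolic_fixed_finite[unfolded act_def, simplified])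

text \<open>
  The points of the line whose projection to the circle has a finite orbit.
\<close>

definition Per :: "real set" where
  "Per = {x. finite ((\<lambda>g. act g x) ` carrier G)}"

lemma Per_frac: "frac x \<in> Per \<longleftrightarrow> x \<in> Per"
proof -
  have "(\<lambda>g. act g (frac x)) ` carrier G = (\<lambda>g. act g x) ` carrier G"
    by (rule image_cong) (auto simp: act_frac)
  then show ?thesis by (simp add: Per_def)
qed

lemma Per_cong: "x - y \<in> \<int> \<Longrightarrow> x \<in> Per \<longleftrightarrow> y \<in> Per"
  using Per_frac by (metis frac_eq_frac_iff)

lemma Per_invariant: assumes "x \<in> Per" "h \<in> carrier G" shows "L h x \<in> Per"
proof -
  have "act g (L h x) = act (g \<otimes> h) x" if "g \<in> carrier G" for g
    using act_mult[OF that assms(2)] act_frac[OF that] by (simp add: act_def)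
  then have "(\<lambda>g. act g (L h x)) ` carrier G \<subseteq> (\<lambda>g. act g x) ` carrier G"
    using assms by auto
  then show ?thesis using assms finite_subset by (auto simp: Per_def)
qed

lemma hyperbolic_in_Per:
  assumes "h \<in> carrier G" "L h x - x \<in> \<int>" "D h x \<noteq> 1"
  shows "x \<in> Per"
proof -
  have "act h (frac x) = frac x"
    using assms act_frac[of h x] by (metis act_def frac_eq_frac_iff)
  moreover have "ln (D h (frac x)) \<noteq> 0" using assms D_pos[of h x] by (simp add: D_frac)
  ultimately have "frac x \<in> Per"
    unfolding Per_def mem_Collect_eq
    by (intro frac_action.hyperbolic_orbit_finite[OF assms(1)]) (auto simp: frac_lt_1)
  then show ?thesis by (simp add: Per_frac)
qed

text \<open>
  Rigidity of finite orbits on the circle: after a translation, \<open>y\<close> lies between \<open>x\<close> and \<open>x + 1\<close>, both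
  fixed by a translate of \<open>L g\<close>. If \<open>y\<close> were moved, its iterates would be strictly monotone and bounded,
  hence pairwise distinct modulo \<open>1\<close>, although the orbit of \<open>y\<close> is finite.
\<close>

lemma Per_stab:
  assumes x: "L g x - x \<in> \<int>" and y: "y \<in> Per" and g: "g \<in> carrier G"
  shows "L g y - y \<in> \<int>"
proof -
  obtain k :: int where k: "L g x = x + k" using x by (metis Ints_cases add.commute diff_add_cancel)
  define m where "m = \<lfloor>y - x\<rfloor>"
  define z where "z = y - m"
  have z: "x \<le> z" "z < x + 1" by (auto simp: z_def m_def) linarith+
  have zP: "z \<in> Per" using y by (subst Per_cong[of z y]) (auto simp: z_def)
  define f where "f = (\<lambda>u. L g u - k)"
  have f_mono: "f u < f v \<longleftrightarrow> u < v" for u v using L_mono_iff[OF g] by (simp add: f_def)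
  have fx: "f x = x" "f (x + 1) = x + 1" using k L_period[OF g] by (auto simp: f_def)
  have "f z = z"
  proof (rule ccontr)
    assume ne: "f z \<noteq> z"
    let ?z = "\<lambda>n. (f ^^ n) z"
    have rng: "x \<le> ?z n \<and> ?z n < x + 1" for n
    proof (induction n)
      case (Suc n)
      then show ?case using fx f_mono[of "?z n" x] f_mono[of "?z n" "x+1"] by (auto simp: not_less[symmetric])
    qed (use z in auto)
    have gn: "L (g [^] n) z - ?z n \<in> \<int>" for n
    proof (induction n)
      case 0
      show ?case using act_one[of z] by (simp add: act_def frac_eq_frac_iff)
    next
      case (Suc n)
      have "L (g [^] Suc n) z - L (g \<otimes> g [^] n) z \<in> \<int>" using nat_pow_Suc2[OF g] by simp
      moreover have "L (g \<otimes> g [^] n) z - L g (L (g [^] n) z) \<in> \<int>" by (rule L_mult) (use g in auto)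
      moreover have "L g (L (g [^] n) z) - L g (?z n) \<in> \<int>" by (rule L_cong[OF g Suc])
      moreover have "L g (?z n) - ?z (Suc n) \<in> \<int>" by (simp add: f_def)
      ultimately show ?case unfolding frac_eq_frac_iff[symmetric] by simp
    qed
    have "inj (\<lambda>n. ?z n)"
    proof (cases "f z > z")
      case True
      have "?z n < ?z (Suc n)" for n by (induction n) (use True f_mono in auto)
      then show ?thesis by (intro strict_mono_imp_inj_on) (simp add: strict_mono_Suc_iff)
    next
      case False
      then have "f z < z" using ne by simp
      then have "?z n > ?z (Suc n)" for n by (induction n) (use f_mono in auto)
      then have "strict_mono (\<lambda>n. - ?z n)" by (simp add: strict_mono_Suc_iff)
      then have "inj (\<lambda>n. - ?z n)" by (rule strict_mono_imp_inj_on)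
      then show ?thesis by (auto simp: inj_def)
    qed
    moreover have "inj_on frac {x..<x+1}"
    proof (rule inj_onI)
      fix u v assume "u \<in> {x..<x+1}" "v \<in> {x..<x+1}" "frac u = frac v"
      then show "u = v" using Ints_nonzero_abs_less1[of "u - v"] by (auto simp: frac_eq_frac_iff)
    qed
    moreover have "range ?z \<subseteq> {x..<x+1}" using rng by auto
    ultimately have "inj (\<lambda>n. frac (?z n))"
      using inj_on_subset[of frac "{x..<x+1}" "range ?z"] comp_inj_on[of ?z UNIV frac] unfolding o_def by blast
    then have "infinite (range (\<lambda>n. frac (?z n)))" using finite_imageD by blast
    moreover have "range (\<lambda>n. frac (?z n)) \<subseteq> (\<lambda>g. act g z) ` carrier G"
    proof clarify
      fix n
      have "frac (?z n) = act (g [^] n) z" using gn[of n] unfolding act_def frac_eq_frac_iff[symmetric] by (rule sym)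
      then show "frac (?z n) \<in> (\<lambda>g. act g z) ` carrier G" using g by auto
    qed
    ultimately show False using zP finite_subset by (auto simp: Per_def)
  qed
  then have "L g z = z + k" by (simp add: f_def)
  moreover have "y = z + of_int m" by (simp add: z_def)
  ultimately have "L g y = y + k" using L_int[OF g, of z m] by simp
  then show ?thesis by simp
qed

lemma act_eq_iff_stab:
  assumes gh: "g \<in> carrier G" "h \<in> carrier G"
  shows "act g z = act h z \<longleftrightarrow> L (inv h \<otimes> g) z - z \<in> \<int>"
proof -
  obtain k :: int where k: "\<And>x. L (inv h \<otimes> g) x = L (inv h) (L g x) + k"
    using L_mult_const[of "inv h" g] gh by (meson inv_closed)
  obtain m :: int where m: "\<And>x. L (inv h) (L h x) = x + m" using L_inv_const[OF gh(2)] by blast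
  obtain m' :: int where m': "\<And>x. L (inv (inv h)) (L (inv h) x) = x + m'"
    using L_inv_const[of "inv h"] gh by (meson inv_closed)
  have "act g z = act h z \<longleftrightarrow> L (inv h) (L g z) - L (inv h) (L h z) \<in> \<int>"
  proof
    assume "act g z = act h z"
    then show "L (inv h) (L g z) - L (inv h) (L h z) \<in> \<int>"
      using L_cong[of "inv h"] gh by (simp add: act_eq_iff)
  next
    assume "L (inv h) (L g z) - L (inv h) (L h z) \<in> \<int>"
    then have "L h (L (inv h) (L g z)) - L h (L (inv h) (L h z)) \<in> \<int>"
      by (rule L_cong[OF gh(2)])
    moreover have "L h (L (inv h) y) = y + m'" for y using m'[of y] gh by simp
    ultimately have "(L g z + m') - (L h z + m') \<in> \<int>" by metis
    then show "act g z = act h z" by (simp add: act_eq_iff)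
  qed
  also have "L (inv h) (L g z) - L (inv h) (L h z) = L (inv h \<otimes> g) z - z - of_int (k + m)"
    using k[of z] m[of z] by simp
  also have "\<dots> \<in> \<int> \<longleftrightarrow> L (inv h \<otimes> g) z - z \<in> \<int>"
    by (metis Ints_add Ints_diff Ints_of_int diff_add_cancel)
  finally show ?thesis .
qed

text \<open>
  All finite orbits have the same stabilizers, which exhibits the set of their points as an
  intersection of closed fixed-point sets.
\<close>

lemma Per_eq_stab:
  assumes x: "x \<in> Per"
  shows "Per = (\<Inter>g \<in> {g \<in> carrier G. L g x - x \<in> \<int>}. {y. L g y - y \<in> \<int>})"
proof (intro equalityI subsetI)
  fix y assume "y \<in> Per"
  then show "y \<in> (\<Inter>g \<in> {g \<in> carrier G. L g x - x \<in> \<int>}. {y. L g y - y \<in> \<int>})"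
    using Per_stab by auto
next
  fix y assume y: "y \<in> (\<Inter>g \<in> {g \<in> carrier G. L g x - x \<in> \<int>}. {y. L g y - y \<in> \<int>})"
  have "act g y = act h y" if gh: "g \<in> carrier G" "h \<in> carrier G" "act g x = act h x" for g h
  proof -
    have "L (inv h \<otimes> g) x - x \<in> \<int>" using gh act_eq_iff_stab by blast
    then have "L (inv h \<otimes> g) y - y \<in> \<int>" using y gh by blast
    then show ?thesis using gh act_eq_iff_stab by blast
  qed
  note * = this
  let ?r = "\<lambda>u. SOME h. h \<in> carrier G \<and> act h x = u"
  have "(\<lambda>g. act g y) ` carrier G \<subseteq> (\<lambda>u. act (?r u) y) ` ((\<lambda>g. act g x) ` carrier G)"
  proof (rule image_subsetI)
    fix g assume g: "g \<in> carrier G"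
    let ?h = "?r (act g x)"
    have h: "?h \<in> carrier G \<and> act ?h x = act g x"
      by (rule someI[of "\<lambda>h. h \<in> carrier G \<and> act h x = act g x" g]) (use g in auto)
    then have "act g y = act ?h y" using *[OF g] by metis
    then show "act g y \<in> (\<lambda>u. act (?r u) y) ` ((\<lambda>g. act g x) ` carrier G)"
      using g by blast
  qed
  then show "y \<in> Per" unfolding Per_def mem_Collect_eq
    by (rule finite_subset) (use x in \<open>simp add: Per_def\<close>)
qed

lemma Per_closed: "closed Per"
proof (cases "Per = {}")
  case False
  then obtain x where x: "x \<in> Per" by auto
  show ?thesis unfolding Per_eq_stab[OF x]
  proof (intro closed_INT ballI)
    fix g assume "g \<in> {g \<in> carrier G. L g x - x \<in> \<int>}"
    then have "continuous_on UNIV (\<lambda>y. L g y - y)" by (intro continuous_intros L_cont) auto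
    then have "closed ((\<lambda>y. L g y - y) -` \<int>)"
      using continuous_on_closed_vimage[of UNIV "\<lambda>y. L g y - y"] by simp
    then show "closed {y. L g y - y \<in> \<int>}" by (simp add: vimage_def)
  qed
qed simp

end

context lifted_group
begin

lemma act_eq_transfer:
  assumes "x \<in> Per" "y \<in> Per" "g \<in> carrier G" "h \<in> carrier G" "act g x = act h x"
  shows "act g y = act h y"
proof -
  have "L (inv h \<otimes> g) x - x \<in> \<int>" using act_eq_iff_stab[OF assms(3,4), of x] assms(5) by blast
  then have "L (inv h \<otimes> g) y - y \<in> \<int>" by (rule Per_stab[OF _ assms(2)]) (use assms in auto)
  then show ?thesis using act_eq_iff_stab[OF assms(3,4), of y] by blast
qed

lemma D_eq_of_trivial_stab:
  assumes st: "\<And>h. h \<in> carrier G \<Longrightarrow> L h x - x \<in> \<int> \<Longrightarrow> D h x = 1"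
    and g: "g \<in> carrier G" and h: "h \<in> carrier G" and eq: "act g x = act h x"
  shows "D g x = D h x"
proof -
  have "L (inv h \<otimes> g) x - x \<in> \<int>" using act_eq_iff_stab[OF g h, of x] eq by blast
  then have "D (inv h \<otimes> g) x = 1" using g h by (intro st) auto
  moreover have "D (inv h \<otimes> g) x = D (inv h) (L g x) * D g x" using g h by (intro D_mult) auto
  moreover have "D (inv h) (L g x) = D (inv h) (L h x)"
    using eq h by (intro D_cong) (auto simp: act_eq_iff)
  moreover have "D (inv h) (L h x) = 1 / D h x" by (rule D_inv[OF h])
  ultimately show ?thesis using D_pos[OF h, of x] by (simp add: field_simps)
qed

text \<open>
  \<open>T\<close> represents the cosets of the stabilizer of one finite orbit, hence, by rigidity, of every finite
  orbit. Right multiplication by \<open>g\<close> permutes these cosets, and where the stabilizer has trivial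
  derivatives \<open>D t x\<close> depends only on the coset of \<open>t\<close>.
\<close>

lemma transversal_exists:
  "\<exists>T. finite T \<and> T \<noteq> {} \<and> T \<subseteq> carrier G \<and>
     (\<forall>x\<in>Per. (\<forall>h\<in>carrier G. L h x - x \<in> \<int> \<longrightarrow> D h x = 1) \<longrightarrow>
        (\<forall>g\<in>carrier G. (\<Sum>t\<in>T. D (t \<otimes> g) x) = (\<Sum>t\<in>T. D t x)))"
proof (cases "Per = {}")
  case True
  then show ?thesis by (intro exI[of _ "{\<one>}"]) auto
next
  case False
  then obtain x1 where x1: "x1 \<in> Per" by auto
  define Or where "Or = (\<lambda>g. act g x1) ` carrier G"
  have fin: "finite Or" using x1 unfolding Per_def Or_def mem_Collect_eq .
  define r where "r = (\<lambda>u. SOME g. g \<in> carrier G \<and> act g x1 = u)"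
  have r: "r u \<in> carrier G \<and> act (r u) x1 = u" if u: "u \<in> Or" for u
  proof -
    obtain g where "g \<in> carrier G \<and> act g x1 = u" using u unfolding Or_def by blast
    then show ?thesis unfolding r_def by (rule someI)
  qed
  define T where "T = r ` Or"
  have T: "finite T" "T \<subseteq> carrier G" using fin r by (auto simp: T_def)
  have "act \<one> x1 \<in> Or" unfolding Or_def by (rule imageI) simp
  then have "T \<noteq> {}" by (auto simp: T_def)
  have T_inj: "t = t'" if tt: "t \<in> T" "t' \<in> T" and eq: "act t x1 = act t' x1" for t t'
  proof -
    obtain u u' where "u \<in> Or" "t = r u" "u' \<in> Or" "t' = r u'" using tt by (auto simp: T_def)
    then show ?thesis using r[of u] r[of u'] eq by simp
  qed
  have "(\<Sum>t\<in>T. D (t \<otimes> g) x) = (\<Sum>t\<in>T. D t x)"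
    if x: "x \<in> Per" and st: "\<And>h. h \<in> carrier G \<Longrightarrow> L h x - x \<in> \<int> \<Longrightarrow> D h x = 1" and g: "g \<in> carrier G" for x g
  proof -
    define p where "p = (\<lambda>t. r (act (t \<otimes> g) x1))"
    have tg: "act (t \<otimes> g) x1 \<in> Or" if "t \<in> T" for t
      unfolding Or_def by (rule imageI) (use T(2) that g in auto)
    have p: "p t \<in> T" "p t \<in> carrier G" "act (p t) x1 = act (t \<otimes> g) x1" if "t \<in> T" for t
      using r[OF tg[OF that]] tg[OF that] by (auto simp: p_def T_def)
    have inj: "inj_on p T"
    proof (rule inj_onI)
      fix t t' assume tt: "t \<in> T" "t' \<in> T" "p t = p t'"
      have tc: "t \<in> carrier G" "t' \<in> carrier G" using tt T by auto
      have "act (t \<otimes> g) x1 = act (t' \<otimes> g) x1" using p(3) tt by metis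
      then have "act t (L g x1) = act t' (L g x1)"
        using act_mult[OF _ g] tc act_frac[of _ "L g x1"] by (simp add: act_def[of g])
      then have "act t x1 = act t' x1"
        by (rule act_eq_transfer[OF Per_invariant[OF x1 g] x1 tc])
      then show "t = t'" using T_inj tt by blast
    qed
    have "p ` T \<subseteq> T" using p(1) by blast
    then have bij: "bij_betw p T T" using endo_inj_surj[OF T(1) _ inj] inj by (simp add: bij_betw_def)
    have "(\<Sum>t\<in>T. D (t \<otimes> g) x) = (\<Sum>t\<in>T. D (p t) x)"
    proof (rule sum.cong[OF refl])
      fix t assume t: "t \<in> T"
      have c: "t \<otimes> g \<in> carrier G" using t T g by auto
      have "act (t \<otimes> g) x = act (p t) x"
        by (rule act_eq_transfer[OF x1 x c p(2)[OF t] p(3)[OF t, symmetric]])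
      from D_eq_of_trivial_stab[OF _ c p(2)[OF t] this] st
      show "D (t \<otimes> g) x = D (p t) x" by blast
    qed
    also have "\<dots> = (\<Sum>t\<in>T. D t x)" by (rule sum.reindex_bij_betw[OF bij])
    finally show ?thesis .
  qed
  note main = this
  show ?thesis
    by (intro exI[of _ T] conjI ballI impI) (use T \<open>T \<noteq> {}\<close> in \<open>simp_all add: main\<close>)
qed

end

section \<open>Word length\<close>

context lifted_group
begin

lemma carrier_words: "g \<in> carrier G \<Longrightarrow> \<exists>n. g \<in> words G S n"
proof -
  assume "g \<in> carrier G"
  then have "g \<in> generate G S" using S_gen by simp
  then show ?thesis
  proof (induction rule: generate.induct)
    case one then show ?case using words_one by blast
  next
    case (incl h) then show ?case using words_letter[OF _ S_sub] by blast
  next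
    case (inv h) then show ?case using words_letter[OF S_inv S_sub] by blast
  next
    case (eng h1 h2) then show ?case using words_mult[OF S_sub] by blast
  qed
qed

definition wlen :: "'a \<Rightarrow> nat" where "wlen g = (LEAST n. g \<in> words G S n)"

lemma wlen_words: "g \<in> carrier G \<Longrightarrow> g \<in> words G S (wlen g)"
  unfolding wlen_def using carrier_words LeastI_ex by metis

lemma wlen_le: "g \<in> words G S n \<Longrightarrow> wlen g \<le> n"
  unfolding wlen_def by (rule Least_le)

lemma wlen_list:
  assumes "g \<in> carrier G"
  obtains xs where "set xs \<subseteq> S" "length xs = wlen g" "gprod G xs = g"
proof -
  obtain xs where xs: "set xs \<subseteq> S" "length xs \<le> wlen g" "gprod G xs = g"
    using wlen_words[OF assms] unfolding words_def by blast
  moreover have "g \<in> words G S (length xs)" using xs unfolding words_def by blast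
  then have "wlen g \<le> length xs" by (rule wlen_le)
  ultimately show thesis using that by simp
qed

lemma wlen_mult_le: "g \<in> carrier G \<Longrightarrow> h \<in> carrier G \<Longrightarrow> wlen (g \<otimes> h) \<le> wlen g + wlen h"
  by (intro wlen_le words_mult[OF S_sub] wlen_words)

lemma wlen_letter: "s \<in> S \<Longrightarrow> wlen s \<le> 1"
  using wlen_le words_letter[OF _ S_sub, of s 0] by simp

lemma wlen_mult_letter:
  assumes g: "g \<in> carrier G" and s: "s \<in> S"
  shows "wlen (g \<otimes> s) \<le> wlen g + 1" "wlen g \<le> wlen (g \<otimes> s) + 1"
proof -
  have sc: "s \<in> carrier G" using s S_sub by auto
  show "wlen (g \<otimes> s) \<le> wlen g + 1"
    using wlen_mult_le[OF g sc] wlen_letter[OF s] by simp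
  have "g = (g \<otimes> s) \<otimes> inv s" using g sc by (simp add: m_assoc)
  then have "wlen g \<le> wlen (g \<otimes> s) + wlen (inv s)"
    using wlen_mult_le[of "g \<otimes> s" "inv s"] g sc by simp
  then show "wlen g \<le> wlen (g \<otimes> s) + 1" using wlen_letter[OF S_inv[OF s]] by simp
qed

lemma wlen_pow_le: "g \<in> carrier G \<Longrightarrow> wlen (g [^] n) \<le> n * wlen g" for n :: nat
proof (induction n)
  case 0 then show ?case using wlen_le[OF words_one[of S 0]] by simp
next
  case (Suc n)
  then show ?case using wlen_mult_le[of "g [^] n" g] by simp
qed

lemma wlen_ball: "{g \<in> carrier G. wlen g \<le> n} \<subseteq> words G S n"
  using wlen_words words_mono[OF order_refl] by blast

lemma finite_wlen_ball: "finite {g \<in> carrier G. wlen g \<le> n}"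
  by (rule finite_subset[OF wlen_ball words_finite[OF S_fin]])

lemma wlen_ball_card: "\<exists>C d. \<forall>n. card {g \<in> carrier G. wlen g \<le> n} \<le> C * (n + 1) ^ d"
proof -
  have "poly_growth S" by (rule nilpotent_poly_growth[OF nilp le0 S_fin]) (use S_sub in simp)
  then obtain C d where "\<forall>n. card (words G S n) \<le> C * (n + 1) ^ d" by (auto simp: poly_growth_def)
  then show ?thesis using card_mono[OF words_finite[OF S_fin] wlen_ball] order_trans by metis
qed

end

section \<open>Subexponential growth of derivatives\<close>

lemma periodic_uniform_continuity:
  fixes f :: "real \<Rightarrow> real"
  assumes cont: "continuous_on UNIV f" and per: "\<And>x (k::int). f (x + k) = f x" and e: "e > 0"
  shows "\<exists>d>0. \<forall>x y. \<bar>x - y\<bar> < d \<longrightarrow> \<bar>f x - f y\<bar> < e"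
proof -
  have "uniformly_continuous_on {-1..2} f"
    by (rule compact_uniformly_continuous[OF continuous_on_subset[OF cont]]) auto
  then obtain d where d: "d > 0" "\<And>x y. x \<in> {-1..2} \<Longrightarrow> y \<in> {-1..2} \<Longrightarrow> dist y x < d \<Longrightarrow> dist (f y) (f x) < e"
    unfolding uniformly_continuous_on_def using e by meson
  have "\<bar>f x - f y\<bar> < e" if xy: "\<bar>x - y\<bar> < min d 1" for x y
  proof -
    define k where "k = - \<lfloor>x\<rfloor>"
    have "0 \<le> x + k" "x + k < 1" unfolding k_def by linarith+
    then have "x + k \<in> {-1..2}" "y + k \<in> {-1..2}" using xy by auto
    then have "dist (f (x + k)) (f (y + k)) < e" using xy by (intro d(2)) (auto simp: dist_real_def)
    then show ?thesis by (simp add: per dist_real_def)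
  qed
  then show ?thesis using d(1) by (intro exI[of _ "min d 1"]) auto
qed

lemma periodic_bounded:
  fixes f :: "real \<Rightarrow> real"
  assumes cont: "continuous_on UNIV f" and per: "\<And>x (k::int). f (x + k) = f x"
  shows "\<exists>B. \<forall>x. f x \<le> B"
proof -
  have "compact (f ` {0..1})" by (rule compact_continuous_image[OF continuous_on_subset[OF cont]]) auto
  then obtain B where B: "\<And>y. y \<in> f ` {0..1} \<Longrightarrow> norm y \<le> B" using compact_imp_bounded bounded_iff by metis
  have "f x \<le> B" for x
  proof -
    have "f x = f (x + of_int (- \<lfloor>x\<rfloor>))" by (simp only: per)
    also have "x + of_int (- \<lfloor>x\<rfloor>) \<in> {0..1}" using of_int_floor_le[of x] real_of_int_floor_add_one_ge[of x] by (simp add: algebra_simps)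
    then have "norm (f (x + of_int (- \<lfloor>x\<rfloor>))) \<le> B" by (intro B imageI)
    then have "f (x + of_int (- \<lfloor>x\<rfloor>)) \<le> B" by simp
    finally show ?thesis .
  qed
  then show ?thesis by blast
qed

context lifted_group
begin

definition Linv :: "'a \<Rightarrow> real \<Rightarrow> real" where "Linv g y = (THE x. L g x = y)"

lemma Linv_L: assumes "g \<in> carrier G" shows "Linv g (L g x) = x"
  unfolding Linv_def by (rule the_equality) (simp_all add: L_inj[OF assms])

lemma L_Linv: assumes "g \<in> carrier G" shows "L g (Linv g y) = y"
proof -
  obtain x where "L g x = y" using L_surj[OF assms] by blast
  then show ?thesis using Linv_L[OF assms, of x] by simp
qed

lemma Linv_const: assumes "g \<in> carrier G" shows "\<exists>k::int. \<forall>y. L (inv g) y = Linv g y + k"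
proof -
  obtain k :: int where k: "\<And>x. L (inv g) (L g x) = x + k" using L_inv_const[OF assms] by blast
  have "L (inv g) y = Linv g y + k" for y using k[of "Linv g y"] L_Linv[OF assms] by simp
  then show ?thesis by blast
qed

lemma Linv_in_Per: assumes g: "g \<in> carrier G" and "y \<in> Per" shows "Linv g y \<in> Per"
proof -
  obtain k :: int where "\<And>y. L (inv g) y = Linv g y + k" using Linv_const[OF g] by blast
  then have "L (inv g) y - Linv g y \<in> \<int>" by simp
  moreover have "L (inv g) y \<in> Per" using Per_invariant[OF assms(2)] g by simp
  ultimately show ?thesis using Per_cong by blast
qed

text \<open>
  Uniform continuity of the logarithmic derivatives of the finitely many generators: at scale \<open>\<delta>\<close> the
  inverse of a generator is as contracting as at the centre, up to the factor \<open>exp \<eta>\<close>.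
\<close>

lemma Linv_local_lipschitz:
  assumes \<eta>: "\<eta> > 0"
  shows "\<exists>\<delta>>0. \<forall>s\<in>S. \<forall>x y z. \<bar>y - L s x\<bar> \<le> \<delta> \<longrightarrow> \<bar>z - L s x\<bar> \<le> \<delta> \<longrightarrow>
           \<bar>Linv s y - Linv s z\<bar> \<le> exp (\<eta> - ln (D s x)) * \<bar>y - z\<bar>"
proof -
  have "\<exists>d>0. \<forall>x y. \<bar>x - y\<bar> < d \<longrightarrow> \<bar>ln (D (inv s) x) - ln (D (inv s) y)\<bar> < \<eta>" if s: "s \<in> S" for s
  proof (rule periodic_uniform_continuity[OF _ _ \<eta>])
    have c: "inv s \<in> carrier G" using s S_sub by auto
    show "continuous_on UNIV (\<lambda>x. ln (D (inv s) x))"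
      using D_pos[OF c] by (intro continuous_on_ln D_cont[OF c]) (auto simp: less_imp_neq[symmetric])
    show "ln (D (inv s) (x + of_int k)) = ln (D (inv s) x)" for x k by (simp add: D_int[OF c])
  qed
  then obtain d where d: "\<And>s. s \<in> S \<Longrightarrow> d s > 0"
    "\<And>s x y. s \<in> S \<Longrightarrow> \<bar>x - y\<bar> < d s \<Longrightarrow> \<bar>ln (D (inv s) x) - ln (D (inv s) y)\<bar> < \<eta>"
    by metis
  define \<delta> where "\<delta> = Min (insert 1 (d ` S)) / 2"
  have "0 < Min (insert 1 (d ` S))" using S_fin d(1) by (subst Min_gr_iff) auto
  then have \<delta>: "\<delta> > 0" by (simp add: \<delta>_def)
  have \<delta>d: "\<delta> < d s" if "s \<in> S" for s
  proof -
    have "Min (insert 1 (d ` S)) \<le> d s" using S_fin that by (intro Min_le) auto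
    then show ?thesis using d(1)[OF that] by (simp add: \<delta>_def)
  qed
  have "\<bar>Linv s y - Linv s z\<bar> \<le> exp (\<eta> - ln (D s x)) * \<bar>y - z\<bar>"
    if s: "s \<in> S" and yz: "\<bar>y - L s x\<bar> \<le> \<delta>" "\<bar>z - L s x\<bar> \<le> \<delta>" for s x y z
  proof -
    have sc: "s \<in> carrier G" and c: "inv s \<in> carrier G" using s S_sub by auto
    obtain k :: int where k: "\<And>y. L (inv s) y = Linv s y + k" using Linv_const[OF sc] by blast
    have *: "\<bar>L (inv s) b - L (inv s) a\<bar> \<le> exp (\<eta> - ln (D s x)) * \<bar>b - a\<bar>"
      if ab: "a < b" "\<bar>a - L s x\<bar> \<le> \<delta>" "\<bar>b - L s x\<bar> \<le> \<delta>" for a b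
    proof -
      obtain \<xi> where \<xi>: "a < \<xi>" "\<xi> < b" "L (inv s) b - L (inv s) a = (b - a) * D (inv s) \<xi>"
        using MVT2[OF ab(1), of "L (inv s)" "D (inv s)"] L_deriv[OF c] by blast
      have "\<bar>\<xi> - L s x\<bar> < d s" using \<xi> ab \<delta>d[OF s] by linarith
      then have "ln (D (inv s) \<xi>) \<le> \<eta> + ln (D (inv s) (L s x))" using d(2)[OF s, of \<xi> "L s x"] by linarith
      also have "ln (D (inv s) (L s x)) = - ln (D s x)" using D_pos[OF sc] by (simp add: D_inv[OF sc] ln_div)
      finally have "D (inv s) \<xi> \<le> exp (\<eta> - ln (D s x))"
        using D_pos[OF c, of \<xi>] by (metis add_uminus_conv_diff exp_le_cancel_iff exp_ln)
      then have "(b - a) * D (inv s) \<xi> \<le> (b - a) * exp (\<eta> - ln (D s x))" using ab by (intro mult_left_mono) auto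
      moreover have "0 \<le> (b - a) * D (inv s) \<xi>" using ab D_pos[OF c, of \<xi>] by simp
      ultimately show ?thesis using \<xi>(3) ab by (simp add: mult.commute)
    qed
    have "Linv s y - Linv s z = L (inv s) y - L (inv s) z" by (simp add: k)
    then show ?thesis
      using *[of y z] *[of z y] yz by (cases y z rule: linorder_cases) (auto simp: abs_minus_commute)
  qed
  then show ?thesis using \<delta> by blast
qed

end

text \<open>
  A trajectory \<open>X\<close> under the generators \<open>u 0, u 1, \<dots>\<close>. The function \<open>pullback j m\<close> below follows a point
  near \<open>X j\<close> backwards to time \<open>j - m\<close>, and \<open>path_elt j m\<close> is the group element that leads from time
  \<open>j - m\<close> to time \<open>j\<close>.
\<close>

locale generator_path = lifted_group G S L D c
  for G (structure) and S L D c +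
  fixes u :: "nat \<Rightarrow> 'a" and X :: "nat \<Rightarrow> real"
  assumes u_in: "u k \<in> S" and X_Suc: "X (Suc k) = L (u k) (X k)"
begin

lemma u_carrier: "u k \<in> carrier G"
  using u_in S_sub by blast

primrec pullback :: "nat \<Rightarrow> nat \<Rightarrow> real \<Rightarrow> real" where
  "pullback j 0 y = y"
| "pullback j (Suc m) y = Linv (u (j - Suc m)) (pullback j m y)"

primrec path_elt :: "nat \<Rightarrow> nat \<Rightarrow> 'a" where
  "path_elt j 0 = \<one>"
| "path_elt j (Suc m) = path_elt j m \<otimes> u (j - Suc m)"

lemma path_elt_carrier: "path_elt j m \<in> carrier G"
  by (induction m) (auto simp: u_carrier)

lemma path_elt_pullback: "\<exists>k::int. \<forall>y. L (path_elt j m) (pullback j m y) = y + k"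
proof (induction m)
  case 0
  obtain k :: int where "\<And>y. L \<one> y = y + k" using L_one_const by blast
  then show ?case by auto
next
  case (Suc m)
  then obtain k :: int where k: "\<And>y. L (path_elt j m) (pullback j m y) = y + k" by blast
  obtain k' :: int where k': "\<And>y. L (path_elt j m \<otimes> u (j - Suc m)) y = L (path_elt j m) (L (u (j - Suc m)) y) + k'"
    using L_mult_const[OF path_elt_carrier u_carrier] by blast
  have "L (path_elt j (Suc m)) (pullback j (Suc m) y) = y + of_int (k + k')" for y
    by (simp add: k' L_Linv[OF u_carrier] k)
  then show ?case by blast
qed

lemma pullback_Per: "y \<in> Per \<Longrightarrow> pullback j m y \<in> Per"
  by (induction m) (auto intro: Linv_in_Per u_carrier)

lemma pullback_X: "m \<le> j \<Longrightarrow> pullback j m (X j) = X (j - m)"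
proof (induction m)
  case (Suc m)
  then have "X (j - m) = L (u (j - Suc m)) (X (j - Suc m))" using X_Suc[of "j - Suc m"] by (simp add: Suc_diff_Suc)
  then show ?case using Suc by (simp add: Linv_L[OF u_carrier])
qed simp

definition growth_rate :: "nat \<Rightarrow> real" where "growth_rate k = ln (D (u k) (X k))"

text \<open>
  If \<open>j\<close> is a hyperbolic time, that is, every segment of the trajectory ending at \<open>j\<close> expands at rate
  at least \<open>2 * \<eta>\<close>, then going backwards from \<open>j\<close> contracts a ball of radius \<open>\<delta>\<close>: the distortion
  \<open>\<eta>\<close> per step is allowed for as long as the pulled back ball stays within distance \<open>\<delta>\<close>, which the
  contraction itself ensures.
\<close>

lemma pullback_contraction:
  assumes \<delta>: "\<delta> > 0"
    "\<And>s x y z. s \<in> S \<Longrightarrow> \<bar>y - L s x\<bar> \<le> \<delta> \<Longrightarrow> \<bar>z - L s x\<bar> \<le> \<delta> \<Longrightarrow>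
           \<bar>Linv s y - Linv s z\<bar> \<le> exp (\<eta> - ln (D s x)) * \<bar>y - z\<bar>"
    and \<eta>: "\<eta> > 0"
    and rec: "\<And>i. i < j \<Longrightarrow> (\<Sum>k = i..<j. growth_rate k) \<ge> 2 * \<eta> * (j - i)"
    and yz: "\<bar>y - X j\<bar> \<le> \<delta>" "\<bar>z - X j\<bar> \<le> \<delta>" and m: "m \<le> j"
  shows "\<bar>pullback j m y - pullback j m z\<bar> \<le> exp (- (\<eta> * m)) * \<bar>y - z\<bar>"
proof -
  have aux: "\<bar>pullback j m y - pullback j m z\<bar> \<le> exp (\<Sum>k = j - m..<j. \<eta> - growth_rate k) * \<bar>y - z\<bar>"
    if "m \<le> j" "\<bar>y - X j\<bar> \<le> \<delta>" "\<bar>z - X j\<bar> \<le> \<delta>" for m y z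
    using that
  proof (induction m arbitrary: y z)
    case (Suc m)
    have mj: "m < j" "m \<le> j" using Suc by auto
    define i where "i = j - Suc m"
    have i: "j - m = Suc i" "i < j" using mj by (auto simp: i_def)
    have near: "\<bar>pullback j m w - L (u i) (X i)\<bar> \<le> \<delta>" if w: "\<bar>w - X j\<bar> \<le> \<delta>" for w
    proof -
      have "(\<Sum>k = j - m..<j. \<eta> - growth_rate k) \<le> 0"
      proof (cases "m = 0")
        case False
        then have "2 * \<eta> * (j - (j - m)) \<le> (\<Sum>k = j - m..<j. growth_rate k)"
          using rec[of "j - m"] mj by simp
        moreover have "(\<Sum>k = j - m..<j. \<eta> - growth_rate k) = \<eta> * m - (\<Sum>k = j - m..<j. growth_rate k)"
          using mj by (simp add: sum_subtractf)
        moreover have "\<eta> * m \<ge> 0" using \<eta> by simp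
        ultimately show ?thesis using mj by (simp add: of_nat_diff)
      qed simp
      then have "exp (\<Sum>k = j - m..<j. \<eta> - growth_rate k) * \<bar>w - X j\<bar> \<le> 1 * \<bar>w - X j\<bar>"
        by (intro mult_right_mono) auto
      moreover have "\<bar>pullback j m w - pullback j m (X j)\<bar> \<le> exp (\<Sum>k = j - m..<j. \<eta> - growth_rate k) * \<bar>w - X j\<bar>"
        by (rule Suc.IH[OF mj(2) w]) (use \<delta>(1) in simp)
      moreover have "pullback j m (X j) = L (u i) (X i)" using pullback_X[OF mj(2)] X_Suc[of i] i by simp
      ultimately show ?thesis using w by simp
    qed
    have "\<bar>pullback j (Suc m) y - pullback j (Suc m) z\<bar> = \<bar>Linv (u i) (pullback j m y) - Linv (u i) (pullback j m z)\<bar>"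
      by (simp add: i_def)
    also have "\<dots> \<le> exp (\<eta> - growth_rate i) * \<bar>pullback j m y - pullback j m z\<bar>"
      unfolding growth_rate_def by (rule \<delta>(2)[OF u_in near near]) (use Suc in auto)
    also have "\<dots> \<le> exp (\<eta> - growth_rate i) * (exp (\<Sum>k = j - m..<j. \<eta> - growth_rate k) * \<bar>y - z\<bar>)"
      by (intro mult_left_mono Suc.IH) (use Suc in auto)
    also have "\<dots> = exp ((\<eta> - growth_rate i) + (\<Sum>k = Suc i..<j. \<eta> - growth_rate k)) * \<bar>y - z\<bar>"
      by (simp add: i exp_add)
    also have "(\<eta> - growth_rate i) + (\<Sum>k = Suc i..<j. \<eta> - growth_rate k) = (\<Sum>k = i..<j. \<eta> - growth_rate k)"
      by (rule sum.atLeast_Suc_lessThan[OF i(2), symmetric])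
    finally show ?case by (simp add: i_def)
  qed simp
  have "(\<Sum>k = j - m..<j. \<eta> - growth_rate k) \<le> - (\<eta> * m)"
  proof (cases "m = 0")
    case False
    then have "2 * \<eta> * (j - (j - m)) \<le> (\<Sum>k = j - m..<j. growth_rate k)"
      using rec[of "j - m"] m by simp
    moreover have "(\<Sum>k = j - m..<j. \<eta> - growth_rate k) = \<eta> * m - (\<Sum>k = j - m..<j. growth_rate k)"
      using m by (simp add: sum_subtractf)
    ultimately show ?thesis using m by (simp add: of_nat_diff)
  qed simp
  then have "exp (\<Sum>k = j - m..<j. \<eta> - growth_rate k) * \<bar>y - z\<bar> \<le> exp (- (\<eta> * m)) * \<bar>y - z\<bar>"
    by (intro mult_right_mono) auto
  then show ?thesis using aux[OF m yz] by linarith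
qed

text \<open>
  When the trajectory nearly returns modulo \<open>1\<close>, the contraction maps the ball around \<open>X j\<close> into itself.
  Its fixed point is hyperbolic for the group element of the return, hence has a finite orbit.
\<close>

lemma pullback_fixed_point:
  assumes \<delta>: "\<delta> > 0"
    "\<And>s x y z. s \<in> S \<Longrightarrow> \<bar>y - L s x\<bar> \<le> \<delta> \<Longrightarrow> \<bar>z - L s x\<bar> \<le> \<delta> \<Longrightarrow>
           \<bar>Linv s y - Linv s z\<bar> \<le> exp (\<eta> - ln (D s x)) * \<bar>y - z\<bar>"
    and \<eta>: "\<eta> > 0"
    and rec: "\<And>i. i < j \<Longrightarrow> (\<Sum>k = i..<j. growth_rate k) \<ge> 2 * \<eta> * (j - i)"
    and m: "m \<le> j" "exp (- (\<eta> * m)) \<le> 1/2"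
    and k: "\<bar>X (j - m) + of_int k - X j\<bar> \<le> \<delta> / 2"
  shows "\<exists>p\<in>Per. \<bar>p - X j\<bar> \<le> \<delta>"
proof -
  let ?q = "exp (- (\<eta> * m))"
  have contr: "\<bar>pullback j m y - pullback j m z\<bar> \<le> ?q * \<bar>y - z\<bar>" if "\<bar>y - X j\<bar> \<le> \<delta>" "\<bar>z - X j\<bar> \<le> \<delta>" for y z
    by (rule pullback_contraction[OF \<delta> \<eta> rec that m(1)])
  have self: "\<bar>pullback j m y + of_int k - X j\<bar> \<le> \<delta>" if y: "\<bar>y - X j\<bar> \<le> \<delta>" for y
  proof -
    have "\<bar>pullback j m y - pullback j m (X j)\<bar> \<le> ?q * \<bar>y - X j\<bar>" using y \<delta>(1) by (intro contr) auto
    also have "\<dots> \<le> 1/2 * \<delta>" using m(2) y by (intro mult_mono) auto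
    finally have "\<bar>pullback j m y - X (j - m)\<bar> \<le> \<delta> / 2" using pullback_X[OF m(1)] by simp
    then show ?thesis using k by linarith
  qed
  have "\<exists>!z\<in>cball (X j) \<delta>. pullback j m z + of_int k = z"
  proof (rule Banach_fix[of _ "1/2"])
    show "complete (cball (X j) \<delta>)" by (intro compact_imp_complete compact_cball)
    show "cball (X j) \<delta> \<noteq> {}" using \<delta>(1) by simp
    show "(\<lambda>z. pullback j m z + of_int k) ` cball (X j) \<delta> \<subseteq> cball (X j) \<delta>"
      using self by (auto simp: dist_real_def abs_minus_commute)
    show "dist (pullback j m y + of_int k) (pullback j m z + of_int k) \<le> 1/2 * dist y z"
      if "y \<in> cball (X j) \<delta>" "z \<in> cball (X j) \<delta>" for y z
    proof -
      have "\<bar>pullback j m y - pullback j m z\<bar> \<le> ?q * \<bar>y - z\<bar>"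
        using that by (intro contr) (auto simp: dist_real_def abs_minus_commute)
      also have "\<dots> \<le> 1/2 * \<bar>y - z\<bar>" using m(2) by (intro mult_right_mono) auto
      finally show ?thesis by (simp add: dist_real_def)
    qed
  qed auto
  then obtain z where z: "z \<in> cball (X j) \<delta>" "pullback j m z + of_int k = z" by blast
  then have zX: "\<bar>z - X j\<bar> \<le> \<delta>" by (simp add: dist_real_def abs_minus_commute)
  let ?g = "path_elt j m"
  obtain K :: int where K: "\<And>y. L ?g (pullback j m y) = y + K" using path_elt_pullback by blast
  have "pullback j m z - z = of_int (- k)" using z(2) by simp
  then have pz: "pullback j m z - z \<in> \<int>" by simp
  have "L ?g (pullback j m z) - pullback j m z = of_int (K + k)" using K[of z] z(2) by simp
  then have fx: "L ?g (pullback j m z) - pullback j m z \<in> \<int>" by simp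
  \<comment> \<open>The branch \<open>pullback j m\<close> contracts by the factor \<open>1/2\<close>, so \<open>?g\<close> expands by at least \<open>2\<close> at its
    fixed point; continuity of the derivative turns this into a statement about \<open>D ?g\<close>.\<close>
  have "D ?g (pullback j m z) \<noteq> 1"
  proof
    assume one: "D ?g (pullback j m z) = 1"
    have "isCont (D ?g) (pullback j m z)"
      using D_cont[OF path_elt_carrier] by (simp add: continuous_on_eq_continuous_at)
    then obtain e where e: "e > 0" "\<And>\<xi>. \<bar>\<xi> - pullback j m z\<bar> < e \<Longrightarrow> \<bar>D ?g \<xi> - 1\<bar> < 1"
      unfolding continuous_at_eps_delta using one by (metis dist_real_def zero_less_one)
    define t where "t = min \<delta> e / 2"
    have t: "t > 0" "t < e" "t \<le> \<delta>" using \<delta>(1) e(1) by (auto simp: t_def)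
    define y where "y = (if z \<le> X j then z + t else z - t)"
    have y: "\<bar>y - X j\<bar> \<le> \<delta>" "\<bar>y - z\<bar> = t" using zX t by (auto simp: y_def)
    have small: "\<bar>pullback j m y - pullback j m z\<bar> \<le> ?q * t" using contr[OF y(1) zX] y(2) by simp
    also have "?q * t \<le> 1/2 * t" using m(2) t by (intro mult_right_mono) auto
    finally have small: "\<bar>pullback j m y - pullback j m z\<bar> \<le> t / 2" by simp
    have *: "\<bar>L ?g b - L ?g a\<bar> < 2 * \<bar>b - a\<bar>"
      if ab: "a < b" "\<bar>a - pullback j m z\<bar> < e" "\<bar>b - pullback j m z\<bar> < e" for a b
    proof -
      obtain \<xi> where \<xi>: "a < \<xi>" "\<xi> < b" "L ?g b - L ?g a = (b - a) * D ?g \<xi>"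
        using MVT2[OF ab(1), of "L ?g" "D ?g"] L_deriv[OF path_elt_carrier] by blast
      have "\<bar>D ?g \<xi> - 1\<bar> < 1" using \<xi> ab by (intro e(2)) linarith
      then have "D ?g \<xi> < 2" by linarith
      then have "(b - a) * D ?g \<xi> < (b - a) * 2" using that by (intro mult_strict_left_mono) auto
      moreover have "0 < (b - a) * D ?g \<xi>" using that D_pos[OF path_elt_carrier] by simp
      ultimately show ?thesis using \<xi>(3) that by (simp add: mult.commute)
    qed
    have dist: "\<bar>L ?g (pullback j m y) - L ?g (pullback j m z)\<bar> = t" using K y(2) by simp
    have ne: "pullback j m y \<noteq> pullback j m z" using dist t by auto
    have "\<bar>pullback j m y - pullback j m z\<bar> < e" "\<bar>pullback j m z - pullback j m z\<bar> < e" using small t e(1) by auto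
    then have "\<bar>L ?g (pullback j m y) - L ?g (pullback j m z)\<bar> < 2 * \<bar>pullback j m y - pullback j m z\<bar>"
      using *[of "pullback j m y" "pullback j m z"] *[of "pullback j m z" "pullback j m y"] ne
      by (cases "pullback j m y" "pullback j m z" rule: linorder_cases) (auto simp: abs_minus_commute)
    then have "t < 2 * \<bar>pullback j m y - pullback j m z\<bar>" unfolding dist .
    also have "\<dots> \<le> 2 * (t / 2)" by (intro mult_left_mono small) simp
    finally show False by simp
  qed
  then have "pullback j m z \<in> Per" by (rule hyperbolic_in_Per[OF path_elt_carrier fx])
  then have "z \<in> Per" using Per_cong[OF pz] by simp
  then show ?thesis using zX by blast
qed

end

context generator_path
begin

text \<open>
  Suppose that the sum is large. The first times at which it exceeds the multiples of
  \<open>A * (l + 1)\<close> are hyperbolic times with gaps of at least \<open>l\<close>. By the pigeonhole principle two of the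
  \<open>N + 1\<close> times are a near return, which yields a point of \<open>Per\<close> near the trajectory. Pulled back to
  time \<open>0\<close> it comes closer to \<open>X 0\<close> than \<open>r\<close>.
\<close>

lemma growth_sum_bound:
  assumes \<delta>: "\<delta> > 0"
    "\<And>s x y z. s \<in> S \<Longrightarrow> \<bar>y - L s x\<bar> \<le> \<delta> \<Longrightarrow> \<bar>z - L s x\<bar> \<le> \<delta> \<Longrightarrow>
           \<bar>Linv s y - Linv s z\<bar> \<le> exp (\<eta> - ln (D s x)) * \<bar>y - z\<bar>"
    and \<eta>: "\<eta> > 0" and A: "A > 0" "\<And>k. growth_rate k \<le> A"
    and N: "N > 0" "1 / real N \<le> \<delta> / 2"
    and l: "exp (- (\<eta> * real l)) \<le> 1/2" "exp (- (\<eta> * real l)) * \<delta> < r"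
    and far: "\<And>p. p \<in> Per \<Longrightarrow> r \<le> \<bar>X 0 - p\<bar>"
  shows "(\<Sum>k<n. growth_rate k - 2 * \<eta>) < real (N + 1) * (A * (real l + 1))"
proof (rule ccontr)
  define B where "B = A * (real l + 1)"
  define s where "s = (\<lambda>j. \<Sum>k<j. growth_rate k - 2 * \<eta>)"
  assume "\<not> ?thesis"
  then have sn: "real (N + 1) * B \<le> s n" by (simp add: s_def B_def)
  have B: "B > 0" using A by (simp add: B_def)
  have s_le: "s (j + i) \<le> s j + A * real i" for i j
  proof (induction i)
    case (Suc i)
    have "s (j + Suc i) = s (j + i) + (growth_rate (j + i) - 2 * \<eta>)" by (simp add: s_def)
    also have "\<dots> \<le> s j + A * real i + A" using Suc A(2)[of "j + i"] \<eta> by linarith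
    also have "\<dots> = s j + A * real (Suc i)" by (simp add: distrib_left)
    finally show ?case .
  qed simp
  \<comment> \<open>At a first passage time the sum \<open>s\<close> is a strict record, which is what \<open>rec\<close> below expresses.\<close>
  define t where "t = (\<lambda>q. LEAST j. real q * B \<le> s j)"
  have t1: "real q * B \<le> s (t q)" if "q \<le> N + 1" for q
  proof -
    have "real q * B \<le> real (N + 1) * B" using that B by (intro mult_right_mono) auto
    then have "real q * B \<le> s n" using sn by linarith
    then show ?thesis unfolding t_def by (rule LeastI[of "\<lambda>j. real q * B \<le> s j" n])
  qed
  have t2: "s i < real q * B" if "i < t q" for i q
    using not_less_Least[of i "\<lambda>j. real q * B \<le> s j"] that unfolding t_def by linarith
  have t3: "s (t q) \<le> real q * B + A" for q
  proof (cases "t q")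
    case 0
    have "0 \<le> real q * B" using B by simp
    then show ?thesis using 0 A by (simp add: s_def)
  next
    case (Suc i)
    then show ?thesis using t2[of i q] s_le[of i 1] by simp
  qed
  have gap: "t q + l \<le> t q'" if "q < q'" "q' \<le> N + 1" for q q'
  proof (rule ccontr)
    assume "\<not> t q + l \<le> t q'"
    then have less: "t q' < t q + l" by simp
    have "real (q + 1) * B \<le> real q' * B" using that B by (intro mult_right_mono) auto
    then have low: "real q * B + B \<le> s (t q')" using t1[OF that(2)] by (simp add: algebra_simps)
    show False
    proof (cases "t q' < t q")
      case True
      then show False using t2[of "t q'" q] low B by linarith
    next
      case False
      define i where "i = t q' - t q"
      have i: "t q' = t q + i" "i < l" using False less by (auto simp: i_def)
      have "A * real i \<le> A * (real l - 1)" using i A by (intro mult_left_mono) auto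
      then have "s (t q') \<le> real q * B + A + A * (real l - 1)" using s_le[of "t q" i] t3[of q] i(1) by simp
      also have "\<dots> < real q * B + B" using A by (simp add: B_def algebra_simps)
      finally show False using low by linarith
    qed
  qed
  have rec: "(\<Sum>k = i..<t q. growth_rate k) \<ge> 2 * \<eta> * (t q - i)" if "i < t q" "q \<le> N + 1" for i q
  proof -
    have "s (t q) = s i + (\<Sum>k = i..<t q. growth_rate k - 2 * \<eta>)"
      unfolding s_def using that sum.atLeastLessThan_concat[of 0 i "t q" "\<lambda>k. growth_rate k - 2 * \<eta>"]
      by (simp add: atLeast0LessThan)
    also have "(\<Sum>k = i..<t q. growth_rate k - 2 * \<eta>) = (\<Sum>k = i..<t q. growth_rate k) - 2 * \<eta> * (t q - i)"
      by (simp add: sum_subtractf)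
    finally show ?thesis using t1[OF that(2)] t2[OF that(1)] by linarith
  qed
  define f where "f = (\<lambda>q. \<lfloor>real N * frac (X (t q))\<rfloor>)"
  have f_range: "f ` {1..N+1} \<subseteq> {0..<int N}"
  proof
    fix v assume "v \<in> f ` {1..N+1}"
    then obtain q where q: "v = \<lfloor>real N * frac (X (t q))\<rfloor>" by (auto simp: f_def)
    have "real N * frac (X (t q)) < real N * 1" using N by (intro mult_strict_left_mono frac_lt_1) auto
    then show "v \<in> {0..<int N}" using q by (simp add: floor_less_iff)
  qed
  have "\<not> inj_on f {1..N+1}"
  proof
    assume "inj_on f {1..N+1}"
    then have "card {1..N+1} \<le> card {0..<int N}" by (rule card_inj_on_le[OF _ f_range]) simp
    then show False by simp
  qed
  then obtain a b where ab: "a \<in> {1..N+1}" "b \<in> {1..N+1}" "a \<noteq> b" "f a = f b"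
    unfolding inj_on_def by blast
  define q where "q = min a b"
  define q' where "q' = max a b"
  have q: "1 \<le> q" "q < q'" "q' \<le> N + 1" "f q = f q'" using ab by (auto simp: q_def q'_def min_def max_def)
  define j where "j = t q'"
  define m where "m = j - t q"
  have m: "m \<le> j" "l \<le> m" "j - m = t q" using gap[OF q(2,3)] by (auto simp: m_def j_def)
  have j: "l \<le> j" using m by simp
  have exp_m: "exp (- (\<eta> * real i)) \<le> exp (- (\<eta> * real l))" if "l \<le> i" for i
    using that \<eta> by simp
  define k where "k = \<lfloor>X (t q')\<rfloor> - \<lfloor>X (t q)\<rfloor>"
  have "\<bar>real N * frac (X (t q)) - real N * frac (X (t q'))\<bar> < 1"
    using q(4) unfolding f_def by linarith
  then have "real N * \<bar>frac (X (t q)) - frac (X (t q'))\<bar> < 1"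
    by (simp add: abs_mult flip: right_diff_distrib)
  then have "\<bar>frac (X (t q)) - frac (X (t q'))\<bar> < 1 / real N" using N(1) by (simp add: field_simps)
  moreover have "X (j - m) + of_int k - X j = frac (X (t q)) - frac (X (t q'))"
    by (simp add: m(3) k_def frac_def) (simp add: j_def)
  ultimately have close: "\<bar>X (j - m) + of_int k - X j\<bar> \<le> \<delta> / 2" using N(2) by linarith
  have recj: "(\<Sum>k = i..<j. growth_rate k) \<ge> 2 * \<eta> * (j - i)" if "i < j" for i
    using rec[of i q'] that q(3) by (simp add: j_def)
  have "exp (- (\<eta> * real m)) \<le> 1/2" using exp_m[OF m(2)] l(1) by linarith
  then obtain p where p: "p \<in> Per" "\<bar>p - X j\<bar> \<le> \<delta>"
    using pullback_fixed_point[OF \<delta> \<eta> recj m(1) _ close] by blast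
  have "\<bar>pullback j j p - pullback j j (X j)\<bar> \<le> exp (- (\<eta> * real j)) * \<bar>p - X j\<bar>"
    using p(2) \<delta>(1) by (intro pullback_contraction[OF \<delta> \<eta> recj]) auto
  also have "\<dots> \<le> exp (- (\<eta> * real l)) * \<delta>"
    using exp_m[OF j] p(2) by (intro mult_mono) auto
  also have "\<dots> < r" by (rule l(2))
  finally have "\<bar>X 0 - pullback j j p\<bar> < r" using pullback_X[of j j] by (simp add: abs_minus_commute)
  then show False using far[OF pullback_Per[OF p(1), of j j]] by linarith
qed

end

context lifted_group
begin

text \<open>
  A word read from its last letter is a trajectory, and the logarithm of the derivative is the sum of
  the growth rates. The bound of the preceding lemma does not depend on the length of the word.
\<close>

lemma subexponential_derivatives:
  fixes c' :: real
  assumes c': "c' > 0" and r: "r > 0"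
  shows "\<exists>n0. \<forall>g\<in>carrier G. \<forall>x. n0 \<le> wlen g \<longrightarrow> (\<forall>p\<in>Per. r \<le> \<bar>x - p\<bar>) \<longrightarrow> D g x < exp (c' * wlen g)"
proof -
  \<comment> \<open>Growth at rate \<open>4 * \<eta>\<close> gives hyperbolic times of rate \<open>2 * \<eta>\<close>; distortion uses up another \<open>\<eta>\<close>.\<close>
  define \<eta> where "\<eta> = c' / 4"
  have \<eta>: "\<eta> > 0" using c' by (simp add: \<eta>_def)
  obtain \<delta> where \<delta>: "\<delta> > 0"
    "\<And>s x y z. s \<in> S \<Longrightarrow> \<bar>y - L s x\<bar> \<le> \<delta> \<Longrightarrow> \<bar>z - L s x\<bar> \<le> \<delta> \<Longrightarrow>
           \<bar>Linv s y - Linv s z\<bar> \<le> exp (\<eta> - ln (D s x)) * \<bar>y - z\<bar>"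
    using Linv_local_lipschitz[OF \<eta>] by blast
  have "\<exists>B. \<forall>x. ln (D s x) \<le> B" if s: "s \<in> S" for s
  proof (rule periodic_bounded)
    have sc: "s \<in> carrier G" using s S_sub by auto
    show "continuous_on UNIV (\<lambda>x. ln (D s x))"
      using D_pos[OF sc] by (intro continuous_on_ln D_cont[OF sc]) (auto simp: less_imp_neq[symmetric])
    show "ln (D s (x + of_int k)) = ln (D s x)" for x k by (simp add: D_int[OF sc])
  qed
  then obtain b where b: "\<And>s x. s \<in> S \<Longrightarrow> ln (D s x) \<le> b s" by metis
  define A where "A = Max (insert 1 (b ` S))"
  have A1: "1 \<le> A" unfolding A_def using S_fin by (intro Max_ge) auto
  have A2: "ln (D s x) \<le> A" if "s \<in> S" for s x
  proof -
    have "b s \<le> A" unfolding A_def using S_fin that by (intro Max_ge) auto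
    then show ?thesis using b[OF that, of x] by linarith
  qed
  obtain N where N: "N > 0" "1 / real N < \<delta> / 2"
    using real_arch_inverse[of "\<delta> / 2"] \<delta>(1) by (auto simp: inverse_eq_divide)
  have lim: "(\<lambda>l. exp (- (\<eta> * real l))) \<longlonglongrightarrow> 0"
  proof -
    have "(\<lambda>l. exp (- \<eta>) ^ l) \<longlonglongrightarrow> 0" using \<eta> by (intro LIMSEQ_realpow_zero) auto
    then show ?thesis by (simp add: mult.commute flip: exp_of_nat_mult)
  qed
  have "\<forall>\<^sub>F l in sequentially. exp (- (\<eta> * real l)) < min (1/2) (r / \<delta>)"
    using lim r \<delta>(1) by (intro order_tendstoD(2)) auto
  then obtain l :: nat where "exp (- (\<eta> * real l)) < min (1/2) (r / \<delta>)"
    using eventually_happens'[OF sequentially_bot] by blast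
  then have l: "exp (- (\<eta> * real l)) \<le> 1/2" "exp (- (\<eta> * real l)) * \<delta> < r"
    using \<delta>(1) by (auto simp: field_simps)
  define W where "W = real (N + 1) * (A * (real l + 1))"
  obtain n0 :: nat where n0: "W / (2 * \<eta>) \<le> real n0" using real_arch_simple by blast
  have "D g x < exp (c' * wlen g)"
    if g: "g \<in> carrier G" and n: "max n0 1 \<le> wlen g" and far: "\<And>p. p \<in> Per \<Longrightarrow> r \<le> \<bar>x - p\<bar>" for g x
  proof -
    obtain xs where xs: "set xs \<subseteq> S" "length xs = wlen g" "gprod G xs = g" using wlen_list[OF g] .
    define n where "n = length xs"
    have n1: "n \<ge> 1" "n \<ge> n0" using n xs by (auto simp: n_def)
    define u where "u = (\<lambda>k. xs ! (n - Suc k))"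
    have u: "u k \<in> S" for k
    proof -
      have "n - Suc k < length xs" using n1 by (simp add: n_def)
      then show ?thesis using xs(1) nth_mem unfolding u_def by blast
    qed
    define X where "X = rec_nat x (\<lambda>k y. L (u k) y)"
    have X0: "X 0 = x" and XS: "\<And>k. X (Suc k) = L (u k) (X k)" by (auto simp: X_def)
    interpret generator_path G S L D c u X
      by unfold_locales (use u XS in auto)
    define \<gamma> where "\<gamma> = (\<lambda>k. gprod G (drop (n - k) xs))"
    have \<gamma>c: "\<gamma> k \<in> carrier G" for k
      unfolding \<gamma>_def using xs(1) S_sub set_drop_subset[of "n - k" xs] by (intro gprod_closed) blast
    have \<gamma>S: "\<gamma> (Suc k) = u k \<otimes> \<gamma> k" if "k < n" for k
    proof -
      have "n - Suc k < length xs" "Suc (n - Suc k) = n - k" using that by (auto simp: n_def)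
      then show ?thesis unfolding \<gamma>_def u_def using Cons_nth_drop_Suc[of "n - Suc k" xs] gprod_Cons by metis
    qed
    have "L (\<gamma> k) x - X k \<in> \<int> \<and> ln (D (\<gamma> k) x) = (\<Sum>i<k. growth_rate i)" if "k \<le> n" for k
      using that
    proof (induction k)
      case 0
      have e: "\<gamma> 0 = \<one>" by (simp add: \<gamma>_def n_def)
      show ?case unfolding e using act_one[of x] X0 D_one by (simp add: act_def frac_eq_frac_iff)
    next
      case (Suc k)
      then have k: "k < n" and IH: "L (\<gamma> k) x - X k \<in> \<int>" "ln (D (\<gamma> k) x) = (\<Sum>i<k. growth_rate i)" by auto
      have "L (u k \<otimes> \<gamma> k) x - L (u k) (L (\<gamma> k) x) \<in> \<int>" by (rule L_mult[OF u_carrier \<gamma>c])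
      moreover have "L (u k) (L (\<gamma> k) x) - L (u k) (X k) \<in> \<int>" by (rule L_cong[OF u_carrier IH(1)])
      ultimately have "L (u k \<otimes> \<gamma> k) x - L (u k) (L (\<gamma> k) x) + (L (u k) (L (\<gamma> k) x) - L (u k) (X k)) \<in> \<int>"
        by (rule Ints_add)
      then have 1: "L (\<gamma> (Suc k)) x - X (Suc k) \<in> \<int>" by (simp add: \<gamma>S[OF k] XS)
      have "D (\<gamma> (Suc k)) x = D (u k) (L (\<gamma> k) x) * D (\<gamma> k) x"
        unfolding \<gamma>S[OF k] by (rule D_mult[OF u_carrier \<gamma>c])
      also have "D (u k) (L (\<gamma> k) x) = D (u k) (X k)" by (rule D_cong[OF u_carrier IH(1)])
      finally have "ln (D (\<gamma> (Suc k)) x) = growth_rate k + ln (D (\<gamma> k) x)"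
        using D_pos[OF u_carrier, of k "X k"] D_pos[OF \<gamma>c, of k x] by (simp add: growth_rate_def ln_mult_pos)
      then show ?case using 1 IH(2) by simp
    qed
    from this[of n] have lnD: "ln (D g x) = (\<Sum>i<n. growth_rate i)"
      using xs(3) by (simp add: \<gamma>_def)
    have "(\<Sum>k<n. growth_rate k - 2 * \<eta>) < W"
      unfolding W_def
    proof (rule growth_sum_bound[OF \<delta> \<eta> _ _ N(1) _ l])
      show "0 < A" using A1 by simp
      show "growth_rate k \<le> A" for k unfolding growth_rate_def by (rule A2[OF u])
      show "1 / real N \<le> \<delta> / 2" using N(2) by simp
      show "r \<le> \<bar>X 0 - p\<bar>" if "p \<in> Per" for p using far[OF that] X0 by simp
    qed
    moreover have "(\<Sum>k<n. growth_rate k - 2 * \<eta>) = ln (D g x) - 2 * \<eta> * real n"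
      unfolding lnD by (simp add: sum_subtractf)
    moreover have "W \<le> 2 * \<eta> * real n"
    proof -
      have "W \<le> 2 * \<eta> * real n0" using n0 \<eta> by (simp add: field_simps)
      also have "\<dots> \<le> 2 * \<eta> * real n" using n1 \<eta> by (intro mult_left_mono) auto
      finally show ?thesis .
    qed
    ultimately have "ln (D g x) < c' * real n" by (simp add: \<eta>_def)
    then have "D g x < exp (c' * real n)" using D_pos[OF g, of x] by (metis exp_less_mono exp_ln)
    then show ?thesis using xs(2) by (simp add: n_def)
  qed
  then show ?thesis by (intro exI[of _ "max n0 1"]) blast
qed

end

section \<open>Weighted sums\<close>

lemma has_sum_diff_real:
  fixes f g :: "'g \<Rightarrow> real"
  assumes "f summable_on A" "g summable_on A"
  shows "((\<lambda>x. f x - g x) has_sum (infsum f A - infsum g A)) A"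
  using has_sum_add[OF has_sum_infsum[OF assms(1)], of "\<lambda>x. - g x" "- infsum g A"] has_sum_infsum[OF assms(2)]
  by (simp add: has_sum_uminus)

lemma summable_on_diff_real:
  fixes f g :: "'g \<Rightarrow> real"
  assumes "f summable_on A" "g summable_on A"
  shows "(\<lambda>x. f x - g x) summable_on A"
  using has_sum_diff_real[OF assms] by (rule has_sum_imp_summable)

lemma infsum_diff_real:
  fixes f g :: "'g \<Rightarrow> real"
  assumes "f summable_on A" "g summable_on A"
  shows "(\<Sum>\<^sub>\<infinity>x\<in>A. f x - g x) = infsum f A - infsum g A"
  using has_sum_diff_real[OF assms] by (rule infsumI)

lemma summable_on_abs_comparison:
  fixes f g :: "'g \<Rightarrow> real"
  assumes "g summable_on A" "\<And>x. x \<in> A \<Longrightarrow> \<bar>f x\<bar> \<le> g x"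
  shows "f summable_on A"
proof -
  have "(\<lambda>x. norm (f x)) summable_on A"
    by (rule Infinite_Sum.abs_summable_on_comparison_test'[OF assms(1)]) (use assms(2) in simp)
  then show ?thesis by (rule abs_summable_summable)
qed

text \<open>
  Dominated convergence for sums over an arbitrary index set (Tannery's theorem), along any filter.
\<close>

lemma infsum_tendsto_dominated:
  fixes a :: "'g \<Rightarrow> 't \<Rightarrow> real"
  assumes B: "B summable_on A"
    and bound: "\<forall>\<^sub>F t in F. \<forall>g\<in>A. \<bar>a g t\<bar> \<le> B g"
    and lim: "\<And>g. g \<in> A \<Longrightarrow> (a g \<longlongrightarrow> \<alpha> g) F"
  shows "((\<lambda>t. \<Sum>\<^sub>\<infinity>g\<in>A. a g t) \<longlongrightarrow> (\<Sum>\<^sub>\<infinity>g\<in>A. \<alpha> g)) F"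
proof (cases "F = bot")
  case False
  define Y where "Y = {t. \<forall>g\<in>A. \<bar>a g t\<bar> \<le> B g}"
  have \<alpha>: "\<bar>\<alpha> g\<bar> \<le> B g" if g: "g \<in> A" for g
  proof (rule tendsto_upperbound[OF tendsto_rabs[OF lim[OF g]] _ False])
    show "\<forall>\<^sub>F t in F. \<bar>a g t\<bar> \<le> B g" using bound by eventually_elim (use g in blast)
  qed
  have \<alpha>s: "\<alpha> summable_on A"
    by (rule summable_on_abs_comparison[OF B \<alpha>])
  have u: "uniform_limit Y (\<lambda>E t. \<Sum>g\<in>E. a g t) (\<lambda>t. \<Sum>\<^sub>\<infinity>g\<in>A. a g t) (finite_subsets_at_top A)"
    by (rule Weierstrass_m_test_general[OF _ B]) (simp add: Y_def)
  show ?thesis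
  proof (rule swap_uniform_limit'[OF _ _ u])
    show "\<forall>\<^sub>F E in finite_subsets_at_top A. ((\<lambda>t. \<Sum>g\<in>E. a g t) \<longlongrightarrow> (\<Sum>g\<in>E. \<alpha> g)) F"
      by (rule eventually_finite_subsets_at_top_weakI) (intro tendsto_sum lim, blast)
    show "((\<lambda>E. \<Sum>g\<in>E. \<alpha> g) \<longlongrightarrow> (\<Sum>\<^sub>\<infinity>g\<in>A. \<alpha> g)) (finite_subsets_at_top A)"
      using infsum_tendsto[OF \<alpha>s] .
    show "\<forall>\<^sub>F t in F. t \<in> Y" using bound by (simp add: Y_def)
  qed simp
qed simp

text \<open>
  The quotient is the average of \<open>w' / w\<close> with respect to the weights \<open>w g * a g t\<close>. Outside a finite set
  this ratio is close to \<open>1\<close>. In the first case the finite set becomes negligible because the total mass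
  tends to infinity. In the second case it contributes almost \<open>\<kappa>\<close> times the sum of \<open>w' - w\<close> over
  a large finite set, which is small because the total sums agree.
\<close>

lemma weighted_quotient_tendsto_1:
  fixes a :: "'g \<Rightarrow> 't \<Rightarrow> real" and w w' :: "'g \<Rightarrow> real"
  assumes w: "\<And>g. g \<in> A \<Longrightarrow> w g > 0" and g0: "g0 \<in> A"
    and cof: "\<And>\<eta>. \<eta> > 0 \<Longrightarrow> finite {g \<in> A. \<eta> * w g < \<bar>w' g - w g\<bar>}"
    and pos: "\<forall>\<^sub>F t in F. \<forall>g\<in>A. a g t > 0"
    and sum: "\<forall>\<^sub>F t in F. (\<lambda>g. w g * a g t) summable_on A \<and> (\<lambda>g. w' g * a g t) summable_on A"
    and lim: "\<And>g. g \<in> A \<Longrightarrow> (a g \<longlongrightarrow> \<alpha> g) F"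
    and cases: "(\<forall>B. \<exists>E. finite E \<and> E \<subseteq> A \<and> B < (\<Sum>g\<in>E. w g * \<alpha> g)) \<or>
      (\<exists>\<kappa>>0. (\<forall>g\<in>A. \<alpha> g = \<kappa>) \<and> w summable_on A \<and> w' summable_on A \<and>
         (\<Sum>\<^sub>\<infinity>g\<in>A. w' g) = (\<Sum>\<^sub>\<infinity>g\<in>A. w g))"
  shows "((\<lambda>t. (\<Sum>\<^sub>\<infinity>g\<in>A. w' g * a g t) / (\<Sum>\<^sub>\<infinity>g\<in>A. w g * a g t)) \<longlongrightarrow> 1) F"
proof (rule tendstoI)
  fix e :: real assume e: "e > 0"
  define \<eta> where "\<eta> = e / 3"
  have \<eta>: "\<eta> > 0" using e by (simp add: \<eta>_def)
  define E where "E = {g \<in> A. \<eta> * w g < \<bar>w' g - w g\<bar>}"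
  have E: "finite E" "E \<subseteq> A" using cof[OF \<eta>] by (auto simp: E_def)
  have "\<exists>E1 E2. finite E1 \<and> E \<subseteq> E1 \<and> E1 \<subseteq> A \<and> finite E2 \<and> E2 \<subseteq> A \<and>
      \<bar>\<Sum>g\<in>E1. (w' g - w g) * \<alpha> g\<bar> < \<eta> * (\<Sum>g\<in>E2. w g * \<alpha> g)"
    using cases
  proof
    assume *: "\<forall>B. \<exists>E. finite E \<and> E \<subseteq> A \<and> B < (\<Sum>g\<in>E. w g * \<alpha> g)"
    obtain E2 where E2: "finite E2" "E2 \<subseteq> A" "\<bar>\<Sum>g\<in>E. (w' g - w g) * \<alpha> g\<bar> / \<eta> < (\<Sum>g\<in>E2. w g * \<alpha> g)"
      using * by blast
    have "\<bar>\<Sum>g\<in>E. (w' g - w g) * \<alpha> g\<bar> < \<eta> * (\<Sum>g\<in>E2. w g * \<alpha> g)"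
      using E2(3) \<eta> by (simp add: field_simps)
    then show ?thesis using E E2 by blast
  next
    assume "\<exists>\<kappa>>0. (\<forall>g\<in>A. \<alpha> g = \<kappa>) \<and> w summable_on A \<and> w' summable_on A \<and>
         (\<Sum>\<^sub>\<infinity>g\<in>A. w' g) = (\<Sum>\<^sub>\<infinity>g\<in>A. w g)"
    then obtain \<kappa> where \<kappa>: "\<kappa> > 0" "\<And>g. g \<in> A \<Longrightarrow> \<alpha> g = \<kappa>"
      and s: "w summable_on A" "w' summable_on A" "(\<Sum>\<^sub>\<infinity>g\<in>A. w' g) = (\<Sum>\<^sub>\<infinity>g\<in>A. w g)" by blast
    have "(\<lambda>g. w' g - w g) summable_on A" by (rule summable_on_diff_real[OF s(2,1)])
    moreover have "(\<Sum>\<^sub>\<infinity>g\<in>A. w' g - w g) = 0" using infsum_diff_real[OF s(2,1)] s(3) by simp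
    ultimately have "((\<lambda>E. \<Sum>g\<in>E. w' g - w g) \<longlongrightarrow> 0) (finite_subsets_at_top A)"
      using infsum_tendsto by force
    then have "\<forall>\<^sub>F E in finite_subsets_at_top A. dist (\<Sum>g\<in>E. w' g - w g) 0 < \<eta> * w g0"
      using \<eta> w[OF g0] by (intro tendstoD) auto
    then obtain E0 where E0: "finite E0" "E0 \<subseteq> A"
      "\<And>E'. finite E' \<Longrightarrow> E0 \<subseteq> E' \<Longrightarrow> E' \<subseteq> A \<Longrightarrow> dist (\<Sum>g\<in>E'. w' g - w g) 0 < \<eta> * w g0"
      unfolding eventually_finite_subsets_at_top by metis
    have *: "\<bar>\<Sum>g\<in>E \<union> E0. w' g - w g\<bar> < \<eta> * w g0" using E0(3)[of "E \<union> E0"] E E0(1,2) by simp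
    have "(\<Sum>g\<in>E \<union> E0. (w' g - w g) * \<alpha> g) = (\<Sum>g\<in>E \<union> E0. w' g - w g) * \<kappa>"
      unfolding sum_distrib_right using E E0 \<kappa>(2) by (intro sum.cong) auto
    then have "\<bar>\<Sum>g\<in>E \<union> E0. (w' g - w g) * \<alpha> g\<bar> = \<bar>\<Sum>g\<in>E \<union> E0. w' g - w g\<bar> * \<kappa>"
      using \<kappa>(1) by (simp add: abs_mult)
    also have "\<dots> < \<eta> * w g0 * \<kappa>" using * \<kappa>(1) by (intro mult_strict_right_mono) auto
    also have "\<dots> = \<eta> * (\<Sum>g\<in>{g0}. w g * \<alpha> g)" using \<kappa>(2)[OF g0] by simp
    finally have "\<bar>\<Sum>g\<in>E \<union> E0. (w' g - w g) * \<alpha> g\<bar> < \<eta> * (\<Sum>g\<in>{g0}. w g * \<alpha> g)" .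
    moreover have "finite (E \<union> E0)" "E \<subseteq> E \<union> E0" "E \<union> E0 \<subseteq> A" "finite {g0}" "{g0} \<subseteq> A"
      using E E0 g0 by auto
    ultimately show ?thesis by blast
  qed
  then obtain E1 E2 where E1: "finite E1" "E \<subseteq> E1" "E1 \<subseteq> A" and E2: "finite E2" "E2 \<subseteq> A"
    and less: "\<bar>\<Sum>g\<in>E1. (w' g - w g) * \<alpha> g\<bar> < \<eta> * (\<Sum>g\<in>E2. w g * \<alpha> g)" by blast
  have l1: "((\<lambda>t. \<bar>\<Sum>g\<in>E1. (w' g - w g) * a g t\<bar>) \<longlongrightarrow> \<bar>\<Sum>g\<in>E1. (w' g - w g) * \<alpha> g\<bar>) F"
    by (intro tendsto_rabs tendsto_sum tendsto_mult tendsto_const lim) (use E1 in blast)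
  have l2: "((\<lambda>t. \<eta> * (\<Sum>g\<in>E2. w g * a g t)) \<longlongrightarrow> \<eta> * (\<Sum>g\<in>E2. w g * \<alpha> g)) F"
    by (intro tendsto_sum tendsto_mult tendsto_const lim) (use E2 in blast)
  have "\<forall>\<^sub>F t in F. 0 < \<eta> * (\<Sum>g\<in>E2. w g * a g t) - \<bar>\<Sum>g\<in>E1. (w' g - w g) * a g t\<bar>"
    by (rule order_tendstoD(1)[OF tendsto_diff[OF l2 l1]]) (use less in simp)
  with pos sum
  show "\<forall>\<^sub>F t in F. dist ((\<Sum>\<^sub>\<infinity>g\<in>A. w' g * a g t) / (\<Sum>\<^sub>\<infinity>g\<in>A. w g * a g t)) 1 < e"
  proof eventually_elim
    case (elim t)
    let ?a = "\<lambda>g. a g t"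
    have a: "a g t > 0" if "g \<in> A" for g using elim(1) that by blast
    have s1: "(\<lambda>g. w g * ?a g) summable_on A" and s2: "(\<lambda>g. w' g * ?a g) summable_on A" using elim(2) by auto
    define W where "W = (\<Sum>\<^sub>\<infinity>g\<in>A. w g * ?a g)"
    have nn: "0 \<le> w g * ?a g" if "g \<in> A" for g using a[OF that] w[OF that] by simp
    have fin_le: "(\<Sum>g\<in>E'. w g * ?a g) \<le> W" if "finite E'" "E' \<subseteq> A" for E'
      unfolding W_def by (rule finite_sum_le_infsum[OF s1 that]) (use nn in auto)
    have "0 < w g0 * ?a g0" using a[OF g0] w[OF g0] by simp
    also have "\<dots> \<le> W" using fin_le[of "{g0}"] g0 by simp
    finally have W: "W > 0" .
    have sd: "(\<lambda>g. (w' g - w g) * ?a g) summable_on A"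
      using summable_on_diff_real[OF s2 s1] by (simp add: left_diff_distrib)
    have "(\<Sum>\<^sub>\<infinity>g\<in>A. w' g * ?a g) - W = (\<Sum>\<^sub>\<infinity>g\<in>A. (w' g - w g) * ?a g)"
      unfolding W_def left_diff_distrib by (rule infsum_diff_real[OF s2 s1, symmetric])
    also have "\<dots> = (\<Sum>g\<in>E1. (w' g - w g) * ?a g) + (\<Sum>\<^sub>\<infinity>g\<in>A - E1. (w' g - w g) * ?a g)"
    proof -
      have sE: "(\<lambda>g. (w' g - w g) * ?a g) summable_on E1" "(\<lambda>g. (w' g - w g) * ?a g) summable_on (A - E1)"
        using summable_on_subset_banach[OF sd] E1(3) by auto
      have "A = E1 \<union> (A - E1)" using E1(3) by blast
      then have "(\<Sum>\<^sub>\<infinity>g\<in>A. (w' g - w g) * ?a g) = (\<Sum>\<^sub>\<infinity>g\<in>E1 \<union> (A - E1). (w' g - w g) * ?a g)" by simp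
      also have "\<dots> = (\<Sum>\<^sub>\<infinity>g\<in>E1. (w' g - w g) * ?a g) + (\<Sum>\<^sub>\<infinity>g\<in>A - E1. (w' g - w g) * ?a g)"
        by (rule infsum_Un_disjoint[OF sE]) blast
      finally show ?thesis using E1(1) by simp
    qed
    finally have eq: "(\<Sum>\<^sub>\<infinity>g\<in>A. w' g * ?a g) - W =
        (\<Sum>g\<in>E1. (w' g - w g) * ?a g) + (\<Sum>\<^sub>\<infinity>g\<in>A - E1. (w' g - w g) * ?a g)" .
    have "\<bar>\<Sum>g\<in>E1. (w' g - w g) * ?a g\<bar> < \<eta> * (\<Sum>g\<in>E2. w g * ?a g)" using elim(3) by simp
    also have "\<dots> \<le> \<eta> * W" using \<eta> by (intro mult_left_mono fin_le E2) auto
    finally have p1: "\<bar>\<Sum>g\<in>E1. (w' g - w g) * ?a g\<bar> < \<eta> * W" .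
    have sw: "(\<lambda>g. \<eta> * (w g * ?a g)) summable_on A" by (rule summable_on_cmult_right[OF s1])
    have tail: "\<bar>(w' g - w g) * ?a g\<bar> \<le> \<eta> * (w g * ?a g)" if g: "g \<in> A - E1" for g
    proof -
      have "\<bar>w' g - w g\<bar> \<le> \<eta> * w g" using g E1(2) by (auto simp: E_def)
      then have "\<bar>w' g - w g\<bar> * ?a g \<le> \<eta> * w g * ?a g" using a[of g] g by (intro mult_right_mono) auto
      then show ?thesis using a[of g] g by (simp add: abs_mult mult.assoc)
    qed
    have swE: "(\<lambda>g. \<eta> * (w g * ?a g)) summable_on (A - E1)" by (rule summable_on_subset_banach[OF sw]) blast
    have "\<bar>\<Sum>\<^sub>\<infinity>g\<in>A - E1. (w' g - w g) * ?a g\<bar> \<le> (\<Sum>\<^sub>\<infinity>g\<in>A - E1. \<eta> * (w g * ?a g))"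
      using norm_infsum_le[OF has_sum_infsum[OF summable_on_subset_banach[OF sd, of "A - E1"]] has_sum_infsum[OF swE]] tail
      by auto
    also have "\<dots> \<le> (\<Sum>\<^sub>\<infinity>g\<in>A. \<eta> * (w g * ?a g))"
      by (rule infsum_mono2[OF swE sw]) (use nn \<eta> in auto)
    also have "\<dots> = \<eta> * W" unfolding W_def by (rule infsum_cmult_right[OF s1])
    finally have "\<bar>(\<Sum>\<^sub>\<infinity>g\<in>A. w' g * ?a g) - W\<bar> < 2 * \<eta> * W" using p1 eq by linarith
    then have "\<bar>(\<Sum>\<^sub>\<infinity>g\<in>A. w' g * ?a g) - W\<bar> / W < 2 * \<eta>" using W by (simp add: field_simps)
    moreover have "(\<Sum>\<^sub>\<infinity>g\<in>A. w' g * ?a g) / W - 1 = ((\<Sum>\<^sub>\<infinity>g\<in>A. w' g * ?a g) - W) / W"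
      using W by (simp add: field_simps)
    then have "dist ((\<Sum>\<^sub>\<infinity>g\<in>A. w' g * ?a g) / W) 1 = \<bar>(\<Sum>\<^sub>\<infinity>g\<in>A. w' g * ?a g) - W\<bar> / W"
      using W by (simp add: dist_real_def abs_divide)
    moreover have "2 * \<eta> < e" using e by (simp add: \<eta>_def)
    ultimately show ?case unfolding W_def[symmetric] by linarith
  qed
qed

lemma poly_le_exp:
  assumes "a > 0"
  shows "\<exists>K. \<forall>n::nat. real (n + 1) ^ d \<le> K * exp (a * real n)"
proof -
  define b where "b = a / real (d + 1)"
  define q where "q = min b 1"
  have b: "b > 0" and q: "q > 0" using assms by (auto simp: b_def q_def)
  have "real (n + 1) ^ d \<le> (1 / q) ^ d * exp (a * real n)" for n
  proof -
    have "q * real n \<le> b * real n" by (intro mult_right_mono) (auto simp: q_def)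
    moreover have "q \<le> 1" by (simp add: q_def)
    ultimately have "q * real (n + 1) \<le> 1 + b * real n" by (simp add: distrib_left)
    also have "\<dots> \<le> exp (b * real n)" by (rule exp_ge_add_one_self)
    finally have "real (n + 1) \<le> (1 / q) * exp (b * real n)" using q by (simp add: field_simps)
    then have "real (n + 1) ^ d \<le> ((1 / q) * exp (b * real n)) ^ d" by (intro power_mono) auto
    also have "\<dots> = (1 / q) ^ d * exp (real d * (b * real n))" by (simp only: power_mult_distrib exp_of_nat_mult)
    also have "real d * (b * real n) \<le> a * real n"
    proof -
      have "real d * b \<le> real (d + 1) * b" using b by (intro mult_right_mono) auto
      also have "\<dots> = a" by (simp add: b_def)
      finally have "real d * b * real n \<le> a * real n" by (intro mult_right_mono) auto
      then show ?thesis by (simp add: mult.assoc)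
    qed
    then have "(1 / q) ^ d * exp (real d * (b * real n)) \<le> (1 / q) ^ d * exp (a * real n)"
      using q by (intro mult_left_mono) auto
    finally show ?thesis .
  qed
  then show ?thesis by blast
qed

section \<open>Slowly decaying weights\<close>

text \<open>
  A positive combination of the exponentials \<open>n \<mapsto> exp (- \<epsilon> n / (k + 1))\<close>. For large \<open>n\<close> the terms with
  large \<open>k\<close> dominate, so the decay becomes subexponential; if the coefficients tend to zero fast enough,
  every sum converging against each of the exponentials still converges against the mixture.
\<close>

locale exp_mixture =
  fixes \<epsilon> :: real and c :: "nat \<Rightarrow> real"
  assumes eps: "\<epsilon> > 0" and c_pos: "c k > 0" and c_le: "c k \<le> (1/2) ^ k"
begin

definition rate :: "nat \<Rightarrow> real" where "rate k = \<epsilon> / real (k + 1)"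
definition v :: "nat \<Rightarrow> real" where "v n = (\<Sum>k. c k * exp (- (rate k * real n)))"

lemma rate_pos: "rate k > 0"
  using eps by (simp add: rate_def)

lemma rate_antimono: "k \<le> k' \<Longrightarrow> rate k' \<le> rate k"
  using eps by (auto simp: rate_def intro!: divide_left_mono)

lemma rate_le: "rate k \<le> \<epsilon>"
  using rate_antimono[of 0 k] by (simp add: rate_def)

lemma term_pos: "c k * exp (- (rate k * real n)) > 0"
  using c_pos by simp

lemma term_le: "c k * exp (- (rate k * real n)) \<le> (1/2) ^ k"
proof -
  have "c k * exp (- (rate k * real n)) \<le> c k * 1"
    using c_pos[of k] rate_pos[of k] by (intro mult_left_mono) auto
  then show ?thesis using c_le[of k] by simp
qed

lemma v_summable: "summable (\<lambda>k. c k * exp (- (rate k * real n)))"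
proof (rule summable_comparison_test'[of "\<lambda>k. (1/2::real) ^ k" 0])
  show "summable (\<lambda>k. (1/2::real) ^ k)" by (rule summable_geometric) simp
  show "norm (c k * exp (- (rate k * real n))) \<le> (1/2) ^ k" for k
    using term_le[of k n] term_pos[of k n] by simp
qed

lemma term_le_v: "c k * exp (- (rate k * real n)) \<le> v n"
  unfolding v_def using sum_le_suminf[OF v_summable, of "{k}" n] term_pos by (simp add: less_imp_le)

lemma v_pos: "v n > 0"
  using term_le_v[of 0 n] term_pos[of 0 n] by linarith

lemma term_Suc: "c k * exp (- (rate k * real (Suc n))) = exp (- rate k) * (c k * exp (- (rate k * real n)))"
  by (simp add: distrib_left exp_add[symmetric] mult.left_commute)

lemma v_Suc_le: "v (Suc n) \<le> v n"
  unfolding v_def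
proof (rule suminf_le[OF _ v_summable v_summable])
  fix k
  have "exp (- rate k) * (c k * exp (- (rate k * real n))) \<le> 1 * (c k * exp (- (rate k * real n)))"
    using rate_pos[of k] term_pos[of k n] by (intro mult_right_mono) auto
  then show "c k * exp (- (rate k * real (Suc n))) \<le> c k * exp (- (rate k * real n))"
    unfolding term_Suc by simp
qed

lemma v_Suc_ge: "exp (- \<epsilon>) * v n \<le> v (Suc n)"
  unfolding v_def suminf_mult[OF v_summable, symmetric]
proof (rule suminf_le[OF _ summable_mult[OF v_summable] v_summable])
  fix k
  show "exp (- \<epsilon>) * (c k * exp (- (rate k * real n))) \<le> c k * exp (- (rate k * real (Suc n)))"
    unfolding term_Suc using rate_le[of k] term_pos[of k n] by (intro mult_right_mono) auto
qed

text \<open>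
  The terms of rate at most \<open>\<eta> / 2\<close> lose at most this fraction in one step. The finitely many others
  are eventually negligible against the term number \<open>K\<close>.
\<close>

lemma v_slow:
  assumes \<eta>: "\<eta> > 0"
  shows "\<exists>n1. \<forall>n\<ge>n1. v n - v (Suc n) \<le> \<eta> * v n"
proof -
  obtain K where K: "K > 0" "\<epsilon> / real K < \<eta> / 2"
  proof -
    obtain K where "K > 0" "inverse (real K) < \<eta> / (2 * \<epsilon>)"
      using real_arch_inverse[of "\<eta> / (2 * \<epsilon>)"] \<eta> eps by auto
    then show thesis using that[of K] eps by (simp add: field_simps)
  qed
  let ?t = "\<lambda>k n. c k * exp (- (rate k * real n))"
  have "\<forall>\<^sub>F n in sequentially. ?t k n \<le> (\<eta> / (2 * K)) * ?t K n" if k: "k < K" for k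
  proof -
    have "rate K < rate k" unfolding rate_def using k eps by (intro divide_strict_left_mono) auto
    then have d: "rate k - rate K > 0" by simp
    have "(\<lambda>n. exp (- (rate k - rate K)) ^ n) \<longlonglongrightarrow> 0" using d by (intro LIMSEQ_realpow_zero) auto
    moreover have "0 < \<eta> / (2 * K) * c K / c k" using \<eta> K(1) c_pos by simp
    ultimately have "\<forall>\<^sub>F n in sequentially. exp (- (rate k - rate K)) ^ n < \<eta> / (2 * K) * c K / c k"
      by (rule order_tendstoD(2))
    then show ?thesis
    proof eventually_elim
      case (elim n)
      have "exp (- (rate k * real n)) = exp (- (rate k - rate K)) ^ n * exp (- (rate K * real n))"
        by (simp add: exp_of_nat_mult[symmetric] exp_add[symmetric] algebra_simps)
      then have "?t k n = c k * (exp (- (rate k - rate K)) ^ n * exp (- (rate K * real n)))" by simp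
      also have "\<dots> \<le> c k * (\<eta> / (2 * K) * c K / c k * exp (- (rate K * real n)))"
        using elim c_pos[of k] by (intro mult_left_mono mult_right_mono) auto
      also have "\<dots> = (\<eta> / (2 * K)) * ?t K n" using c_pos[of k] by simp
      finally show ?case .
    qed
  qed
  then have "\<forall>\<^sub>F n in sequentially. \<forall>k\<in>{..<K}. ?t k n \<le> (\<eta> / (2 * K)) * ?t K n"
    by (intro eventually_ball_finite) auto
  then obtain n1 where n1: "\<And>n k. n \<ge> n1 \<Longrightarrow> k < K \<Longrightarrow> ?t k n \<le> (\<eta> / (2 * K)) * ?t K n"
    unfolding eventually_sequentially by blast
  have "v n - v (Suc n) \<le> \<eta> * v n" if n: "n \<ge> n1" for n
  proof -
    let ?d = "\<lambda>k. (if k < K then ?t k n else 0) + (\<eta> / 2) * ?t k n"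
    have s1: "summable (\<lambda>k. if k < K then ?t k n else 0)"
      by (rule summable_finite[of "{..<K}"]) auto
    have "v n - v (Suc n) = (\<Sum>k. ?t k n - ?t k (Suc n))"
      unfolding v_def by (rule suminf_diff[OF v_summable v_summable])
    also have "\<dots> \<le> (\<Sum>k. ?d k)"
    proof (rule suminf_le[OF _ summable_diff[OF v_summable v_summable] summable_add[OF s1 summable_mult[OF v_summable]]])
      fix k
      have e: "?t k n - ?t k (Suc n) = (1 - exp (- rate k)) * ?t k n" unfolding term_Suc by (simp add: left_diff_distrib)
      show "?t k n - ?t k (Suc n) \<le> ?d k"
      proof (cases "k < K")
        case True
        have "?t k (Suc n) > 0" "(\<eta> / 2) * ?t k n > 0" using term_pos[of k n] term_pos[of k "Suc n"] \<eta> by auto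
        then show ?thesis using True by simp
      next
        case False
        have "1 - exp (- rate k) \<le> rate k" using exp_ge_add_one_self[of "- rate k"] by simp
        also have "\<dots> \<le> rate (K - 1)" using False by (intro rate_antimono) auto
        also have "\<dots> \<le> \<eta> / 2" using K by (simp add: rate_def)
        finally have "(1 - exp (- rate k)) * ?t k n \<le> \<eta> / 2 * ?t k n"
          using term_pos[of k n] by (intro mult_right_mono) auto
        then show ?thesis using False e by simp
      qed
    qed
    also have "\<dots> = (\<Sum>k. if k < K then ?t k n else 0) + (\<Sum>k. (\<eta> / 2) * ?t k n)"
      by (rule suminf_add[OF s1 summable_mult[OF v_summable], symmetric])
    also have "(\<Sum>k. (\<eta> / 2) * ?t k n) = \<eta> / 2 * v n"
      unfolding v_def by (rule suminf_mult[OF v_summable])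
    also have "(\<Sum>k. if k < K then ?t k n else 0) = (\<Sum>k<K. if k < K then ?t k n else 0)"
      by (rule suminf_finite) auto
    also have "\<dots> \<le> (\<Sum>k<K. (\<eta> / (2 * K)) * ?t K n)"
      using n1[OF n] by (intro sum_mono) auto
    also have "\<dots> = \<eta> / 2 * ?t K n" using K(1) by simp
    also have "\<dots> \<le> \<eta> / 2 * v n" using \<eta> by (intro mult_left_mono term_le_v) auto
    finally show ?thesis by simp
  qed
  then show ?thesis by blast
qed

lemma v_neighbour:
  assumes "n \<le> m + 1" "m \<le> n + 1"
  shows "v m \<le> exp \<epsilon> * v n"
proof -
  have *: "v i \<le> exp \<epsilon> * v i" for i using eps v_pos[of i] by simp
  have **: "v i \<le> exp \<epsilon> * v (Suc i)" for i
  proof -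
    have "exp \<epsilon> * (exp (- \<epsilon>) * v i) \<le> exp \<epsilon> * v (Suc i)" by (intro mult_left_mono v_Suc_ge) simp
    then show ?thesis by (simp add: exp_minus field_simps)
  qed
  consider "m = n" | "m = Suc n" | "n = Suc m" using assms by linarith
  then show ?thesis by cases (use * ** order_trans[OF v_Suc_le[of n] *[of n]] in auto)
qed

lemma v_neighbour_slow:
  assumes \<eta>: "\<eta> > 0"
  shows "\<exists>n1. \<forall>n\<ge>n1. \<forall>m. n \<le> m + 1 \<longrightarrow> m \<le> n + 1 \<longrightarrow> \<bar>v m - v n\<bar> \<le> \<eta> * v n"
proof -
  define \<eta>' where "\<eta>' = \<eta> * exp (- \<epsilon>)"
  have \<eta>': "\<eta>' > 0" "\<eta>' \<le> \<eta>" using \<eta> eps by (auto simp: \<eta>'_def)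
  obtain n1 where n1: "\<And>n. n \<ge> n1 \<Longrightarrow> v n - v (Suc n) \<le> \<eta>' * v n" using v_slow[OF \<eta>'(1)] by blast
  have "\<bar>v m - v n\<bar> \<le> \<eta> * v n" if n: "n \<ge> n1 + 1" and nm: "n \<le> m + 1" "m \<le> n + 1" for n m
  proof -
    consider "m = n" | "m = Suc n" | "n = Suc m" using nm by linarith
    then show ?thesis
    proof cases
      case 1 then show ?thesis using \<eta> v_pos[of n] by simp
    next
      case 2
      have "v n - v (Suc n) \<le> \<eta>' * v n" using n by (intro n1) simp
      also have "\<dots> \<le> \<eta> * v n" using \<eta>' v_pos[of n] by (intro mult_right_mono) auto
      finally show ?thesis using 2 v_Suc_le[of n] by simp
    next
      case 3
      have "v m - v (Suc m) \<le> \<eta>' * v m" using n 3 by (intro n1) simp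
      also have "\<dots> \<le> \<eta>' * (exp \<epsilon> * v n)"
        using \<eta>' v_neighbour[OF nm] by (intro mult_left_mono) auto
      also have "\<dots> = \<eta> * v n" by (simp add: \<eta>'_def exp_minus field_simps)
      finally show ?thesis using 3 v_Suc_le[of m] by simp
    qed
  qed
  then show ?thesis by blast
qed

end

context lifted_group
begin

lemma exp_wlen_summable:
  assumes a: "a > 0"
  shows "(\<lambda>g. exp (- (a * real (wlen g)))) summable_on carrier G"
proof -
  obtain C d where Cd: "\<And>n. card {g \<in> carrier G. wlen g \<le> n} \<le> C * (n + 1) ^ d"
    using wlen_ball_card by blast
  obtain K where K: "\<And>n::nat. real (n + 1) ^ d \<le> K * exp (a / 2 * real n)"
    using poly_le_exp[where a = "a / 2" and d = d] a by auto
  have K0: "K \<ge> 0" using K[of 0] by simp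
  define b where "b = (\<lambda>n::nat. C * K * exp (- (a / 2)) ^ n)"
  have b: "summable b" unfolding b_def using a by (intro summable_mult summable_geometric) auto
  have b0: "b n \<ge> 0" for n using K0 by (simp add: b_def)
  have "(\<Sum>g\<in>F. exp (- (a * real (wlen g)))) \<le> suminf b" if F: "F \<subseteq> carrier G" "finite F" for F
  proof -
    have "(\<Sum>g\<in>F. exp (- (a * real (wlen g)))) =
        (\<Sum>n\<in>wlen ` F. \<Sum>g\<in>{g \<in> F. wlen g = n}. exp (- (a * real (wlen g))))"
      by (rule sum.image_gen[OF F(2)])
    also have "\<dots> \<le> (\<Sum>n\<in>wlen ` F. b n)"
    proof (rule sum_mono)
      fix n
      have "(\<Sum>g\<in>{g \<in> F. wlen g = n}. exp (- (a * real (wlen g)))) =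
          (\<Sum>g\<in>{g \<in> F. wlen g = n}. exp (- (a * real n)))" by (intro sum.cong) auto
      also have "\<dots> = real (card {g \<in> F. wlen g = n}) * exp (- (a * real n))" by simp
      also have "\<dots> \<le> real (C * (n + 1) ^ d) * exp (- (a * real n))"
      proof (intro mult_right_mono of_nat_mono)
        have "card {g \<in> F. wlen g = n} \<le> card {g \<in> carrier G. wlen g \<le> n}"
          using F by (intro card_mono finite_wlen_ball) auto
        then show "card {g \<in> F. wlen g = n} \<le> C * (n + 1) ^ d" using Cd[of n] by linarith
      qed simp
      also have "\<dots> = C * (real (n + 1) ^ d) * exp (- (a * real n))" by simp
      also have "\<dots> \<le> C * (K * exp (a / 2 * real n)) * exp (- (a * real n))"
        using K[of n] by (intro mult_right_mono mult_left_mono) auto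
      also have "\<dots> = C * K * (exp (a / 2 * real n) * exp (- (a * real n)))" by simp
      also have "exp (a / 2 * real n) * exp (- (a * real n)) = exp (- (a / 2)) ^ n"
        by (simp add: exp_add[symmetric] exp_of_nat_mult[symmetric] algebra_simps)
      finally show "(\<Sum>g\<in>{g \<in> F. wlen g = n}. exp (- (a * real (wlen g)))) \<le> b n" by (simp add: b_def)
    qed
    also have "\<dots> \<le> suminf b" by (rule sum_le_suminf[OF b]) (use F b0 in auto)
    finally show ?thesis .
  qed
  then show ?thesis by (intro nonneg_bdd_above_summable_on bdd_aboveI2[of _ _ "suminf b"]) auto
qed

lemma D_bounded: "g \<in> carrier G \<Longrightarrow> \<exists>B. \<forall>x. D g x \<le> B"
  by (rule periodic_bounded[OF D_cont D_int])

definition far :: "real \<Rightarrow> real set" where "far r = {x. \<forall>p\<in>Per. r \<le> \<bar>x - p\<bar>}"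

text \<open>
  The value \<open>1\<close> is inserted to have a meaningful supremum when the set \<open>far r\<close> is empty, and to make
  summability against \<open>Dsup\<close> imply plain summability.
\<close>

definition Dsup :: "real \<Rightarrow> 'a \<Rightarrow> real" where "Dsup r g = Sup (insert 1 (D g ` far r))"

lemma Dsup_ge:
  assumes g: "g \<in> carrier G"
  shows "1 \<le> Dsup r g" "x \<in> far r \<Longrightarrow> D g x \<le> Dsup r g"
proof -
  obtain B where B: "\<And>x. D g x \<le> B" using D_bounded[OF g] by blast
  have "bdd_above (insert 1 (D g ` far r))" by (intro bdd_aboveI[of _ "max 1 B"]) (use B in \<open>auto simp: le_max_iff_disj\<close>)
  then show "1 \<le> Dsup r g" "x \<in> far r \<Longrightarrow> D g x \<le> Dsup r g"
    unfolding Dsup_def by (auto intro: cSup_upper)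
qed

lemma Dsup_summable:
  assumes a: "a > 0" and r: "r > 0"
  shows "(\<lambda>g. exp (- (a * real (wlen g))) * Dsup r g) summable_on carrier G"
proof -
  obtain n0 where n0: "\<And>g x. g \<in> carrier G \<Longrightarrow> n0 \<le> wlen g \<Longrightarrow> x \<in> far r \<Longrightarrow> D g x < exp (a / 2 * wlen g)"
    using subexponential_derivatives[OF half_gt_zero[OF a] r] unfolding far_def by auto
  let ?E = "{g \<in> carrier G. wlen g \<le> n0}"
  have le: "Dsup r g \<le> exp (a / 2 * wlen g)" if g: "g \<in> carrier G" "n0 \<le> wlen g" for g
    unfolding Dsup_def
  proof (rule cSup_least)
    fix y assume "y \<in> insert 1 (D g ` far r)"
    then show "y \<le> exp (a / 2 * wlen g)" using n0[OF g] a by (auto intro: less_imp_le)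
  qed simp
  have "(\<lambda>g. exp (- (a * real (wlen g))) * Dsup r g) summable_on (carrier G - ?E)"
  proof (rule summable_on_abs_comparison)
    show "(\<lambda>g. exp (- (a / 2 * real (wlen g)))) summable_on (carrier G - ?E)"
      by (rule summable_on_subset_banach[OF exp_wlen_summable]) (use a in auto)
    fix g assume g: "g \<in> carrier G - ?E"
    have "exp (- (a * real (wlen g))) * Dsup r g \<le> exp (- (a * real (wlen g))) * exp (a / 2 * wlen g)"
      using g by (intro mult_left_mono le) auto
    also have "\<dots> = exp (- (a / 2 * real (wlen g)))" by (simp add: exp_add[symmetric])
    finally show "\<bar>exp (- (a * real (wlen g))) * Dsup r g\<bar> \<le> exp (- (a / 2 * real (wlen g)))"
      using Dsup_ge(1)[of g r] g by (simp add: abs_mult)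
  qed
  then have "(\<lambda>g. exp (- (a * real (wlen g))) * Dsup r g) summable_on (carrier G - ?E) \<union> ?E"
    by (rule summable_on_Un_disjoint[OF _ summable_on_finite[OF finite_wlen_ball]]) auto
  moreover have "(carrier G - ?E) \<union> ?E = carrier G" by auto
  ultimately show ?thesis by simp
qed

text \<open>
  The weight is a mixture of exponentials of the word length. The sums over the group of the single
  exponentials against \<open>Dsup r\<close> converge, by polynomial growth and the subexponential growth of
  derivatives; a diagonal choice of the coefficients covers \<open>r = 1 / (m + 1)\<close> for all \<open>m\<close> at once.
\<close>

lemma weight_exists:
  assumes \<epsilon>: "\<epsilon> > 0"
  shows "\<exists>w. (\<forall>g\<in>carrier G. w g > 0) \<and>
    (\<forall>g\<in>carrier G. \<forall>s\<in>S. w (g \<otimes> s) \<le> exp \<epsilon> * w g) \<and>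
    (\<forall>s\<in>S. \<forall>\<eta>>0. finite {g \<in> carrier G. \<eta> * w g < \<bar>w (g \<otimes> s) - w g\<bar>}) \<and>
    w summable_on carrier G \<and>
    (\<forall>r>0. (\<lambda>g. w g * Dsup r g) summable_on carrier G) \<and>
    (\<forall>\<kappa>>0. \<exists>C>0. \<forall>g\<in>carrier G. C * exp (- (\<kappa> * real (wlen g))) \<le> w g)"
proof -
  define a where "a = (\<lambda>k::nat. \<epsilon> / real (k + 1))"
  have a: "a k > 0" for k using \<epsilon> by (simp add: a_def)
  define R where "R = (\<lambda>m::nat. 1 / real (m + 1))"
  have R: "R m > 0" for m by (simp add: R_def)
  define B where "B = (\<lambda>m k. \<Sum>\<^sub>\<infinity>g\<in>carrier G. exp (- (a k * real (wlen g))) * Dsup (R m) g)"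
  have B_summ: "(\<lambda>g. exp (- (a k * real (wlen g))) * Dsup (R m) g) summable_on carrier G" for m k
    by (rule Dsup_summable[OF a R])
  have Dsup0: "0 \<le> exp (- (a k * real (wlen g))) * Dsup r g" if "g \<in> carrier G" for r g k
    using Dsup_ge(1)[OF that, of r] by simp
  have B0: "B m k \<ge> 0" for m k unfolding B_def by (intro infsum_nonneg Dsup0)
  \<comment> \<open>For fixed \<open>m\<close> the product \<open>c k * B m k\<close> is at most \<open>(1/2) ^ k\<close> as soon as \<open>k \<ge> m\<close>.\<close>
  define c where "c = (\<lambda>k. (1/2) ^ k / (1 + (\<Sum>m\<le>k. B m k)))"
  have den: "1 + (\<Sum>m\<le>k. B m k) \<ge> 1" for k using B0 by (simp add: sum_nonneg)
  have c_pos: "c k > 0" for k using den[of k] by (simp add: c_def)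
  interpret exp_mixture \<epsilon> c
  proof
    show "c k \<le> (1/2) ^ k" for k
    proof -
      have "(1/2) ^ k / (1 + (\<Sum>m\<le>k. B m k)) \<le> (1/2) ^ k / 1" by (rule divide_left_mono) (use den[of k] in auto)
      then show ?thesis by (simp add: c_def)
    qed
  qed (use \<epsilon> c_pos in auto)
  have rate: "rate k = a k" for k by (simp add: rate_def a_def)
  define w where "w = (\<lambda>g. v (wlen g))"
  have w_pos: "w g > 0" for g by (simp add: w_def v_pos)
  have cB: "summable (\<lambda>k. c k * B m k)" for m
  proof (rule summable_comparison_test'[of "\<lambda>k. (1/2::real) ^ k" m])
    show "summable (\<lambda>k. (1/2::real) ^ k)" by (rule summable_geometric) simp
    fix k assume "m \<le> k"
    then have "B m k \<le> (\<Sum>m\<le>k. B m k)" using B0 by (intro member_le_sum) auto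
    then have "B m k \<le> 1 + (\<Sum>m\<le>k. B m k)" by simp
    then have "(1/2) ^ k * (B m k / (1 + (\<Sum>m\<le>k. B m k))) \<le> (1/2) ^ k * 1"
      using den[of k] by (intro mult_left_mono) auto
    then show "norm (c k * B m k) \<le> (1/2) ^ k" using B0 den[of k] by (simp add: c_def)
  qed
  have sumR: "(\<lambda>g. w g * Dsup (R m) g) summable_on carrier G" for m
  proof (intro nonneg_bdd_above_summable_on bdd_aboveI2[of _ _ "\<Sum>k. c k * B m k"])
    fix F assume F: "F \<in> {F. F \<subseteq> carrier G \<and> finite F}"
    have "(\<Sum>g\<in>F. w g * Dsup (R m) g) = (\<Sum>g\<in>F. \<Sum>k. c k * exp (- (rate k * real (wlen g))) * Dsup (R m) g)"
      unfolding w_def v_def by (simp add: suminf_mult2[OF v_summable])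
    also have "\<dots> = (\<Sum>k. \<Sum>g\<in>F. c k * exp (- (rate k * real (wlen g))) * Dsup (R m) g)"
      by (rule suminf_sum[symmetric]) (intro summable_mult2 v_summable)
    also have "\<dots> \<le> (\<Sum>k. c k * B m k)"
    proof (rule suminf_le[OF _ _ cB])
      fix k
      have "(\<Sum>g\<in>F. c k * exp (- (rate k * real (wlen g))) * Dsup (R m) g) =
          c k * (\<Sum>g\<in>F. exp (- (a k * real (wlen g))) * Dsup (R m) g)"
        by (simp add: sum_distrib_left mult.assoc rate)
      also have "\<dots> \<le> c k * B m k"
        unfolding B_def using c_pos[of k] F Dsup0
        by (intro mult_left_mono finite_sum_le_infsum[OF B_summ]) auto
      finally show "(\<Sum>g\<in>F. c k * exp (- (rate k * real (wlen g))) * Dsup (R m) g) \<le> c k * B m k" .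
    next
      show "summable (\<lambda>k. \<Sum>g\<in>F. c k * exp (- (rate k * real (wlen g))) * Dsup (R m) g)"
        by (intro summable_sum summable_mult2 v_summable)
    qed
    finally show "(\<Sum>g\<in>F. w g * Dsup (R m) g) \<le> (\<Sum>k. c k * B m k)" .
  next
    fix g assume "g \<in> carrier G"
    then show "0 \<le> w g * Dsup (R m) g" using Dsup_ge(1)[of g "R m"] w_pos[of g] by simp
  qed
  have sum_r: "(\<lambda>g. w g * Dsup r g) summable_on carrier G" if r: "r > 0" for r
  proof -
    obtain m where m: "inverse (real (Suc m)) < r" using reals_Archimedean[OF r] by blast
    have far: "far r \<subseteq> far (R m)"
    proof
      fix x assume x: "x \<in> far r"
      have "R m \<le> r" using m by (simp add: R_def inverse_eq_divide)
      then show "x \<in> far (R m)" using x unfolding far_def by force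
    qed
    have "\<bar>w g * Dsup r g\<bar> \<le> w g * Dsup (R m) g" if g: "g \<in> carrier G" for g
    proof -
      have "Dsup r g \<le> Dsup (R m) g"
        unfolding Dsup_def[of r g] by (rule cSup_least) (use Dsup_ge[OF g] far in auto)
      then show ?thesis using w_pos[of g] Dsup_ge(1)[OF g, of r] by (simp add: abs_mult)
    qed
    then show ?thesis by (rule summable_on_abs_comparison[OF sumR])
  qed
  have sum_w: "w summable_on carrier G"
  proof (rule summable_on_abs_comparison[OF sum_r[of 1]])
    fix g assume g: "g \<in> carrier G"
    show "\<bar>w g\<bar> \<le> w g * Dsup 1 g" using w_pos[of g] Dsup_ge(1)[OF g, of 1] by simp
  qed simp
  have nb: "wlen g \<le> wlen (g \<otimes> s) + 1" "wlen (g \<otimes> s) \<le> wlen g + 1" if "g \<in> carrier G" "s \<in> S" for g s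
    using wlen_mult_letter[OF that] by auto
  have ratio: "w (g \<otimes> s) \<le> exp \<epsilon> * w g"
    if "g \<in> carrier G" "s \<in> S" for g s
    unfolding w_def using v_neighbour[OF nb[OF that]] by blast
  have slow: "finite {g \<in> carrier G. \<eta> * w g < \<bar>w (g \<otimes> s) - w g\<bar>}" if s: "s \<in> S" and \<eta>: "\<eta> > 0" for s \<eta>
  proof -
    obtain n1 where n1: "\<And>n m. n \<ge> n1 \<Longrightarrow> n \<le> m + 1 \<Longrightarrow> m \<le> n + 1 \<Longrightarrow> \<bar>v m - v n\<bar> \<le> \<eta> * v n"
      using v_neighbour_slow[OF \<eta>] by blast
    have "{g \<in> carrier G. \<eta> * w g < \<bar>w (g \<otimes> s) - w g\<bar>} \<subseteq> {g \<in> carrier G. wlen g \<le> n1}"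
    proof (rule subsetI, clarify)
      fix g assume g: "g \<in> carrier G" and less: "\<eta> * w g < \<bar>w (g \<otimes> s) - w g\<bar>"
      show "wlen g \<le> n1"
      proof (rule ccontr)
        assume "\<not> wlen g \<le> n1"
        then have "\<bar>v (wlen (g \<otimes> s)) - v (wlen g)\<bar> \<le> \<eta> * v (wlen g)"
          using nb[OF g s] by (intro n1) auto
        then show False using less by (simp add: w_def)
      qed
    qed
    then show ?thesis by (rule finite_subset[OF _ finite_wlen_ball])
  qed
  have low: "\<exists>C>0. \<forall>g\<in>carrier G. C * exp (- (\<kappa> * real (wlen g))) \<le> w g" if \<kappa>: "\<kappa> > 0" for \<kappa>
  proof -
    obtain k where "inverse (real (Suc k)) < \<kappa> / \<epsilon>" using reals_Archimedean[of "\<kappa> / \<epsilon>"] \<kappa> \<epsilon> by auto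
    then have k: "rate k \<le> \<kappa>" using \<epsilon> by (simp add: rate_def field_simps)
    have "c k * exp (- (\<kappa> * real (wlen g))) \<le> w g" for g
    proof -
      have "rate k * real (wlen g) \<le> \<kappa> * real (wlen g)" using k by (intro mult_right_mono) auto
      then have "c k * exp (- (\<kappa> * real (wlen g))) \<le> c k * exp (- (rate k * real (wlen g)))"
        using c_pos[of k] by simp
      also have "\<dots> \<le> w g" unfolding w_def by (rule term_le_v)
      finally show ?thesis .
    qed
    then show ?thesis using c_pos[of k] by blast
  qed
  show ?thesis
    by (intro exI[of _ w] conjI ballI allI impI) (use w_pos ratio slow sum_w sum_r low in simp_all)
qed

end

section \<open>Strict differentiability\<close>

text \<open>
  Convergence of the difference quotients along this filter is strict differentiability. If it holds
  at every point, the derivative is automatically continuous, so that existence and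
  continuity of the derivative of a conjugate are obtained in one step.
\<close>

definition pairs_at :: "real \<Rightarrow> (real \<times> real) filter" where
  "pairs_at x = inf (nhds (x, x)) (principal {p. fst p \<noteq> snd p})"

lemma eventually_pairs_at:
  "eventually Q (pairs_at x) \<longleftrightarrow> (\<exists>d>0. \<forall>y z. \<bar>y - x\<bar> < d \<longrightarrow> \<bar>z - x\<bar> < d \<longrightarrow> y \<noteq> z \<longrightarrow> Q (y, z))"
proof
  assume "eventually Q (pairs_at x)"
  then have "\<forall>\<^sub>F p in nhds (x, x). fst p \<noteq> snd p \<longrightarrow> Q p"
    by (simp add: pairs_at_def eventually_inf_principal)
  then have "\<forall>\<^sub>F p in nhds x \<times>\<^sub>F nhds x. fst p \<noteq> snd p \<longrightarrow> Q p" by (simp add: nhds_prod)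
  then obtain Pf Pg where PQ: "eventually Pf (nhds x)" "eventually Pg (nhds x)"
    "\<And>y z. Pf y \<Longrightarrow> Pg z \<Longrightarrow> y \<noteq> z \<Longrightarrow> Q (y, z)"
    unfolding eventually_prod_filter by force
  have "\<forall>\<^sub>F y in nhds x. Pf y \<and> Pg y" using PQ(1,2) by (rule eventually_conj)
  then obtain d where "d > 0" "\<And>y. dist y x < d \<Longrightarrow> Pf y \<and> Pg y"
    unfolding eventually_nhds_metric by blast
  then show "\<exists>d>0. \<forall>y z. \<bar>y - x\<bar> < d \<longrightarrow> \<bar>z - x\<bar> < d \<longrightarrow> y \<noteq> z \<longrightarrow> Q (y, z)"
    using PQ(3) by (intro exI[of _ d]) (auto simp: dist_real_def)
next
  assume "\<exists>d>0. \<forall>y z. \<bar>y - x\<bar> < d \<longrightarrow> \<bar>z - x\<bar> < d \<longrightarrow> y \<noteq> z \<longrightarrow> Q (y, z)"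
  then obtain d where d: "d > 0" "\<And>y z. \<bar>y - x\<bar> < d \<Longrightarrow> \<bar>z - x\<bar> < d \<Longrightarrow> y \<noteq> z \<Longrightarrow> Q (y, z)" by blast
  have "\<forall>\<^sub>F y in nhds x. \<bar>y - x\<bar> < d"
    unfolding eventually_nhds_metric using d(1) by (auto simp: dist_real_def)
  then have "\<forall>\<^sub>F p in nhds x \<times>\<^sub>F nhds x. fst p \<noteq> snd p \<longrightarrow> Q p"
    unfolding eventually_prod_filter using d(2) by (intro exI[of _ "\<lambda>y. \<bar>y - x\<bar> < d"]) auto
  then show "eventually Q (pairs_at x)"
    by (simp add: pairs_at_def eventually_inf_principal nhds_prod)
qed

lemma pairs_at_neq_bot: "pairs_at x \<noteq> bot"
proof
  assume "pairs_at x = bot"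
  then have "eventually (\<lambda>_. False) (pairs_at x)" by simp
  then obtain d where d: "d > 0" "\<And>y z. \<bar>y - x\<bar> < d \<Longrightarrow> \<bar>z - x\<bar> < d \<Longrightarrow> y \<noteq> z \<Longrightarrow> False"
    unfolding eventually_pairs_at by blast
  show False by (rule d(2)[of x "x + d / 2"]) (use d(1) in auto)
qed

definition slope :: "(real \<Rightarrow> real) \<Rightarrow> real \<times> real \<Rightarrow> real" where
  "slope f = (\<lambda>(y, z). (f y - f z) / (y - z))"

lemma C1_slope_tendsto:
  assumes d: "\<And>x. (f has_real_derivative f' x) (at x)" and c: "isCont f' x"
  shows "(slope f \<longlongrightarrow> f' x) (pairs_at x)"
proof (rule tendstoI)
  fix e :: real assume "e > 0"
  then obtain r where r: "r > 0" "\<And>y. \<bar>y - x\<bar> < r \<Longrightarrow> \<bar>f' y - f' x\<bar> < e"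
    using c unfolding continuous_at_eps_delta by (metis dist_real_def)
  have *: "\<bar>(f z - f y) / (z - y) - f' x\<bar> < e" if yz: "\<bar>y - x\<bar> < r" "\<bar>z - x\<bar> < r" "y < z" for y z
  proof -
    obtain \<xi> where \<xi>: "y < \<xi>" "\<xi> < z" "f z - f y = (z - y) * f' \<xi>"
      using MVT2[OF yz(3), of f f'] d by blast
    have "\<bar>\<xi> - x\<bar> < r" using \<xi> yz by linarith
    then show ?thesis using r(2)[of \<xi>] \<xi> by simp
  qed
  have "dist (slope f (y, z)) (f' x) < e" if "\<bar>y - x\<bar> < r" "\<bar>z - x\<bar> < r" "y \<noteq> z" for y z
  proof (cases "y < z")
    case True
    have "(f y - f z) / (y - z) = (f z - f y) / (z - y)" by (metis minus_diff_eq minus_divide_divide)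
    then show ?thesis using *[OF that(1,2) True] by (simp add: slope_def dist_real_def)
  next
    case False
    then show ?thesis using *[OF that(2,1)] that(3) by (simp add: slope_def dist_real_def)
  qed
  then show "\<forall>\<^sub>F p in pairs_at x. dist (slope f p) (f' x) < e"
    unfolding eventually_pairs_at using r(1) by blast
qed

lemma slope_tendsto_imp_C1:
  assumes lim: "\<And>x. (slope f \<longlongrightarrow> f' x) (pairs_at x)"
  shows "continuous_on UNIV f'" "(f has_real_derivative f' x) (at x)"
proof -
  have deriv: "(f has_real_derivative f' x) (at x)" for x
    unfolding has_field_derivative_iff
  proof (rule tendstoI)
    fix e :: real assume "e > 0"
    then have "\<forall>\<^sub>F p in pairs_at x. dist (slope f p) (f' x) < e" using lim by (intro tendstoD)
    then obtain d where d: "d > 0" "\<And>y z. \<bar>y - x\<bar> < d \<Longrightarrow> \<bar>z - x\<bar> < d \<Longrightarrow> y \<noteq> z \<Longrightarrow> dist (slope f (y, z)) (f' x) < e"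
      unfolding eventually_pairs_at by blast
    have "dist ((f y - f x) / (y - x)) (f' x) < e" if "y \<noteq> x" "dist y x < d" for y
      using d(2)[of y x] that d(1) by (simp add: slope_def dist_real_def)
    then show "\<forall>\<^sub>F y in at x. dist ((f y - f x) / (y - x)) (f' x) < e"
      unfolding eventually_at using d(1) by blast
  qed
  then show "(f has_real_derivative f' x) (at x)" .
  have "isCont f' x" for x
    unfolding continuous_at_eps_delta
  proof (intro allI impI)
    fix e :: real assume e: "e > 0"
    then have "\<forall>\<^sub>F p in pairs_at x. dist (slope f p) (f' x) < e / 2" using lim by (intro tendstoD) auto
    then obtain d where d: "d > 0" "\<And>y z. \<bar>y - x\<bar> < d \<Longrightarrow> \<bar>z - x\<bar> < d \<Longrightarrow> y \<noteq> z \<Longrightarrow> dist (slope f (y, z)) (f' x) < e / 2"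
      unfolding eventually_pairs_at by blast
    have "dist (f' y) (f' x) < e" if y: "\<bar>y - x\<bar> < d" for y
    proof -
      have "\<forall>\<^sub>F p in pairs_at y. dist (slope f p) (f' x) \<le> e / 2"
        unfolding eventually_pairs_at
        by (intro exI[of _ "d - \<bar>y - x\<bar>"]) (use d(2) y in \<open>auto intro!: less_imp_le\<close>)
      moreover have "((\<lambda>p. dist (slope f p) (f' x)) \<longlongrightarrow> dist (f' y) (f' x)) (pairs_at y)"
        by (intro tendsto_dist lim tendsto_const)
      ultimately have "dist (f' y) (f' x) \<le> e / 2" using pairs_at_neq_bot by (intro tendsto_upperbound)
      then show ?thesis using e by simp
    qed
    then show "\<exists>d>0. \<forall>y. dist y x < d \<longrightarrow> dist (f' y) (f' x) < e"
      using d(1) by (auto simp: dist_real_def)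
  qed
  then show "continuous_on UNIV f'" by (simp add: continuous_on_eq_continuous_at)
qed

lemma filterlim_pairs_at:
  assumes "isCont \<psi> x" "inj \<psi>"
  shows "filterlim (\<lambda>(y, z). (\<psi> y, \<psi> z)) (pairs_at (\<psi> x)) (pairs_at x)"
  unfolding filterlim_iff
proof (intro allI impI)
  fix Q assume "eventually Q (pairs_at (\<psi> x))"
  then obtain d where d: "d > 0" "\<And>y z. \<bar>y - \<psi> x\<bar> < d \<Longrightarrow> \<bar>z - \<psi> x\<bar> < d \<Longrightarrow> y \<noteq> z \<Longrightarrow> Q (y, z)"
    unfolding eventually_pairs_at by blast
  obtain r where r: "r > 0" "\<And>y. \<bar>y - x\<bar> < r \<Longrightarrow> \<bar>\<psi> y - \<psi> x\<bar> < d"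
    using assms(1) d(1) unfolding continuous_at_eps_delta by (metis dist_real_def)
  show "\<forall>\<^sub>F p in pairs_at x. Q (case p of (y, z) \<Rightarrow> (\<psi> y, \<psi> z))"
    unfolding eventually_pairs_at
  proof (intro exI[of _ r] conjI allI impI r(1))
    fix y z assume "\<bar>y - x\<bar> < r" "\<bar>z - x\<bar> < r" "y \<noteq> z"
    then have "Q (\<psi> y, \<psi> z)" by (intro d(2) r(2)) (auto dest: injD[OF assms(2)])
    then show "Q (case (y, z) of (y, z) \<Rightarrow> (\<psi> y, \<psi> z))" by simp
  qed
qed

context lifted_group
begin

lemma dist_Per_far:
  assumes "x \<notin> Per"
  shows "\<exists>r>0. \<forall>y. \<bar>y - x\<bar> < r \<longrightarrow> y \<in> far r"
proof -
  have "open (- Per)" using Per_closed by (simp add: open_Compl)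
  then obtain e where e: "e > 0" "ball x e \<subseteq> - Per" using assms open_contains_ball by blast
  have "y \<in> far (e / 2)" if y: "\<bar>y - x\<bar> < e / 2" for y
    unfolding far_def
  proof (clarify, rule ccontr)
    fix p assume "p \<in> Per" "\<not> e / 2 \<le> \<bar>y - p\<bar>"
    then have "\<bar>x - p\<bar> < e" using y by linarith
    then have "p \<in> ball x e" by (simp add: dist_real_def)
    then show False using e(2) \<open>p \<in> Per\<close> by blast
  qed
  then show ?thesis using e(1) by (intro exI[of _ "e / 2"]) auto
qed

lemma bij_mult_right: "s \<in> carrier G \<Longrightarrow> bij_betw (\<lambda>g. g \<otimes> s) (carrier G) (carrier G)"
  by (rule bij_betwI[where g = "\<lambda>g. g \<otimes> inv s"]) (auto simp: m_assoc)

text \<open>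
  Along the powers of an element expanding at \<open>x\<close> the derivative grows exponentially while the weight
  decays slower than any exponential.
\<close>

lemma hyperbolic_sum_diverges:
  assumes w: "\<And>g. g \<in> carrier G \<Longrightarrow> w g > 0"
    and low: "\<And>\<kappa>. \<kappa> > 0 \<Longrightarrow> \<exists>C>0. \<forall>g\<in>carrier G. C * exp (- (\<kappa> * real (wlen g))) \<le> w g"
    and h: "h \<in> carrier G" "L h x - x \<in> \<int>" "D h x \<noteq> 1"
  shows "\<exists>E. finite E \<and> E \<subseteq> carrier G \<and> B < (\<Sum>g\<in>E. w g * D g x)"
proof -
  have "\<exists>h\<in>carrier G. L h x - x \<in> \<int> \<and> D h x > 1"
  proof (cases "D h x > 1")
    case False
    then have less: "D h x < 1" using h(3) by simp
    obtain k :: int where k: "\<And>x. L (inv h) (L h x) = x + k" using L_inv_const[OF h(1)] by blast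
    have ih: "inv h \<in> carrier G" using h by simp
    have "L (inv h) (L h x) - L (inv h) x \<in> \<int>" by (rule L_cong[OF ih h(2)])
    then have "of_int k - (L (inv h) (L h x) - L (inv h) x) \<in> \<int>" by (rule Ints_diff[OF Ints_of_int])
    moreover have "of_int k - (L (inv h) (L h x) - L (inv h) x) = L (inv h) x - x" using k[of x] by simp
    ultimately have "L (inv h) x - x \<in> \<int>" by simp
    moreover have "D (inv h) x = D (inv h) (L h x)" using D_cong[OF ih h(2)] by simp
    then have "D (inv h) x > 1" using D_inv[OF h(1)] less D_pos[OF h(1), of x] by simp
    ultimately show ?thesis using ih by blast
  qed (use h in blast)
  then obtain h where h: "h \<in> carrier G" "L h x - x \<in> \<int>" "D h x > 1" by blast
  define q where "q = D h x"
  have q: "q > 1" using h by (simp add: q_def)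
  \<comment> \<open>With this rate the lower bound of the weight at \<open>h [^] n\<close> loses at most \<open>q ^ n\<close>.\<close>
  define \<kappa> where "\<kappa> = ln q / real (wlen h + 1)"
  have \<kappa>: "\<kappa> > 0" using q by (simp add: \<kappa>_def)
  obtain C where C: "C > 0" "\<And>g. g \<in> carrier G \<Longrightarrow> C * exp (- (\<kappa> * real (wlen g))) \<le> w g"
    using low[OF \<kappa>] by blast
  have fx: "L (h [^] n) x - x \<in> \<int> \<and> D (h [^] n) x = q ^ n" for n :: nat
  proof (induction n)
    case 0
    have "L \<one> x - x \<in> \<int>" using act_one[of x] by (simp add: act_def frac_eq_frac_iff)
    then show ?case by (simp add: D_one)
  next
    case (Suc n)
    have c: "h [^] n \<in> carrier G" using h by simp
    have 1: "L (h [^] n \<otimes> h) x - L (h [^] n) (L h x) \<in> \<int>" by (rule L_mult[OF c h(1)])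
    have 2: "L (h [^] n) (L h x) - L (h [^] n) x \<in> \<int>" by (rule L_cong[OF c h(2)])
    have "L (h [^] n \<otimes> h) x - L (h [^] n) (L h x) + (L (h [^] n) (L h x) - L (h [^] n) x) + (L (h [^] n) x - x) \<in> \<int>"
      by (rule Ints_add[OF Ints_add[OF 1 2]]) (use Suc in blast)
    then have "L (h [^] Suc n) x - x \<in> \<int>" by simp
    moreover have "D (h [^] n \<otimes> h) x = D (h [^] n) (L h x) * D h x" by (rule D_mult[OF c h(1)])
    then have "D (h [^] Suc n) x = q ^ Suc n" using D_cong[OF c h(2)] Suc by (simp add: q_def)
    ultimately show ?case by blast
  qed
  have big: "C \<le> w (h [^] n) * D (h [^] n) x" for n :: nat
  proof -
    have "\<kappa> * real (wlen (h [^] n)) \<le> \<kappa> * real (n * (wlen h + 1))"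
      using wlen_pow_le[OF h(1), of n] \<kappa> by (intro mult_left_mono of_nat_mono) (auto intro: order_trans)
    also have "\<dots> = real n * (\<kappa> * real (wlen h + 1))" by (simp only: of_nat_mult mult_ac)
    also have "\<kappa> * real (wlen h + 1) = ln q" unfolding \<kappa>_def
      by (rule nonzero_eq_divide_eq[THEN iffD1, OF _ refl]) (simp del: of_nat_Suc of_nat_add)
    finally have "exp (- (real n * ln q)) \<le> exp (- (\<kappa> * real (wlen (h [^] n))))" by simp
    then have "C * exp (- (real n * ln q)) \<le> w (h [^] n)"
      using C(1) C(2)[of "h [^] n"] h(1) by (meson mult_left_mono less_imp_le nat_pow_closed order_trans)
    then have "C * exp (- (real n * ln q)) * q ^ n \<le> w (h [^] n) * D (h [^] n) x"
      using fx[of n] q by (simp add: mult_right_mono)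
    moreover have "exp (- (real n * ln q)) * q ^ n = 1"
      using q by (simp add: exp_minus exp_of_nat_mult)
    ultimately show ?thesis by (simp add: mult.assoc)
  qed
  have inj: "inj (\<lambda>n::nat. h [^] n)"
  proof (rule injI)
    fix m n :: nat assume "h [^] m = h [^] n"
    then have "q ^ m = q ^ n" using fx by metis
    then show "m = n" using power_inject_exp[OF q] by blast
  qed
  obtain n :: nat where n: "B / C < real n" using reals_Archimedean2 by blast
  let ?E = "(\<lambda>k::nat. h [^] k) ` {..<n}"
  have "B < real n * C" using n C(1) by (simp add: field_simps)
  also have "\<dots> = (\<Sum>k<n. C)" by simp
  also have "\<dots> \<le> (\<Sum>k<n. w (h [^] k) * D (h [^] k) x)" by (intro sum_mono big)
  also have "\<dots> = (\<Sum>g\<in>?E. w g * D g x)"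
    by (subst sum.reindex) (use inj in \<open>auto simp: inj_on_def inj_def\<close>)
  finally show ?thesis using h(1) by (intro exI[of _ ?E]) auto
qed

end

section \<open>The conjugating homeomorphism\<close>

text \<open>
  The data of the construction: a weight as in \<open>weight_exists\<close> and a transversal as in
  \<open>transversal_exists\<close>.
\<close>

locale weighted_lifted_group = lifted_group G S L D c for G (structure) and S L D c +
  fixes \<epsilon> :: real and w :: "'a \<Rightarrow> real" and T :: "'a set"
  assumes w_pos: "g \<in> carrier G \<Longrightarrow> w g > 0"
    and w_ratio: "g \<in> carrier G \<Longrightarrow> s \<in> S \<Longrightarrow> w (g \<otimes> s) \<le> exp \<epsilon> * w g"
    and w_slow: "s \<in> S \<Longrightarrow> \<eta> > 0 \<Longrightarrow> finite {g \<in> carrier G. \<eta> * w g < \<bar>w (g \<otimes> s) - w g\<bar>}"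
    and w_sum: "w summable_on carrier G"
    and w_far: "r > 0 \<Longrightarrow> (\<lambda>g. w g * Dsup r g) summable_on carrier G"
    and w_low: "\<kappa> > 0 \<Longrightarrow> \<exists>C>0. \<forall>g\<in>carrier G. C * exp (- (\<kappa> * real (wlen g))) \<le> w g"
    and T_fin: "finite T" and T_ne: "T \<noteq> {}" and T_sub: "T \<subseteq> carrier G"
    and T_avg: "x \<in> Per \<Longrightarrow> (\<And>h. h \<in> carrier G \<Longrightarrow> L h x - x \<in> \<int> \<Longrightarrow> D h x = 1) \<Longrightarrow>
        g \<in> carrier G \<Longrightarrow> (\<Sum>t\<in>T. D (t \<otimes> g) x) = (\<Sum>t\<in>T. D t x)"
begin

text \<open>
  Replacing \<open>L g\<close> by the sum of the \<open>L t \<circ> L g\<close> over the transversal does not change the averaging, but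
  it makes the derivative at a point of a finite orbit with trivial stabilizer derivatives the same
  for all \<open>g\<close>.
\<close>

definition U :: "real \<Rightarrow> real" where "U x = (\<Sum>t\<in>T. L t x)"
definition dU :: "real \<Rightarrow> real" where "dU x = (\<Sum>t\<in>T. D t x)"
definition V :: "'a \<Rightarrow> real \<Rightarrow> real" where "V g x = U (L g x)"
definition dV :: "'a \<Rightarrow> real \<Rightarrow> real" where "dV g x = dU (L g x) * D g x"
definition cT :: real where "cT = real (card T)"

lemma cT_pos: "cT > 0"
  using T_fin T_ne by (simp add: cT_def card_gt_0_iff)

lemma U_int: "U (x + of_int k) = U x + cT * of_int k"
proof -
  have "U (x + of_int k) = (\<Sum>t\<in>T. L t x + of_int k)"
    unfolding U_def using T_sub by (intro sum.cong refl L_int) auto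
  then show ?thesis by (simp add: U_def cT_def sum.distrib)
qed

lemma dU_pos: "dU x > 0"
  unfolding dU_def using T_fin T_ne T_sub D_pos by (intro sum_pos) auto

lemma dU_cont: "continuous_on UNIV dU"
  unfolding dU_def[abs_def] using T_sub by (intro continuous_on_sum D_cont) auto

lemma dU_int: "dU (x + of_int k) = dU x"
  unfolding dU_def using T_sub by (intro sum.cong refl D_int) auto

lemma dU_bounded: "\<exists>B>0. \<forall>x. dU x \<le> B"
proof -
  obtain B where "\<And>x. dU x \<le> B" using periodic_bounded[OF dU_cont dU_int] by blast
  then show ?thesis by (intro exI[of _ "max 1 B"]) (auto simp: le_max_iff_disj)
qed

lemma dU_lower: "\<exists>b>0. \<forall>x. b \<le> dU x"
proof -
  have "continuous_on UNIV (\<lambda>x. 1 / dU x)"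
    using dU_pos by (intro continuous_on_divide continuous_on_const dU_cont) (auto simp: less_imp_neq[symmetric])
  then obtain B where B: "\<And>x. 1 / dU x \<le> B"
    using periodic_bounded[of "\<lambda>x. 1 / dU x"] dU_int by auto
  have "0 < 1 / dU 0" using dU_pos by simp
  then have "B > 0" using B[of 0] by linarith
  moreover have "1 / B \<le> dU x" for x using B[of x] dU_pos[of x] \<open>B > 0\<close> by (simp add: field_simps)
  ultimately show ?thesis by (intro exI[of _ "1 / B"]) auto
qed

lemma V_deriv:
  assumes g: "g \<in> carrier G"
  shows "(V g has_real_derivative dV g x) (at x)"
proof -
  have "(U has_real_derivative dU y) (at y)" for y
    unfolding U_def[abs_def] dU_def using T_sub by (intro DERIV_sum L_deriv) auto
  from DERIV_chain2[OF this L_deriv[OF g]] show ?thesis unfolding V_def[abs_def] dV_def .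
qed

lemma dV_pos: "g \<in> carrier G \<Longrightarrow> dV g x > 0"
  using dU_pos D_pos by (simp add: dV_def)

lemma dV_cont: "g \<in> carrier G \<Longrightarrow> isCont (dV g) x"
proof -
  assume g: "g \<in> carrier G"
  have "continuous_on UNIV (dV g)"
    unfolding dV_def[abs_def]
    by (intro continuous_on_mult continuous_on_compose2[OF dU_cont L_cont[OF g]] D_cont[OF g]) auto
  then show ?thesis by (simp add: continuous_on_eq_continuous_at)
qed

lemma V_mono: "g \<in> carrier G \<Longrightarrow> x < y \<Longrightarrow> V g x < V g y"
  using strictly_increasing_of_deriv[OF V_deriv dV_pos] by blast

lemma V_nat: "g \<in> carrier G \<Longrightarrow> V g (x + real n) = V g x + cT * real n"
  using L_int[of g x "int n"] U_int[of "L g x" "int n"] by (simp add: V_def)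

lemma V_mult:
  assumes g: "g \<in> carrier G" and s: "s \<in> carrier G"
  shows "V (g \<otimes> s) x - V (g \<otimes> s) y = V g (L s x) - V g (L s y)"
proof -
  obtain k :: int where "\<And>x. L (g \<otimes> s) x = L g (L s x) + k" using L_mult_const[OF g s] by blast
  then show ?thesis by (simp add: V_def U_int)
qed

lemma V_diff_le:
  assumes g: "g \<in> carrier G" and le: "\<bar>x - y\<bar> \<le> real n"
  shows "\<bar>V g x - V g y\<bar> \<le> cT * real n"
proof -
  have *: "V g b - V g a \<le> cT * real n \<and> 0 \<le> V g b - V g a" if ab: "a \<le> b" "b \<le> a + real n" for a b
  proof -
    have "V g a \<le> V g b" using V_mono[OF g, of a b] ab by (cases "a = b") auto
    moreover have "V g b \<le> V g (a + real n)"
      using V_mono[OF g, of b "a + real n"] ab by (cases "b = a + real n") auto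
    ultimately show ?thesis using V_nat[OF g, of a n] by linarith
  qed
  show ?thesis
  proof (cases "x \<le> y")
    case True
    then show ?thesis using *[of x y] le by linarith
  next
    case False
    then show ?thesis using *[of y x] le by linarith
  qed
qed

lemma V_summable: "(\<lambda>g. w g * (V g x - V g y)) summable_on carrier G"
proof -
  obtain n :: nat where n: "\<bar>x - y\<bar> \<le> real n" using real_arch_simple by blast
  show ?thesis
  proof (rule summable_on_abs_comparison)
    show "(\<lambda>g. cT * real n * w g) summable_on carrier G" by (rule summable_on_cmult_right[OF w_sum])
    fix g assume g: "g \<in> carrier G"
    have "w g * \<bar>V g x - V g y\<bar> \<le> w g * (cT * real n)"
      using w_pos[OF g] by (intro mult_left_mono V_diff_le[OF g n]) auto
    then show "\<bar>w g * (V g x - V g y)\<bar> \<le> cT * real n * w g"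
      using w_pos[OF g] by (simp add: abs_mult mult_ac)
  qed
qed

text \<open>
  Up to normalization this is the conjugating homeomorphism. It is the integral of the averaged density
  \<open>x \<mapsto> \<Sum>\<^sub>\<infinity>g\<in>carrier G. w g * dV g x\<close>, but written with increments, so that it makes sense where the density is infinite.
\<close>

definition \<Phi> :: "real \<Rightarrow> real" where "\<Phi> x = (\<Sum>\<^sub>\<infinity>g\<in>carrier G. w g * (V g x - V g 0))"

lemma \<Phi>_diff: "\<Phi> x - \<Phi> y = (\<Sum>\<^sub>\<infinity>g\<in>carrier G. w g * (V g x - V g y))"
proof -
  have "\<Phi> x - \<Phi> y = (\<Sum>\<^sub>\<infinity>g\<in>carrier G. w g * (V g x - V g 0) - w g * (V g y - V g 0))"
    unfolding \<Phi>_def by (rule infsum_diff_real[OF V_summable V_summable, symmetric])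
  also have "\<dots> = (\<Sum>\<^sub>\<infinity>g\<in>carrier G. w g * (V g x - V g y))"
    by (intro infsum_cong) (simp add: algebra_simps)
  finally show ?thesis .
qed

lemma \<Phi>_mono: assumes "x < y" shows "\<Phi> x < \<Phi> y"
proof -
  have nn: "0 < w g * (V g y - V g x)" if "g \<in> carrier G" for g
    using w_pos[OF that] V_mono[OF that assms] by simp
  have "0 < (\<Sum>g\<in>{\<one>}. w g * (V g y - V g x))" using nn[of \<one>] by simp
  also have "\<dots> \<le> \<Phi> y - \<Phi> x"
    unfolding \<Phi>_diff by (rule finite_sum_le_infsum[OF V_summable]) (use nn in \<open>auto intro: less_imp_le\<close>)
  finally show ?thesis by simp
qed

definition W :: real where "W = (\<Sum>\<^sub>\<infinity>g\<in>carrier G. w g)"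

lemma W_pos: "W > 0"
proof -
  have "0 < (\<Sum>g\<in>{\<one>}. w g)" using w_pos[of \<one>] by simp
  also have "\<dots> \<le> W" unfolding W_def
    by (rule finite_sum_le_infsum[OF w_sum]) (use w_pos in \<open>auto intro: less_imp_le\<close>)
  finally show ?thesis .
qed

lemma \<Phi>_period: "\<Phi> (x + 1) = \<Phi> x + cT * W"
proof -
  have "\<Phi> (x + 1) - \<Phi> x = (\<Sum>\<^sub>\<infinity>g\<in>carrier G. cT * w g)"
    unfolding \<Phi>_diff using V_nat[of _ x 1] by (intro infsum_cong) simp
  also have "\<dots> = cT * W" unfolding W_def by (rule infsum_cmult_right[OF w_sum])
  finally show ?thesis by simp
qed

lemma \<Phi>_cont: "continuous_on UNIV \<Phi>"
proof -
  have "isCont \<Phi> x" for x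
  proof -
    obtain n :: nat where n: "\<bar>x\<bar> + 1 \<le> real n" using real_arch_simple by blast
    show ?thesis
      unfolding isCont_def \<Phi>_def[abs_def]
    proof (rule infsum_tendsto_dominated)
      show "(\<lambda>g. cT * real n * w g) summable_on carrier G" by (rule summable_on_cmult_right[OF w_sum])
      have "\<forall>\<^sub>F y in at x. dist y x < 1" by (auto simp: eventually_at intro: exI[of _ 1])
      then show "\<forall>\<^sub>F y in at x. \<forall>g\<in>carrier G. \<bar>w g * (V g y - V g 0)\<bar> \<le> cT * real n * w g"
      proof eventually_elim
        case (elim y)
        show ?case
        proof
          fix g assume g: "g \<in> carrier G"
          have "\<bar>y - 0\<bar> \<le> real n" using elim n by (simp add: dist_real_def)
          then have "w g * \<bar>V g y - V g 0\<bar> \<le> w g * (cT * real n)"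
            using w_pos[OF g] by (intro mult_left_mono V_diff_le[OF g]) auto
          then show "\<bar>w g * (V g y - V g 0)\<bar> \<le> cT * real n * w g"
            using w_pos[OF g] by (simp add: abs_mult mult_ac)
        qed
      qed
      fix g assume g: "g \<in> carrier G"
      have "isCont (V g) x" using V_deriv[OF g] by (rule DERIV_isCont)
      then show "((\<lambda>y. w g * (V g y - V g 0)) \<longlongrightarrow> w g * (V g x - V g 0)) (at x)"
        unfolding isCont_def by (intro tendsto_intros)
    qed
  qed
  then show ?thesis by (simp add: continuous_on_eq_continuous_at)
qed

text \<open>
  Quasi-invariance: precomposition with \<open>s\<close> merely shifts the weights.
\<close>

lemma \<Phi>_L_diff:
  assumes s: "s \<in> carrier G"
  shows "\<Phi> (L s x) - \<Phi> (L s y) = (\<Sum>\<^sub>\<infinity>g\<in>carrier G. w (g \<otimes> inv s) * (V g x - V g y))"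
    "(\<lambda>g. w (g \<otimes> inv s) * (V g x - V g y)) summable_on carrier G"
proof -
  have *: "w (g \<otimes> s \<otimes> inv s) * (V (g \<otimes> s) x - V (g \<otimes> s) y) = w g * (V g (L s x) - V g (L s y))"
    if "g \<in> carrier G" for g
    using that s V_mult[OF that s] by (simp add: m_assoc)
  have "\<Phi> (L s x) - \<Phi> (L s y) = (\<Sum>\<^sub>\<infinity>g\<in>carrier G. w (g \<otimes> s \<otimes> inv s) * (V (g \<otimes> s) x - V (g \<otimes> s) y))"
    unfolding \<Phi>_diff by (intro infsum_cong) (simp add: *)
  also have "\<dots> = (\<Sum>\<^sub>\<infinity>g\<in>carrier G. w (g \<otimes> inv s) * (V g x - V g y))"
    by (rule infsum_reindex_bij_betw[OF bij_mult_right[OF s]])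
  finally show "\<Phi> (L s x) - \<Phi> (L s y) = (\<Sum>\<^sub>\<infinity>g\<in>carrier G. w (g \<otimes> inv s) * (V g x - V g y))" .
  have "(\<lambda>g. w (g \<otimes> s \<otimes> inv s) * (V (g \<otimes> s) x - V (g \<otimes> s) y)) summable_on carrier G"
    by (rule summable_on_cong[THEN iffD2, OF _ V_summable[of "L s x" "L s y"]]) (simp add: *)
  then show "(\<lambda>g. w (g \<otimes> inv s) * (V g x - V g y)) summable_on carrier G"
    by (subst (asm) summable_on_reindex_bij_betw[OF bij_mult_right[OF s]])
qed

text \<open>
  The difference quotient of the conjugate of \<open>s\<close>, taken at the images of the two points.
\<close>

definition quot :: "'a \<Rightarrow> real \<times> real \<Rightarrow> real" where
  "quot s = (\<lambda>(x, y). (\<Phi> (L s x) - \<Phi> (L s y)) / (\<Phi> x - \<Phi> y))"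

lemma slope_V_pos: "g \<in> carrier G \<Longrightarrow> x \<noteq> y \<Longrightarrow> slope (V g) (x, y) > 0"
  using V_mono[of g x y] V_mono[of g y x]
  by (cases x y rule: linorder_cases) (auto simp: slope_def intro: divide_neg_neg)

lemma quot_le:
  assumes s: "s \<in> S" and "x \<noteq> y"
  shows "quot s (x, y) \<le> exp \<epsilon>"
proof -
  have *: "\<Phi> (L s b) - \<Phi> (L s a) \<le> exp \<epsilon> * (\<Phi> b - \<Phi> a)" if ab: "a < b" for a b
  proof -
    have sc: "s \<in> carrier G" using s S_sub by auto
    have "\<Phi> (L s b) - \<Phi> (L s a) \<le> (\<Sum>\<^sub>\<infinity>g\<in>carrier G. exp \<epsilon> * (w g * (V g b - V g a)))"
      unfolding \<Phi>_L_diff(1)[OF sc]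
    proof (rule infsum_mono[OF \<Phi>_L_diff(2)[OF sc] summable_on_cmult_right[OF V_summable]])
      fix g assume g: "g \<in> carrier G"
      have "w (g \<otimes> inv s) * (V g b - V g a) \<le> exp \<epsilon> * w g * (V g b - V g a)"
        using V_mono[OF g ab] by (intro mult_right_mono w_ratio[OF g S_inv[OF s]]) auto
      then show "w (g \<otimes> inv s) * (V g b - V g a) \<le> exp \<epsilon> * (w g * (V g b - V g a))" by (simp add: mult.assoc)
    qed
    also have "\<dots> = exp \<epsilon> * (\<Phi> b - \<Phi> a)"
      unfolding \<Phi>_diff by (rule infsum_cmult_right[OF V_summable])
    finally show ?thesis .
  qed
  show ?thesis
  proof (cases "y < x")
    case True
    then show ?thesis using *[OF True] \<Phi>_mono[OF True] by (simp add: quot_def divide_le_eq)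
  next
    case False
    then have xy: "x < y" using assms(2) by simp
    have "(\<Phi> (L s x) - \<Phi> (L s y)) / (\<Phi> x - \<Phi> y) = (\<Phi> (L s y) - \<Phi> (L s x)) / (\<Phi> y - \<Phi> x)"
      by (metis minus_diff_eq minus_divide_divide)
    then show ?thesis using *[OF xy] \<Phi>_mono[OF xy] by (simp add: quot_def divide_le_eq)
  qed
qed

lemma quot_eq:
  assumes s: "s \<in> carrier G" and xy: "x \<noteq> y"
  shows "quot s (x, y) = (\<Sum>\<^sub>\<infinity>g\<in>carrier G. w (g \<otimes> inv s) * slope (V g) (x, y)) /
     (\<Sum>\<^sub>\<infinity>g\<in>carrier G. w g * slope (V g) (x, y))"
    "(\<lambda>g. w g * slope (V g) (x, y)) summable_on carrier G"
    "(\<lambda>g. w (g \<otimes> inv s) * slope (V g) (x, y)) summable_on carrier G"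
proof -
  have e: "w g * slope (V g) (x, y) = (1 / (x - y)) * (w g * (V g x - V g y))"
    "w (g \<otimes> inv s) * slope (V g) (x, y) = (1 / (x - y)) * (w (g \<otimes> inv s) * (V g x - V g y))" for g
    by (simp_all add: slope_def)
  have nz: "1 / (x - y) \<noteq> 0" using xy by simp
  have "quot s (x, y) = (\<Sum>\<^sub>\<infinity>g\<in>carrier G. w (g \<otimes> inv s) * (V g x - V g y)) /
      (\<Sum>\<^sub>\<infinity>g\<in>carrier G. w g * (V g x - V g y))"
    unfolding quot_def prod.case \<Phi>_L_diff(1)[OF s] unfolding \<Phi>_diff by (rule refl)
  also have "\<dots> = (1 / (x - y) * (\<Sum>\<^sub>\<infinity>g\<in>carrier G. w (g \<otimes> inv s) * (V g x - V g y))) /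
      (1 / (x - y) * (\<Sum>\<^sub>\<infinity>g\<in>carrier G. w g * (V g x - V g y)))"
    by (rule mult_divide_mult_cancel_left[OF nz, symmetric])
  finally show "quot s (x, y) = (\<Sum>\<^sub>\<infinity>g\<in>carrier G. w (g \<otimes> inv s) * slope (V g) (x, y)) /
     (\<Sum>\<^sub>\<infinity>g\<in>carrier G. w g * slope (V g) (x, y))"
    unfolding e infsum_cmult_right' .
  show "(\<lambda>g. w g * slope (V g) (x, y)) summable_on carrier G"
    unfolding e by (rule summable_on_cmult_right[OF V_summable])
  show "(\<lambda>g. w (g \<otimes> inv s) * slope (V g) (x, y)) summable_on carrier G"
    unfolding e by (rule summable_on_cmult_right[OF \<Phi>_L_diff(2)[OF s]])
qed

lemma eventually_pairs_neq: "\<forall>\<^sub>F p in pairs_at x. fst p \<noteq> snd p"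
  unfolding pairs_at_def by (simp add: eventually_inf_principal)

lemma slope_V_tendsto: "g \<in> carrier G \<Longrightarrow> (slope (V g) \<longlongrightarrow> dV g x) (pairs_at x)"
  by (rule C1_slope_tendsto[OF V_deriv dV_cont])

lemma w_shift_summable:
  assumes s: "s \<in> carrier G"
  shows "(\<lambda>g. w (g \<otimes> inv s)) summable_on carrier G"
    "(\<Sum>\<^sub>\<infinity>g\<in>carrier G. w (g \<otimes> inv s)) = (\<Sum>\<^sub>\<infinity>g\<in>carrier G. w g)"
  using summable_on_reindex_bij_betw[OF bij_mult_right[of "inv s"], of w]
    infsum_reindex_bij_betw[OF bij_mult_right[of "inv s"], of w] w_sum s by auto

text \<open>
  If some stabilizer derivative at \<open>x\<close> is non-trivial, the averaged density is infinite at \<open>x\<close>.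
  Otherwise all summands have the same derivative at \<open>x\<close>. These are the two cases of
  \<open>weighted_quotient_tendsto_1\<close>.
\<close>

lemma quot_tendsto_Per:
  assumes s: "s \<in> S" and x: "x \<in> Per"
  shows "(quot s \<longlongrightarrow> 1) (pairs_at x)"
proof -
  have sc: "s \<in> carrier G" using s S_sub by auto
  let ?w' = "\<lambda>g. w (g \<otimes> inv s)"
  have "((\<lambda>p. (\<Sum>\<^sub>\<infinity>g\<in>carrier G. ?w' g * slope (V g) p) / (\<Sum>\<^sub>\<infinity>g\<in>carrier G. w g * slope (V g) p)) \<longlongrightarrow> 1)
      (pairs_at x)"
  proof (rule weighted_quotient_tendsto_1[where ?g0.0 = \<one> and \<alpha> = "\<lambda>g. dV g x"])
    show "finite {g \<in> carrier G. \<eta> * w g < \<bar>?w' g - w g\<bar>}" if "\<eta> > 0" for \<eta>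
      by (rule w_slow[OF S_inv[OF s] that])
    show "\<forall>\<^sub>F p in pairs_at x. \<forall>g\<in>carrier G. 0 < slope (V g) p"
      using eventually_pairs_neq[of x] by eventually_elim (use slope_V_pos in \<open>auto simp: split_paired_all\<close>)
    show "\<forall>\<^sub>F p in pairs_at x. (\<lambda>g. w g * slope (V g) p) summable_on carrier G \<and>
        (\<lambda>g. ?w' g * slope (V g) p) summable_on carrier G"
      using eventually_pairs_neq[of x] by eventually_elim (use quot_eq(2,3)[OF sc] in \<open>auto simp: split_paired_all\<close>)
    show "(\<forall>B. \<exists>E. finite E \<and> E \<subseteq> carrier G \<and> B < (\<Sum>g\<in>E. w g * dV g x)) \<or>
       (\<exists>\<kappa>>0. (\<forall>g\<in>carrier G. dV g x = \<kappa>) \<and> w summable_on carrier G \<and> ?w' summable_on carrier G \<and>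
         (\<Sum>\<^sub>\<infinity>g\<in>carrier G. ?w' g) = (\<Sum>\<^sub>\<infinity>g\<in>carrier G. w g))"
    proof (cases "\<exists>h\<in>carrier G. L h x - x \<in> \<int> \<and> D h x \<noteq> 1")
      case True
      then obtain h where h: "h \<in> carrier G" "L h x - x \<in> \<int>" "D h x \<noteq> 1" by blast
      obtain b where b: "b > 0" "\<And>x. b \<le> dU x" using dU_lower by blast
      have "\<exists>E. finite E \<and> E \<subseteq> carrier G \<and> B < (\<Sum>g\<in>E. w g * dV g x)" for B
      proof -
        obtain E where E: "finite E" "E \<subseteq> carrier G" "B / b < (\<Sum>g\<in>E. w g * D g x)"
          using hyperbolic_sum_diverges[OF w_pos w_low h] by blast
        have "B < b * (\<Sum>g\<in>E. w g * D g x)" using E(3) b(1) by (simp add: field_simps)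
        also have "\<dots> = (\<Sum>g\<in>E. w g * (b * D g x))" by (simp add: sum_distrib_left mult_ac)
        also have "\<dots> \<le> (\<Sum>g\<in>E. w g * dV g x)"
        proof (rule sum_mono)
          fix g assume "g \<in> E"
          then have g: "g \<in> carrier G" using E(2) by blast
          show "w g * (b * D g x) \<le> w g * dV g x"
            unfolding dV_def using w_pos[OF g] D_pos[OF g, of x] b(2) by (intro mult_left_mono mult_right_mono) auto
        qed
        finally show ?thesis using E by blast
      qed
      then show ?thesis by blast
    next
      case False
      have "dV g x = dU x" if g: "g \<in> carrier G" for g
      proof -
        have "dV g x = (\<Sum>t\<in>T. D (t \<otimes> g) x)"
          unfolding dV_def dU_def sum_distrib_right using T_sub g by (intro sum.cong refl D_mult[symmetric]) auto
        also have "\<dots> = dU x" unfolding dU_def by (rule T_avg[OF x _ g]) (use False in blast)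
        finally show ?thesis .
      qed
      then show ?thesis using dU_pos w_sum w_shift_summable[OF sc] by blast
    qed
  qed (use w_pos slope_V_tendsto in auto)
  then show ?thesis
  proof (rule Lim_transform_eventually)
    show "\<forall>\<^sub>F p in pairs_at x. (\<Sum>\<^sub>\<infinity>g\<in>carrier G. ?w' g * slope (V g) p) /
        (\<Sum>\<^sub>\<infinity>g\<in>carrier G. w g * slope (V g) p) = quot s p"
      using eventually_pairs_neq[of x] by eventually_elim (use quot_eq(1)[OF sc] in \<open>auto simp: split_paired_all\<close>)
  qed
qed

text \<open>
  Near \<open>x\<close> the summands are dominated by multiples of \<open>w g * Dsup r g\<close>, so numerator and denominator
  converge separately, the latter to a positive limit.
\<close>

lemma quot_tendsto_off_Per:
  assumes s: "s \<in> S" and x: "x \<notin> Per"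
  shows "\<exists>R. (quot s \<longlongrightarrow> R) (pairs_at x)"
proof -
  have sc: "s \<in> carrier G" using s S_sub by auto
  let ?w' = "\<lambda>g. w (g \<otimes> inv s)"
  obtain r where r: "r > 0" "\<And>y. \<bar>y - x\<bar> < r \<Longrightarrow> y \<in> far r" using dist_Per_far[OF x] by blast
  obtain B where B: "B > 0" "\<And>x. dU x \<le> B" using dU_bounded by blast
  have w': "0 \<le> ?w' g \<and> ?w' g \<le> exp \<epsilon> * w g" if g: "g \<in> carrier G" for g
    using w_ratio[OF g S_inv[OF s]] w_pos[of "g \<otimes> inv s"] g sc by auto
  have dV_le: "dV g y \<le> B * Dsup r g" if g: "g \<in> carrier G" and y: "\<bar>y - x\<bar> < r" for g y
    unfolding dV_def using B D_pos[OF g, of y] Dsup_ge(2)[OF g r(2)[OF y]] by (intro mult_mono) auto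
  have slope_le: "\<bar>slope (V g) (y, z)\<bar> \<le> B * Dsup r g"
    if g: "g \<in> carrier G" and yz: "\<bar>y - x\<bar> < r" "\<bar>z - x\<bar> < r" "y \<noteq> z" for g y z
  proof -
    have *: "(V g b - V g a) / (b - a) \<le> B * Dsup r g" if ab: "a < b" "\<bar>a - x\<bar> < r" "\<bar>b - x\<bar> < r" for a b
    proof -
      obtain \<xi> where \<xi>: "a < \<xi>" "\<xi> < b" "V g b - V g a = (b - a) * dV g \<xi>"
        using MVT2[OF ab(1), of "V g" "dV g"] V_deriv[OF g] by blast
      have "\<bar>\<xi> - x\<bar> < r" using \<xi> ab by linarith
      then show ?thesis using dV_le[OF g, of \<xi>] \<xi> by simp
    qed
    have "slope (V g) (y, z) \<le> B * Dsup r g"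
    proof (cases "y < z")
      case True
      have "(V g y - V g z) / (y - z) = (V g z - V g y) / (z - y)" by (metis minus_diff_eq minus_divide_divide)
      then show ?thesis using *[OF True yz(1,2)] by (simp add: slope_def)
    next
      case False
      then show ?thesis using *[OF _ yz(2,1)] yz(3) by (simp add: slope_def)
    qed
    then show ?thesis using slope_V_pos[OF g yz(3)] by simp
  qed
  have near: "\<forall>\<^sub>F p in pairs_at x. \<forall>g\<in>carrier G. \<bar>slope (V g) p\<bar> \<le> B * Dsup r g"
    unfolding eventually_pairs_at using r(1) slope_le by blast
  have tend: "((\<lambda>p. \<Sum>\<^sub>\<infinity>g\<in>carrier G. u g * slope (V g) p) \<longlongrightarrow> (\<Sum>\<^sub>\<infinity>g\<in>carrier G. u g * dV g x)) (pairs_at x)"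
    if u: "\<And>g. g \<in> carrier G \<Longrightarrow> 0 \<le> u g \<and> u g \<le> C * w g" and C: "C > 0" for u C
  proof (rule infsum_tendsto_dominated)
    show "(\<lambda>g. C * B * (w g * Dsup r g)) summable_on carrier G"
      by (rule summable_on_cmult_right[OF w_far[OF r(1)]])
    show "\<forall>\<^sub>F p in pairs_at x. \<forall>g\<in>carrier G. \<bar>u g * slope (V g) p\<bar> \<le> C * B * (w g * Dsup r g)"
      using near
    proof eventually_elim
      case (elim p)
      show ?case
      proof
        fix g assume g: "g \<in> carrier G"
        have "u g * \<bar>slope (V g) p\<bar> \<le> (C * w g) * (B * Dsup r g)"
          using elim g u[OF g] w_pos[OF g] C by (intro mult_mono) auto
        then show "\<bar>u g * slope (V g) p\<bar> \<le> C * B * (w g * Dsup r g)"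
          using u[OF g] by (simp add: abs_mult mult_ac)
      qed
    qed
    show "((\<lambda>p. u g * slope (V g) p) \<longlongrightarrow> u g * dV g x) (pairs_at x)" if "g \<in> carrier G" for g
      by (intro tendsto_mult tendsto_const slope_V_tendsto[OF that])
  qed
  have l1: "((\<lambda>p. \<Sum>\<^sub>\<infinity>g\<in>carrier G. ?w' g * slope (V g) p) \<longlongrightarrow> (\<Sum>\<^sub>\<infinity>g\<in>carrier G. ?w' g * dV g x)) (pairs_at x)"
    by (rule tend[of _ "exp \<epsilon>"]) (use w' in auto)
  have l2: "((\<lambda>p. \<Sum>\<^sub>\<infinity>g\<in>carrier G. w g * slope (V g) p) \<longlongrightarrow> (\<Sum>\<^sub>\<infinity>g\<in>carrier G. w g * dV g x)) (pairs_at x)"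
    by (rule tend[of _ 1]) (use w_pos in \<open>auto intro: less_imp_le\<close>)
  have nz: "(\<Sum>\<^sub>\<infinity>g\<in>carrier G. w g * dV g x) > 0"
  proof -
    have nn: "0 < w g * dV g x" if "g \<in> carrier G" for g using w_pos dV_pos that by simp
    have sm: "(\<lambda>g. w g * dV g x) summable_on carrier G"
    proof (rule summable_on_abs_comparison)
      show "(\<lambda>g. B * (w g * Dsup r g)) summable_on carrier G"
        by (rule summable_on_cmult_right[OF w_far[OF r(1)]])
      fix g assume g: "g \<in> carrier G"
      have "w g * dV g x \<le> w g * (B * Dsup r g)"
        using w_pos[OF g] r(1) by (intro mult_left_mono dV_le[OF g]) auto
      then show "\<bar>w g * dV g x\<bar> \<le> B * (w g * Dsup r g)" using nn[OF g] by (simp add: mult_ac)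
    qed
    have "0 < (\<Sum>g\<in>{\<one>}. w g * dV g x)" using nn[of \<one>] by simp
    also have "\<dots> \<le> (\<Sum>\<^sub>\<infinity>g\<in>carrier G. w g * dV g x)"
      by (rule finite_sum_le_infsum[OF sm]) (use nn in \<open>auto intro: less_imp_le\<close>)
    finally show ?thesis .
  qed
  have "((\<lambda>p. (\<Sum>\<^sub>\<infinity>g\<in>carrier G. ?w' g * slope (V g) p) / (\<Sum>\<^sub>\<infinity>g\<in>carrier G. w g * slope (V g) p)) \<longlongrightarrow>
      (\<Sum>\<^sub>\<infinity>g\<in>carrier G. ?w' g * dV g x) / (\<Sum>\<^sub>\<infinity>g\<in>carrier G. w g * dV g x)) (pairs_at x)"
    by (rule tendsto_divide[OF l1 l2]) (use nz in simp)
  then have "(quot s \<longlongrightarrow> (\<Sum>\<^sub>\<infinity>g\<in>carrier G. ?w' g * dV g x) / (\<Sum>\<^sub>\<infinity>g\<in>carrier G. w g * dV g x)) (pairs_at x)"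
  proof (rule Lim_transform_eventually)
    show "\<forall>\<^sub>F p in pairs_at x. (\<Sum>\<^sub>\<infinity>g\<in>carrier G. ?w' g * slope (V g) p) /
        (\<Sum>\<^sub>\<infinity>g\<in>carrier G. w g * slope (V g) p) = quot s p"
      using eventually_pairs_neq[of x] by eventually_elim (use quot_eq(1)[OF sc] in \<open>auto simp: split_paired_all\<close>)
  qed
  then show ?thesis by blast
qed

lemma quot_tendsto:
  assumes s: "s \<in> S"
  shows "\<exists>R\<le>exp \<epsilon>. (quot s \<longlongrightarrow> R) (pairs_at x)"
proof -
  obtain R where R: "(quot s \<longlongrightarrow> R) (pairs_at x)"
    using quot_tendsto_Per[OF s] quot_tendsto_off_Per[OF s] by blast
  moreover have "R \<le> exp \<epsilon>"
  proof (rule tendsto_upperbound[OF R _ pairs_at_neq_bot])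
    show "\<forall>\<^sub>F p in pairs_at x. quot s p \<le> exp \<epsilon>"
      using eventually_pairs_neq[of x] by eventually_elim (use quot_le[OF s] in \<open>auto simp: split_paired_all\<close>)
  qed
  ultimately show ?thesis by blast
qed

end

lemma strict_mono_surj_inverse:
  fixes f :: "real \<Rightarrow> real"
  assumes sm: "strict_mono f" and cont: "continuous_on UNIV f" and per: "\<And>x. f (x + 1) = f x + 1"
  obtains h where "\<And>x. h (f x) = x" "\<And>y. f (h y) = y" "continuous_on UNIV h" "strict_mono h"
proof -
  have nat: "f (x + real n) = f x + real n" for x n
    using translation_int[of f, OF per, of x "int n"] by simp
  have surj: "\<exists>x. f x = y" for y
  proof -
    obtain n :: nat where n: "\<bar>y - f 0\<bar> \<le> real n" using real_arch_simple by blast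
    have "f (0 + real n) = f 0 + real n" "f (- real n + real n) = f (- real n) + real n" by (rule nat)+
    then have "f (- real n) \<le> y" "y \<le> f (real n)" using n by auto
    then have "\<exists>x\<ge>- real n. x \<le> real n \<and> f x = y"
      by (intro IVT') (auto intro: continuous_on_subset[OF cont])
    then show ?thesis by blast
  qed
  define h where "h = (\<lambda>y. SOME x. f x = y)"
  have fh: "f (h y) = y" for y unfolding h_def by (rule someI_ex[OF surj])
  have hf: "h (f x) = x" for x using strict_mono_eq[OF sm] fh[of "f x"] by simp
  have less: "h y < h z \<longleftrightarrow> y < z" for y z using strict_mono_less[OF sm, of "h y" "h z"] by (simp add: fh)
  have "isCont h y" for y
    unfolding isCont_def
  proof (rule order_tendstoI)
    fix a assume "a < h y"
    then have "f a < y" using strict_mono_less[OF sm, of a "h y"] by (simp add: fh)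
    then have "\<forall>\<^sub>F z in at y. f a < z" by (intro order_tendstoD(1)[OF tendsto_ident_at])
    then show "\<forall>\<^sub>F z in at y. a < h z" by eventually_elim (use less[of "f a"] hf in auto)
  next
    fix a assume "h y < a"
    then have "y < f a" using strict_mono_less[OF sm, of "h y" a] by (simp add: fh)
    then have "\<forall>\<^sub>F z in at y. z < f a" by (intro order_tendstoD(2)[OF tendsto_ident_at])
    then show "\<forall>\<^sub>F z in at y. h z < a" by eventually_elim (use less[of _ "f a"] hf in auto)
  qed
  then have "continuous_on UNIV h" by (simp add: continuous_on_eq_continuous_at)
  then show thesis using that[of h] fh hf less by (auto simp: strict_mono_def)
qed

context weighted_lifted_group
begin

lemma weighted_smoothing:
  shows "\<exists>\<phi> \<psi>. strict_mono \<phi> \<and> continuous_on UNIV \<phi> \<and> continuous_on UNIV \<psi> \<and>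
    (\<forall>x. \<psi> (\<phi> x) = x) \<and> (\<forall>y. \<phi> (\<psi> y) = y) \<and> (\<forall>x. \<phi> (x + 1) = \<phi> x + 1) \<and>
    ((\<forall>g\<in>carrier G. \<forall>x. L g (- x) = - L g x) \<longrightarrow> (\<forall>x. \<phi> (- x) = - \<phi> x)) \<and>
    (\<forall>s\<in>S. \<exists>f'. continuous_on UNIV f' \<and>
       (\<forall>y. ((\<lambda>y. \<phi> (L s (\<psi> y))) has_real_derivative f' y) (at y) \<and> f' y \<le> exp \<epsilon>))"
proof -
  define q where "q = cT * W"
  have q: "q > 0" using cT_pos W_pos by (simp add: q_def)
  define \<phi> where "\<phi> = (\<lambda>x. \<Phi> x / q)"
  have sm: "strict_mono \<phi>" using \<Phi>_mono q by (auto simp: strict_mono_def \<phi>_def divide_strict_right_mono)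
  have cont: "continuous_on UNIV \<phi>"
    unfolding \<phi>_def using q by (intro continuous_on_divide \<Phi>_cont continuous_on_const) auto
  have per: "\<phi> (x + 1) = \<phi> x + 1" for x
    unfolding \<phi>_def \<Phi>_period q_def[symmetric] using q by (simp add: add_divide_distrib)
  obtain \<psi> where \<psi>: "\<And>x. \<psi> (\<phi> x) = x" "\<And>y. \<phi> (\<psi> y) = y" "continuous_on UNIV \<psi>" "strict_mono \<psi>"
    using strict_mono_surj_inverse[OF sm cont per] by blast
  have odd: "\<phi> (- x) = - \<phi> x" if odd: "\<forall>g\<in>carrier G. \<forall>x. L g (- x) = - L g x" for x
  proof -
    have Uo: "U (- y) = - U y" for y
      unfolding U_def sum_negf[symmetric] using odd T_sub by (intro sum.cong) auto
    have Vo: "V g (- y) = - V g y" if "g \<in> carrier G" for g y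
      using odd that Uo by (simp add: V_def)
    have "\<Phi> (- x) = (\<Sum>\<^sub>\<infinity>g\<in>carrier G. - (w g * (V g x - V g 0)))"
      unfolding \<Phi>_def
    proof (rule infsum_cong)
      fix g assume g: "g \<in> carrier G"
      have "V g 0 = 0" using Vo[OF g, of 0] by simp
      then show "w g * (V g (- x) - V g 0) = - (w g * (V g x - V g 0))" by (simp add: Vo[OF g])
    qed
    then show ?thesis by (simp add: \<phi>_def \<Phi>_def infsum_uminus)
  qed
  have main: "\<exists>f'. continuous_on UNIV f' \<and>
       (\<forall>y. ((\<lambda>y. \<phi> (L s (\<psi> y))) has_real_derivative f' y) (at y) \<and> f' y \<le> exp \<epsilon>)" if s: "s \<in> S" for s
  proof -
    have "\<forall>y. \<exists>R. R \<le> exp \<epsilon> \<and> (quot s \<longlongrightarrow> R) (pairs_at (\<psi> y))" using quot_tendsto[OF s] by blast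
    then obtain R where R: "\<And>y. R y \<le> exp \<epsilon>" "\<And>y. (quot s \<longlongrightarrow> R y) (pairs_at (\<psi> y))"
      by metis
    let ?f = "\<lambda>y. \<phi> (L s (\<psi> y))"
    have \<Phi>\<psi>: "\<Phi> (\<psi> y) = q * y" for y using \<psi>(2)[of y] q by (simp add: \<phi>_def field_simps)
    have slope: "slope ?f (y, z) = quot s (\<psi> y, \<psi> z)" if "y \<noteq> z" for y z
    proof -
      have "quot s (\<psi> y, \<psi> z) = (\<Phi> (L s (\<psi> y)) - \<Phi> (L s (\<psi> z))) / (q * (y - z))"
        by (simp add: quot_def \<Phi>\<psi> right_diff_distrib)
      then show ?thesis by (simp add: slope_def \<phi>_def diff_divide_distrib[symmetric] mult.commute)
    qed
    have lim: "(slope ?f \<longlongrightarrow> R y) (pairs_at y)" for y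
    proof -
      have "isCont \<psi> y" using \<psi>(3) by (simp add: continuous_on_eq_continuous_at)
      moreover have "inj \<psi>" using \<psi>(4) by (rule strict_mono_imp_inj_on)
      ultimately have "filterlim (\<lambda>(y, z). (\<psi> y, \<psi> z)) (pairs_at (\<psi> y)) (pairs_at y)"
        by (rule filterlim_pairs_at)
      from filterlim_compose[OF R(2) this] show ?thesis
      proof (rule Lim_transform_eventually)
        show "\<forall>\<^sub>F p in pairs_at y. quot s (case p of (y, z) \<Rightarrow> (\<psi> y, \<psi> z)) = slope ?f p"
          using eventually_pairs_neq[of y] by eventually_elim (use slope in \<open>auto simp: split_paired_all\<close>)
      qed
    qed
    show ?thesis using slope_tendsto_imp_C1[of ?f R, OF lim] R(1) by (intro exI[of _ R]) auto
  qed
  show ?thesis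
  proof (rule exI[of _ \<phi>], rule exI[of _ \<psi>], intro conjI)
    show "(\<forall>g\<in>carrier G. \<forall>x. L g (- x) = - L g x) \<longrightarrow> (\<forall>x. \<phi> (- x) = - \<phi> x)" using odd by blast
    show "\<forall>s\<in>S. \<exists>f'. continuous_on UNIV f' \<and>
       (\<forall>y. ((\<lambda>y. \<phi> (L s (\<psi> y))) has_real_derivative f' y) (at y) \<and> f' y \<le> exp \<epsilon>)"
      using main by blast
  qed (use sm cont \<psi> per in simp_all)
qed

end

context lifted_group
begin

text \<open>
  The statement on odd lifts serves the interval, which will be doubled to a circle with a reflection.
\<close>

lemma smoothing:
  fixes \<epsilon> :: real
  assumes \<epsilon>: "\<epsilon> > 0"
  shows "\<exists>\<phi> \<psi>. strict_mono \<phi> \<and> continuous_on UNIV \<phi> \<and> continuous_on UNIV \<psi> \<and>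
    (\<forall>x. \<psi> (\<phi> x) = x) \<and> (\<forall>y. \<phi> (\<psi> y) = y) \<and> (\<forall>x. \<phi> (x + 1) = \<phi> x + 1) \<and>
    ((\<forall>g\<in>carrier G. \<forall>x. L g (- x) = - L g x) \<longrightarrow> (\<forall>x. \<phi> (- x) = - \<phi> x)) \<and>
    (\<forall>s\<in>S. \<exists>f'. continuous_on UNIV f' \<and>
       (\<forall>y. ((\<lambda>y. \<phi> (L s (\<psi> y))) has_real_derivative f' y) (at y) \<and> f' y \<le> exp \<epsilon>))"
proof -
  obtain w where w: "\<forall>g\<in>carrier G. w g > 0"
    "\<forall>g\<in>carrier G. \<forall>s\<in>S. w (g \<otimes> s) \<le> exp \<epsilon> * w g"
    "\<forall>s\<in>S. \<forall>\<eta>>0. finite {g \<in> carrier G. \<eta> * w g < \<bar>w (g \<otimes> s) - w g\<bar>}"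
    "w summable_on carrier G"
    "\<forall>r>0. (\<lambda>g. w g * Dsup r g) summable_on carrier G"
    "\<forall>\<kappa>>0. \<exists>C>0. \<forall>g\<in>carrier G. C * exp (- (\<kappa> * real (wlen g))) \<le> w g"
    using weight_exists[OF \<epsilon>] by blast
  obtain T where T: "finite T" "T \<noteq> {}" "T \<subseteq> carrier G"
    "\<forall>x\<in>Per. (\<forall>h\<in>carrier G. L h x - x \<in> \<int> \<longrightarrow> D h x = 1) \<longrightarrow>
        (\<forall>g\<in>carrier G. (\<Sum>t\<in>T. D (t \<otimes> g) x) = (\<Sum>t\<in>T. D t x))"
    using transversal_exists by blast
  interpret weighted_lifted_group G S L D c \<epsilon> w T
    by unfold_locales (use w T in \<open>simp_all\<close>)
  show ?thesis by (rule weighted_smoothing)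
qed

end

section \<open>Nilpotent groups of bijections\<close>

locale fg_nilpotent_bijections =
  fixes X :: "'x::topological_space set" and \<Gamma> \<G> :: "('x \<Rightarrow> 'x) set"
  assumes sub: "subgroup \<Gamma> (BijGroup X)" and nil: "nilpotent_group (BijGroup X\<lparr>carrier := \<Gamma>\<rparr>)"
    and fin: "finite \<G>" and gen_sub: "\<G> \<subseteq> \<Gamma>" and gen: "generate (BijGroup X) \<G> = \<Gamma>"
begin

abbreviation "\<Gamma>G \<equiv> BijGroup X\<lparr>carrier := \<Gamma>\<rparr>"

definition inverse_map :: "('x \<Rightarrow> 'x) \<Rightarrow> 'x \<Rightarrow> 'x" where "inverse_map g = restrict (inv_into X g) X"
definition gens :: "('x \<Rightarrow> 'x) set" where "gens = \<G> \<union> inverse_map ` \<G>"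

lemma in_Bij: "g \<in> \<Gamma> \<Longrightarrow> g \<in> Bij X"
  using subgroup.subset[OF sub] by (auto simp: BijGroup_def)

lemma bij: "g \<in> \<Gamma> \<Longrightarrow> bij_betw g X X"
  using in_Bij by (auto simp: Bij_def)

lemma group_\<Gamma>G: "group \<Gamma>G"
  by (rule subgroup.subgroup_is_group[OF sub group_BijGroup])

lemma inv_\<Gamma>G: "g \<in> \<Gamma> \<Longrightarrow> inv\<^bsub>\<Gamma>G\<^esub> g = inverse_map g"
  using group.m_inv_consistent[OF group_BijGroup sub] inv_BijGroup[OF in_Bij] by (simp add: inverse_map_def)

lemma mult_apply: "g \<in> \<Gamma> \<Longrightarrow> h \<in> \<Gamma> \<Longrightarrow> x \<in> X \<Longrightarrow> (g \<otimes>\<^bsub>\<Gamma>G\<^esub> h) x = g (h x)"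
  using in_Bij by (simp add: BijGroup_def compose_def)

lemma inverse_map_in: "g \<in> \<Gamma> \<Longrightarrow> inverse_map g \<in> \<Gamma>"
  using group.inv_closed[OF group_\<Gamma>G, of g] inv_\<Gamma>G by simp

lemma inverse_map_apply: "x \<in> X \<Longrightarrow> inverse_map g x = inv_into X g x"
  by (simp add: inverse_map_def)

lemma gens_sub: "gens \<subseteq> \<Gamma>"
  using gen_sub inverse_map_in by (auto simp: gens_def)

lemma gens_fin: "finite gens"
  using fin by (simp add: gens_def)

lemma gens_inv: "s \<in> gens \<Longrightarrow> inv\<^bsub>\<Gamma>G\<^esub> s \<in> gens"
proof -
  assume s: "s \<in> gens"
  show ?thesis
  proof (cases "s \<in> \<G>")
    case True
    then show ?thesis using inv_\<Gamma>G gen_sub by (auto simp: gens_def)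
  next
    case False
    then obtain g where g: "g \<in> \<G>" "s = inverse_map g" using s by (auto simp: gens_def)
    have gc: "g \<in> carrier \<Gamma>G" using g gen_sub by auto
    have "s = inv\<^bsub>\<Gamma>G\<^esub> g" using inv_\<Gamma>G gc g by simp
    then have "inv\<^bsub>\<Gamma>G\<^esub> s = g" using group.inv_inv[OF group_\<Gamma>G gc] by simp
    then show ?thesis using g by (simp add: gens_def)
  qed
qed

lemma gens_gen: "generate \<Gamma>G gens = carrier \<Gamma>G"
proof
  show "generate \<Gamma>G gens \<subseteq> carrier \<Gamma>G"
    by (rule group.generate_incl[OF group_\<Gamma>G]) (use gens_sub in simp)
  have "g \<in> generate \<Gamma>G gens" if "g \<in> generate (BijGroup X) \<G>" for g
    using that
  proof (induction rule: generate.induct)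
    case one
    then show ?case using generate.one[of \<Gamma>G gens] by simp
  next
    case (incl h)
    then show ?case by (intro generate.incl) (simp add: gens_def)
  next
    case (inv h)
    have "inv\<^bsub>BijGroup X\<^esub> h = inverse_map h"
      using inv_BijGroup[OF in_Bij] inv gen_sub by (auto simp: inverse_map_def)
    then show ?case using inv by (intro generate.incl) (auto simp: gens_def)
  next
    case (eng h1 h2)
    then show ?case using generate.eng[of h1 \<Gamma>G gens h2] by simp
  qed
  then show "carrier \<Gamma>G \<subseteq> generate \<Gamma>G gens" using gen by auto
qed

lemma lifted_group_of_lifts:
  assumes "\<And>g x. g \<in> \<Gamma> \<Longrightarrow> (L g has_real_derivative D g x) (at x)"
    and "\<And>g. g \<in> \<Gamma> \<Longrightarrow> continuous_on UNIV (D g)"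
    and "\<And>g x. g \<in> \<Gamma> \<Longrightarrow> D g x > 0"
    and "\<And>g x. g \<in> \<Gamma> \<Longrightarrow> L g (x + 1) = L g x + 1"
    and "\<And>g h x. g \<in> \<Gamma> \<Longrightarrow> h \<in> \<Gamma> \<Longrightarrow> L (g \<otimes>\<^bsub>\<Gamma>G\<^esub> h) x - L g (L h x) \<in> \<int>"
  shows "\<exists>n. lifted_group \<Gamma>G gens L D n"
proof -
  obtain n where n: "lower_central \<Gamma>G n = {\<one>\<^bsub>\<Gamma>G\<^esub>}" using nil unfolding nilpotent_group_def by blast
  have "lifted_group \<Gamma>G gens L D n"
  proof (intro lifted_group.intro group_\<Gamma>G lifted_group_axioms.intro n gens_fin gens_inv gens_gen)
    show "gens \<subseteq> carrier \<Gamma>G" using gens_sub by simp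
  qed (use assms in auto)
  then show ?thesis by blast
qed

text \<open>
  Since the generating set is closed under inverses, derivative bounds for the conjugates of all
  generators include those of the inverse maps. The congruence hypothesis on \<open>R\<close> absorbs that
  the two conjugates may differ outside \<open>X\<close> from those of extensional functions.
\<close>

lemma conjugates_C1_diffeo:
  fixes R :: "('x \<Rightarrow> 'x) \<Rightarrow> real \<Rightarrow> 'x \<Rightarrow> bool" and b :: real
  assumes \<phi>: "\<And>x. x \<in> X \<Longrightarrow> \<phi> x \<in> X" "\<And>x. x \<in> X \<Longrightarrow> \<psi> x \<in> X"
      "\<And>x. x \<in> X \<Longrightarrow> \<psi> (\<phi> x) = x" "\<And>x. x \<in> X \<Longrightarrow> \<phi> (\<psi> x) = x"
    and cong: "\<And>f f' d x. x \<in> X \<Longrightarrow> (\<And>y. y \<in> X \<Longrightarrow> f' y = f y) \<Longrightarrow> R f d x \<Longrightarrow> R f' d x"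
    and deriv: "\<And>s. s \<in> gens \<Longrightarrow> \<exists>f'. continuous_on X f' \<and> (\<forall>x\<in>X. R (\<phi> \<circ> s \<circ> \<psi>) (f' x) x \<and> f' x \<le> b)"
  shows "\<forall>g\<in>\<G>. \<forall>h\<in>{\<phi> \<circ> g \<circ> \<psi>, \<phi> \<circ> inv_into X g \<circ> \<psi>}.
     C1_diffeo X R h \<and> (\<forall>x\<in>X. \<exists>d. R h d x \<and> d \<le> b)"
proof -
  have bij_\<phi>: "bij_betw \<phi> X X" by (rule bij_betwI[where g = \<psi>]) (use \<phi> in auto)
  have bij_\<psi>: "bij_betw \<psi> X X" by (rule bij_betwI[where g = \<phi>]) (use \<phi> in auto)
  have map: "C1_map X R h \<and> (\<forall>x\<in>X. \<exists>d. R h d x \<and> d \<le> b)"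
    if s: "s \<in> gens" and h: "\<And>y. y \<in> X \<Longrightarrow> h y = \<phi> (s (\<psi> y))" for s h
  proof -
    obtain f' where f': "continuous_on X f'" "\<And>x. x \<in> X \<Longrightarrow> R (\<phi> \<circ> s \<circ> \<psi>) (f' x) x" "\<And>x. x \<in> X \<Longrightarrow> f' x \<le> b"
      using deriv[OF s] by blast
    have R: "R h (f' x) x" if "x \<in> X" for x by (rule cong[OF that _ f'(2)[OF that]]) (simp add: h)
    have "s y \<in> X" if "y \<in> X" for y using bij_betwE[OF bij] s gens_sub that by blast
    then have "h \<in> X \<rightarrow> X" using h \<phi> by auto
    then show ?thesis using R f' unfolding C1_map_def by blast
  qed
  have diffeo: "C1_diffeo X R h \<and> (\<forall>x\<in>X. \<exists>d. R h d x \<and> d \<le> b)"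
    if s: "s \<in> gens" and h: "\<And>y. y \<in> X \<Longrightarrow> h y = \<phi> (s (\<psi> y))" for s h
  proof -
    have s\<Gamma>: "s \<in> \<Gamma>" using s gens_sub by blast
    have "bij_betw (\<phi> \<circ> (s \<circ> \<psi>)) X X"
      by (rule bij_betw_trans[OF bij_betw_trans[OF bij_\<psi> bij[OF s\<Gamma>]] bij_\<phi>])
    then have bij_h: "bij_betw h X X" by (subst bij_betw_cong[of X h]) (auto simp: h)
    have inv_s: "inverse_map s \<in> gens" using gens_inv[OF s] inv_\<Gamma>G[OF s\<Gamma>] by simp
    have inv_h: "inv_into X h y = \<phi> (inverse_map s (\<psi> y))" if y: "y \<in> X" for y
    proof (rule inv_into_f_eq)
      show "inj_on h X" using bij_h by (rule bij_betw_imp_inj_on)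
      have z: "inverse_map s (\<psi> y) \<in> X" using bij_betwE[OF bij[OF inverse_map_in[OF s\<Gamma>]]] \<phi>(2)[OF y] by blast
      then show "\<phi> (inverse_map s (\<psi> y)) \<in> X" by (rule \<phi>(1))
      have "s (inverse_map s (\<psi> y)) = \<psi> y"
        using \<phi>(2)[OF y] bij_betw_inv_into_right[OF bij[OF s\<Gamma>]] by (simp add: inverse_map_apply)
      then show "h (\<phi> (inverse_map s (\<psi> y))) = y" using z \<phi> y by (simp add: h)
    qed
    show ?thesis
      unfolding C1_diffeo_def using bij_h map[OF s h] map[OF inv_s inv_h] by blast
  qed
  show ?thesis
  proof (intro ballI)
    fix g h assume g: "g \<in> \<G>" and h: "h \<in> {\<phi> \<circ> g \<circ> \<psi>, \<phi> \<circ> inv_into X g \<circ> \<psi>}"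
    from h show "C1_diffeo X R h \<and> (\<forall>x\<in>X. \<exists>d. R h d x \<and> d \<le> b)"
    proof
      assume "h = \<phi> \<circ> g \<circ> \<psi>"
      then show ?thesis using g by (intro diffeo[of g]) (auto simp: gens_def)
    next
      assume "h \<in> {\<phi> \<circ> inv_into X g \<circ> \<psi>}"
      then show ?thesis using g \<phi>(2) by (intro diffeo[of "inverse_map g"]) (auto simp: gens_def inverse_map_apply)
    qed
  qed
qed

end

section \<open>The circle\<close>

lemma to_circle_rep: "to_circle (rep_circle x) = x"
  by (rule Quotient3_abs_rep[OF Quotient3_circle])

lemma rep_to_circle: "rep_circle (to_circle t) - t \<in> \<int>"
  using to_circle_rep[of "to_circle t"] by (simp add: to_circle_eq_iff)

lemma continuous_to_circle: "continuous_on UNIV to_circle"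
  by (simp add: continuous_on_open_vimage open_circle_def)

lemma continuous_on_circle:
  assumes "continuous_on UNIV (\<lambda>t. f (to_circle t))"
  shows "continuous_on UNIV (f :: circle \<Rightarrow> 'b::topological_space)"
  using assms by (simp add: continuous_on_open_vimage open_circle_def vimage_def)

text \<open>
  A candidate lift is found by integrating the derivative. It is correct because, for \<open>\<rho>\<close> any (discontinuous)
  section of the lifts, \<open>cos (2 * pi * (\<rho> t - F t))\<close> is locally computed from local lifts and has
  derivative zero; so it is constantly \<open>1\<close> and \<open>\<rho> t - F t\<close> is an integer. The degree is \<open>1\<close> because the map
  is injective.
\<close>

lemma circle_lift_exists:
  assumes g: "C1_diffeo UNIV circle_deriv g" and op: "orientation_preserving UNIV circle_deriv g"
  shows "\<exists>F F'. (\<forall>x. to_circle (F x) = g (to_circle x)) \<and> (\<forall>x. (F has_real_derivative F' x) (at x)) \<and>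
    continuous_on UNIV F' \<and> (\<forall>x. F' x > 0) \<and> (\<forall>x. F (x + 1) = F x + 1)"
proof -
  obtain f' where f': "continuous_on UNIV f'" "\<And>x. circle_deriv g (f' x) x"
    using g by (auto simp: C1_diffeo_def C1_map_def)
  define p where "p = (\<lambda>t. f' (to_circle t))"
  have p_cont: "continuous_on UNIV p"
    unfolding p_def by (rule continuous_on_compose2[OF f'(1) continuous_to_circle]) simp
  have p_pos: "p t > 0" for t
  proof -
    obtain d where "d > 0" "circle_deriv g d (to_circle t)" using op by (auto simp: orientation_preserving_def)
    then show ?thesis using circle_deriv_unique[OF f'(2)] by (simp add: p_def)
  qed
  obtain A where A: "\<And>x. (A has_vector_derivative p x) (at x)"
    using einterval_antiderivative[of "-\<infinity>" "\<infinity>" p] p_cont by (auto simp: continuous_on_eq_continuous_at)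
  define \<rho> where "\<rho> = (\<lambda>t. rep_circle (g (to_circle t)))"
  define F where "F = (\<lambda>x. A x - A 0 + \<rho> 0)"
  have F': "(F has_real_derivative p x) (at x)" for x
    unfolding F_def using A[of x]
    by (auto intro!: derivative_eq_intros simp: has_real_derivative_iff_has_vector_derivative)
  define C where "C = (\<lambda>t. cos (2 * pi * (\<rho> t - F t)))"
  have "(C has_real_derivative 0) (at t)" for t
  proof -
    obtain u K where K: "to_circle u = to_circle t" "\<forall>\<^sub>F s in nhds u. to_circle (K s) = g (to_circle s)"
      "(K has_real_derivative p t) (at u)"
      using f'(2)[of "to_circle t"] unfolding circle_deriv_def p_def by blast
    define k where "k = u - t"
    have k: "k \<in> \<int>" "u = t + k" using K(1) to_circle_eq_iff[of u t] by (auto simp: k_def)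
    have per: "to_circle (s + k) = to_circle s" for s using k(1) by (simp add: to_circle_eq_iff)
    have "filterlim (\<lambda>s. s + k) (nhds (t + k)) (nhds t)" by (intro tendsto_intros filterlim_ident)
    from eventually_compose_filterlim[OF K(2)[unfolded k(2)] this]
    have ev: "\<forall>\<^sub>F s in nhds t. to_circle (K (s + k)) = g (to_circle s)"
      by (simp only: per)
    have ev2: "\<forall>\<^sub>F s in nhds t. C s = cos (2 * pi * (K (s + k) - F s))"
      using ev
    proof eventually_elim
      case (elim s)
      then have "to_circle (\<rho> s) = to_circle (K (s + k))" by (simp add: \<rho>_def to_circle_rep)
      then obtain m :: int where "\<rho> s - K (s + k) = m" by (auto simp: to_circle_eq_iff elim: Ints_cases)
      then have "2 * pi * (\<rho> s - F s) = 2 * pi * (K (s + k) - F s) + 2 * pi * of_int m"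
        by (simp add: algebra_simps)
      then show ?case unfolding C_def using cos.plus_of_int[of "2 * pi * (K (s + k) - F s)" m]
        by (simp add: mult.commute)
    qed
    have dK: "((\<lambda>s. K (s + k)) has_real_derivative p t) (at t)"
      using K(3) unfolding k(2) by (rule DERIV_shift[THEN iffD1])
    have "((\<lambda>s. cos (2 * pi * (K (s + k) - F s))) has_real_derivative
        - sin (2 * pi * (K (t + k) - F t)) * (2 * pi * (p t - p t))) (at t)"
      by (rule DERIV_chain2[OF DERIV_cos], intro DERIV_cmult DERIV_diff dK F')
    then have "((\<lambda>s. cos (2 * pi * (K (s + k) - F s))) has_real_derivative 0) (at t)" by simp
    then show ?thesis using ev2 by (subst DERIV_cong_ev[OF refl _ refl])
  qed
  then have "C t = C 0" for t by (intro DERIV_isconst_all) blast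
  moreover have "C 0 = 1" by (simp add: C_def F_def)
  ultimately have "cos (2 * pi * (\<rho> t - F t)) = 1" for t by (simp add: C_def)
  then have int: "\<rho> t - F t \<in> \<int>" for t
  proof -
    obtain n :: int where "2 * pi * (\<rho> t - F t) = of_int n * 2 * pi"
      using \<open>cos (2 * pi * (\<rho> t - F t)) = 1\<close> cos_one_2pi_int by blast
    then have "\<rho> t - F t = of_int n" by simp
    then show ?thesis by simp
  qed
  have lift: "to_circle (F t) = g (to_circle t)" for t
  proof -
    have "to_circle (\<rho> t) = to_circle (F t)" using int[of t] by (simp add: to_circle_eq_iff)
    then show ?thesis by (simp add: \<rho>_def to_circle_rep)
  qed
  have mono: "F x < F y" if "x < y" for x y by (rule strictly_increasing_of_deriv[OF F' p_pos that])
  have F_cont: "continuous_on B F" for B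
    by (rule DERIV_continuous_on[where D = p], rule has_field_derivative_at_within[OF F'])
  have "F (x + 1) - F x \<in> \<int>" for x
  proof -
    have "to_circle (x + 1) = to_circle x" by (simp add: to_circle_eq_iff)
    then show ?thesis unfolding to_circle_eq_iff[symmetric] lift by simp
  qed
  moreover have "continuous_on UNIV (\<lambda>x. F (x + 1) - F x)"
    by (intro continuous_intros continuous_on_compose2[OF F_cont[of UNIV]]) auto
  ultimately obtain m :: int where m: "\<And>x. F (x + 1) - F x = m" using continuous_Ints_constant by blast
  have "m > 0" using m[of 0] mono[of 0 1] by simp
  have "m = 1"
  proof (rule ccontr)
    assume "m \<noteq> 1"
    then have "F 0 + 1 < F 1" using \<open>m > 0\<close> m[of 0] by simp
    then obtain x where x: "0 \<le> x" "x \<le> 1" "F x = F 0 + 1"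
      using IVT'[of F 0 "F 0 + 1" 1] F_cont by auto
    have "x \<noteq> 0" "x \<noteq> 1" using x(3) \<open>F 0 + 1 < F 1\<close> by auto
    have "g (to_circle x) = g (to_circle 0)" unfolding lift[symmetric] x(3) by (simp add: to_circle_eq_iff)
    then have "to_circle x = to_circle 0"
      using g unfolding C1_diffeo_def bij_betw_def by (blast dest: injD)
    then have "x \<in> \<int>" by (simp add: to_circle_eq_iff)
    then show False using x \<open>x \<noteq> 0\<close> \<open>x \<noteq> 1\<close> Ints_nonzero_abs_ge1[of x] by auto
  qed
  then have "F (x + 1) = F x + 1" for x using m[of x] by simp
  then show ?thesis using lift F' p_cont p_pos by blast
qed

lemma circle_case:
  fixes \<Gamma> \<G> :: "(circle \<Rightarrow> circle) set" and \<epsilon> :: real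
  assumes \<epsilon>: "\<epsilon> > 0" and fg: "fg_nilpotent_bijections UNIV \<Gamma> \<G>"
    and diffeo: "\<And>g. g \<in> \<Gamma> \<Longrightarrow> C1_diffeo UNIV circle_deriv g \<and> orientation_preserving UNIV circle_deriv g"
  shows "\<exists>\<phi> \<psi>. homeomorphism UNIV UNIV \<phi> \<psi> \<and>
     (\<forall>g\<in>\<G>. \<forall>h\<in>{\<phi> \<circ> g \<circ> \<psi>, \<phi> \<circ> inv_into UNIV g \<circ> \<psi>}.
        C1_diffeo UNIV circle_deriv h \<and> (\<forall>x\<in>UNIV. \<exists>d. circle_deriv h d x \<and> d \<le> exp \<epsilon>))"
proof -
  interpret fg_nilpotent_bijections UNIV \<Gamma> \<G> by (rule fg)
  have "\<forall>g\<in>\<Gamma>. \<exists>F F'. (\<forall>x. to_circle (F x) = g (to_circle x)) \<and> (\<forall>x. (F has_real_derivative F' x) (at x)) \<and>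
    continuous_on UNIV F' \<and> (\<forall>x. F' x > 0) \<and> (\<forall>x. F (x + 1) = F x + 1)"
    using circle_lift_exists diffeo by blast
  then obtain L D where LD: "\<And>g x. g \<in> \<Gamma> \<Longrightarrow> to_circle (L g x) = g (to_circle x)"
    "\<And>g x. g \<in> \<Gamma> \<Longrightarrow> (L g has_real_derivative D g x) (at x)"
    "\<And>g. g \<in> \<Gamma> \<Longrightarrow> continuous_on UNIV (D g)"
    "\<And>g x. g \<in> \<Gamma> \<Longrightarrow> D g x > 0" "\<And>g x. g \<in> \<Gamma> \<Longrightarrow> L g (x + 1) = L g x + 1"
    by metis
  have "L (g \<otimes>\<^bsub>\<Gamma>G\<^esub> h) x - L g (L h x) \<in> \<int>" if "g \<in> \<Gamma>" "h \<in> \<Gamma>" for g h x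
  proof -
    have "g \<otimes>\<^bsub>\<Gamma>G\<^esub> h \<in> \<Gamma>" using subgroup.m_closed[OF sub that] by simp
    then have "to_circle (L (g \<otimes>\<^bsub>\<Gamma>G\<^esub> h) x) = to_circle (L g (L h x))"
      using LD(1) that mult_apply[OF that] by simp
    then show ?thesis by (simp add: to_circle_eq_iff)
  qed
  then obtain n where "lifted_group \<Gamma>G gens L D n"
    using lifted_group_of_lifts[of L D] LD(2-5) by blast
  then interpret lg: lifted_group \<Gamma>G gens L D n .
  obtain \<phi> \<psi> where \<phi>: "continuous_on UNIV \<phi>" "continuous_on UNIV \<psi>" "\<And>x. \<psi> (\<phi> x) = x" "\<And>y. \<phi> (\<psi> y) = y"
      "\<And>x. \<phi> (x + 1) = \<phi> x + 1"
    and sm: "\<And>s. s \<in> gens \<Longrightarrow> \<exists>f'. continuous_on UNIV f' \<and>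
       (\<forall>y. ((\<lambda>y. \<phi> (L s (\<psi> y))) has_real_derivative f' y) (at y) \<and> f' y \<le> exp \<epsilon>)"
    using lg.smoothing[OF \<epsilon>] by blast
  have \<phi>_int: "\<phi> (x + of_int k) = \<phi> x + of_int k" for x k using translation_int[of \<phi>, OF \<phi>(5)] .
  have \<psi>_int: "\<psi> (y + of_int k) = \<psi> y + of_int k" for y k
    using \<phi>_int[of "\<psi> y" k] \<phi>(3)[of "\<psi> y + of_int k"] by (simp add: \<phi>(4))
  define \<phi>c where "\<phi>c = (\<lambda>x. to_circle (\<phi> (rep_circle x)))"
  define \<psi>c where "\<psi>c = (\<lambda>x. to_circle (\<psi> (rep_circle x)))"
  have \<phi>c: "\<phi>c (to_circle t) = to_circle (\<phi> t)" for t
  proof -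
    obtain k :: int where "rep_circle (to_circle t) - t = k" using rep_to_circle[of t] by (auto elim: Ints_cases)
    then have "rep_circle (to_circle t) = t + k" by simp
    then show ?thesis by (simp add: \<phi>c_def \<phi>_int to_circle_eq_iff)
  qed
  have \<psi>c: "\<psi>c (to_circle t) = to_circle (\<psi> t)" for t
  proof -
    obtain k :: int where "rep_circle (to_circle t) - t = k" using rep_to_circle[of t] by (auto elim: Ints_cases)
    then have "rep_circle (to_circle t) = t + k" by simp
    then show ?thesis by (simp add: \<psi>c_def \<psi>_int to_circle_eq_iff)
  qed
  have inv1: "\<psi>c (\<phi>c x) = x" for x
  proof -
    have "\<psi>c (\<phi>c (to_circle (rep_circle x))) = to_circle (rep_circle x)" by (simp only: \<phi>c \<psi>c \<phi>(3))
    then show ?thesis by (simp add: to_circle_rep)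
  qed
  have inv2: "\<phi>c (\<psi>c x) = x" for x
  proof -
    have "\<phi>c (\<psi>c (to_circle (rep_circle x))) = to_circle (rep_circle x)" by (simp only: \<phi>c \<psi>c \<phi>(4))
    then show ?thesis by (simp add: to_circle_rep)
  qed
  have cont: "continuous_on UNIV \<phi>c" "continuous_on UNIV \<psi>c"
    by (rule continuous_on_circle, unfold \<phi>c \<psi>c,
        rule continuous_on_compose2[OF continuous_to_circle], rule \<phi>, simp)+
  have homeo: "homeomorphism UNIV UNIV \<phi>c \<psi>c"
    by (rule homeomorphismI) (use cont inv1 inv2 in auto)
  have deriv: "\<exists>f'. continuous_on UNIV f' \<and> (\<forall>x\<in>UNIV. circle_deriv (\<phi>c \<circ> s \<circ> \<psi>c) (f' x) x \<and> f' x \<le> exp \<epsilon>)"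
    if s: "s \<in> gens" for s
  proof -
    have s\<Gamma>: "s \<in> \<Gamma>" using s gens_sub by blast
    obtain f' where f': "continuous_on UNIV f'" "\<And>y. ((\<lambda>y. \<phi> (L s (\<psi> y))) has_real_derivative f' y) (at y)"
      "\<And>y. f' y \<le> exp \<epsilon>"
      using sm[OF s] by blast
    have cd: "circle_deriv (\<phi>c \<circ> s \<circ> \<psi>c) (f' t) (to_circle t)" for t
      unfolding circle_deriv_def
      by (intro exI[of _ t] exI[of _ "\<lambda>y. \<phi> (L s (\<psi> y))"] conjI f' refl always_eventually allI)
        (simp add: \<phi>c \<psi>c LD(1)[OF s\<Gamma>, symmetric])
    have per: "f' (rep_circle (to_circle t)) = f' t" for t
      using circle_deriv_unique[OF cd[of "rep_circle (to_circle t)"]] cd[of t] by (simp add: to_circle_rep)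
    have "continuous_on UNIV (\<lambda>x. f' (rep_circle x))"
      by (rule continuous_on_circle) (simp add: per f'(1))
    moreover have "circle_deriv (\<phi>c \<circ> s \<circ> \<psi>c) (f' (rep_circle x)) x" for x
      using cd[of "rep_circle x"] by (simp add: to_circle_rep)
    ultimately show ?thesis using f'(3) by (intro exI[of _ "\<lambda>x. f' (rep_circle x)"]) simp
  qed
  have "\<forall>g\<in>\<G>. \<forall>h\<in>{\<phi>c \<circ> g \<circ> \<psi>c, \<phi>c \<circ> inv_into UNIV g \<circ> \<psi>c}.
        C1_diffeo UNIV circle_deriv h \<and> (\<forall>x\<in>UNIV. \<exists>d. circle_deriv h d x \<and> d \<le> exp \<epsilon>)"
  proof (rule conjugates_C1_diffeo)
    fix f f' :: "circle \<Rightarrow> circle" and d x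
    assume "\<And>y. y \<in> UNIV \<Longrightarrow> f' y = f y" "circle_deriv f d x"
    moreover have "f' = f" using \<open>\<And>y. y \<in> UNIV \<Longrightarrow> f' y = f y\<close> by blast
    ultimately show "circle_deriv f' d x" by simp
  qed (use inv1 inv2 deriv in auto)
  then show ?thesis using homeo by blast
qed

section \<open>The interval\<close>

text \<open>
  The triangle wave, that is, the folding map from the circle to the interval.
\<close>

definition tri :: "real \<Rightarrow> real" where "tri u = arccos (cos (2 * pi * u)) / pi"

lemma tri_cont: "continuous_on UNIV tri"
  unfolding tri_def[abs_def]
  by (intro continuous_on_divide continuous_on_const continuous_on_arccos continuous_intros) auto

lemma tri_even: "tri (- u) = tri u"
  by (simp add: tri_def)

lemma tri_periodic: "tri (u + 1) = tri u"
  by (simp add: tri_def distrib_left)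

lemma tri_range: "tri u \<in> {0..1}"
  using arccos_bounded[of "cos (2 * pi * u)"] by (auto simp: tri_def)

lemma tri_half: "u \<in> {0..1/2} \<Longrightarrow> tri u = 2 * u"
  by (simp add: tri_def arccos_cos)

lemma odd_degree_one_eqI:
  fixes f h :: "real \<Rightarrow> real"
  assumes "\<And>x. f (- x) = - f x" "\<And>x. f (x + 1) = f x + 1" "\<And>x. h (- x) = - h x" "\<And>x. h (x + 1) = h x + 1"
    and eq: "\<And>x. x \<in> {0..1/2} \<Longrightarrow> f x = h x"
  shows "f x = h x"
proof -
  have *: "f y = h y" if y: "\<bar>y\<bar> \<le> 1/2" for y
  proof (cases "y \<ge> 0")
    case True then show ?thesis using eq[of y] y by simp
  next
    case False then show ?thesis using eq[of "- y"] y assms(1,3) by simp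
  qed
  define k where "k = \<lfloor>x + 1/2\<rfloor>"
  have "\<bar>x - of_int k\<bar> \<le> 1/2" unfolding k_def by linarith
  then have "f (x - of_int k) = h (x - of_int k)" by (rule *)
  moreover have "f (x - of_int k + of_int k) = f (x - of_int k) + of_int k"
    using translation_int[of f, OF assms(2)] .
  moreover have "h (x - of_int k + of_int k) = h (x - of_int k) + of_int k"
    using translation_int[of h, OF assms(4)] .
  ultimately show ?thesis by simp
qed

text \<open>
  A diffeomorphism of the interval is doubled to an odd diffeomorphism of the circle with \<open>g (2 x) / 2\<close>
  on \<open>[0, 1/2]\<close>. The doubled map is \<open>C\<^sup>1\<close> across the fixed points \<open>0\<close> and \<open>1/2\<close>, since both one-sided
  derivatives there agree; integrating the folded derivative makes this visible without gluing.
\<close>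

lemma interval_lift_exists:
  assumes g: "C1_diffeo {0..1} interval_deriv g" and op: "orientation_preserving {0..1} interval_deriv g"
  shows "\<exists>F F'. (\<forall>x\<in>{0..1/2}. F x = g (2 * x) / 2) \<and> (\<forall>x. F (- x) = - F x) \<and>
    (\<forall>x. (F has_real_derivative F' x) (at x)) \<and>
    continuous_on UNIV F' \<and> (\<forall>x. F' x > 0) \<and> (\<forall>x. F (x + 1) = F x + 1)"
proof -
  obtain f' where f': "continuous_on {0..1} f'" "\<And>x. x \<in> {0..1} \<Longrightarrow> interval_deriv g (f' x) x"
    and gb: "bij_betw g {0..1} {0..1}"
    using g by (auto simp: C1_diffeo_def C1_map_def)
  have f'_pos: "f' x > 0" if x: "x \<in> {0..1}" for x
  proof -
    obtain d where "d > 0" "interval_deriv g d x" using op x unfolding orientation_preserving_def by blast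
    then show ?thesis using interval_deriv_unique[OF f'(2)[OF x] _ x] by simp
  qed
  have dg: "(g has_real_derivative f' x) (at x within {0..1})" if "x \<in> {0..1}" for x
    using f'(2)[OF that] by (simp add: interval_deriv_def)
  have g_cont: "continuous_on {0..1} g" by (rule DERIV_continuous_on[OF dg])
  have g_mono: "g x < g y" if xy: "0 \<le> x" "x < y" "y \<le> 1" for x y
  proof (rule DERIV_pos_imp_increasing_open[OF xy(2)])
    show "continuous_on {x..y} g" by (rule continuous_on_subset[OF g_cont]) (use xy in auto)
    fix z assume z: "x < z" "z < y"
    have "at z within {0..1} = at z" by (rule at_within_interior) (use z xy in simp)
    then have "(g has_real_derivative f' z) (at z)" using dg[of z] z xy by simp
    then show "\<exists>d. (g has_real_derivative d) (at z) \<and> 0 < d" using f'_pos[of z] z xy by auto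
  qed
  have g01: "g x \<in> {0..1}" if "x \<in> {0..1}" for x using bij_betwE[OF gb] that by blast
  have g0: "g 0 = 0"
  proof -
    obtain x where x: "x \<in> {0..1}" "g x = 0" using gb unfolding bij_betw_def by (metis atLeastAtMost_iff image_iff order_refl zero_le_one)
    show ?thesis
    proof (cases "x = 0")
      case False
      then have "g 0 < g x" using x by (intro g_mono) auto
      then show ?thesis using x g01[of 0] by simp
    qed (use x in simp)
  qed
  have g1: "g 1 = 1"
  proof -
    obtain x where x: "x \<in> {0..1}" "g x = 1" using gb unfolding bij_betw_def by (metis atLeastAtMost_iff image_iff order_refl zero_le_one)
    show ?thesis
    proof (cases "x = 1")
      case False
      then have "g x < g 1" using x by (intro g_mono) auto
      then show ?thesis using x g01[of 1] by simp
    qed (use x in simp)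
  qed
  define p where "p = (\<lambda>u. f' (tri u))"
  have p_cont: "continuous_on UNIV p"
    unfolding p_def by (rule continuous_on_compose2[OF f'(1) tri_cont]) (use tri_range in auto)
  have p_pos: "p u > 0" for u unfolding p_def by (rule f'_pos[OF tri_range])
  obtain A where A: "\<And>x. (A has_vector_derivative p x) (at x)"
    using einterval_antiderivative[of "-\<infinity>" "\<infinity>" p] p_cont by (auto simp: continuous_on_eq_continuous_at)
  define F where "F = (\<lambda>x. A x - A 0)"
  have F': "(F has_real_derivative p x) (at x)" for x
    unfolding F_def using A[of x]
    by (auto intro!: derivative_eq_intros simp: has_real_derivative_iff_has_vector_derivative)
  have F0: "F 0 = 0" by (simp add: F_def)
  have odd: "F (- x) = - F x" for x
  proof -
    have "((\<lambda>x. F x + F (- x)) has_real_derivative p x + p (- x) * (- 1)) (at x)" for x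
      by (intro DERIV_add F' DERIV_chain2[OF F']) (auto intro!: derivative_eq_intros)
    then have "((\<lambda>x. F x + F (- x)) has_real_derivative 0) (at x)" for x by (simp add: p_def tri_even)
    then have "F x + F (- x) = F 0 + F (- 0)" using DERIV_isconst_all[of "\<lambda>x. F x + F (- x)" x 0] by blast
    then show ?thesis using F0 by simp
  qed
  have half: "F x = g (2 * x) / 2" if x: "x \<in> {0..1/2}" for x
  proof -
    have "((\<lambda>x. F x - g (2 * x) / 2) has_real_derivative 0) (at x within {0..1/2})" if x: "x \<in> {0..1/2}" for x
    proof -
      have "(g has_real_derivative f' (2 * x)) (at (2 * x) within (\<lambda>x. 2 * x) ` {0..1/2})"
        by (rule DERIV_subset[OF dg]) (use x in auto)
      moreover have "((\<lambda>x. 2 * x) has_real_derivative 2) (at x within {0..1/2})"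
        by (auto intro!: derivative_eq_intros)
      ultimately have "((g \<circ> (\<lambda>x. 2 * x)) has_real_derivative f' (2 * x) * 2) (at x within {0..1/2})"
        by (rule DERIV_image_chain)
      then have "((\<lambda>x. g (2 * x) / 2) has_real_derivative f' (2 * x) * 2 / 2) (at x within {0..1/2})"
        unfolding o_def by (rule DERIV_cdivide)
      then have "((\<lambda>x. F x - g (2 * x) / 2) has_real_derivative p x - f' (2 * x) * 2 / 2) (at x within {0..1/2})"
        by (intro DERIV_diff has_field_derivative_at_within[OF F'])
      then show ?thesis by (simp add: p_def tri_half[OF x])
    qed
    then obtain k where k: "\<And>x. x \<in> {0..1/2} \<Longrightarrow> F x - g (2 * x) / 2 = k"
      using has_field_derivative_zero_constant[of "{0..1/2}" "\<lambda>x. F x - g (2 * x) / 2"] by auto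
    have "k = 0" using k[of 0] F0 g0 by simp
    then show ?thesis using k[OF x] by simp
  qed
  have period: "F (x + 1) = F x + 1" for x
  proof -
    have "((\<lambda>x. F (x + 1) - F x) has_real_derivative p (x + 1) * 1 - p x) (at x)" for x
      by (intro DERIV_diff F' DERIV_chain2[OF F']) (auto intro!: derivative_eq_intros)
    then have "((\<lambda>x. F (x + 1) - F x) has_real_derivative 0) (at x)" for x by (simp add: p_def tri_periodic)
    then have "F (x + 1) - F x = F (- (1/2) + 1) - F (- (1/2))"
      using DERIV_isconst_all[of "\<lambda>x. F (x + 1) - F x" x "- (1/2)"] by blast
    also have "\<dots> = F (1/2) + F (1/2)" by (simp only: odd) simp
    also have "\<dots> = 1" using half[of "1/2"] g1 by simp
    finally show ?thesis by simp
  qed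
  show ?thesis using half odd F' p_cont p_pos period by blast
qed

lemma interval_case:
  fixes \<Gamma> \<G> :: "(real \<Rightarrow> real) set" and \<epsilon> :: real
  assumes \<epsilon>: "\<epsilon> > 0" and fg: "fg_nilpotent_bijections {0..1} \<Gamma> \<G>"
    and diffeo: "\<And>g. g \<in> \<Gamma> \<Longrightarrow> C1_diffeo {0..1} interval_deriv g \<and> orientation_preserving {0..1} interval_deriv g"
  shows "\<exists>\<phi> \<psi>. homeomorphism {0..1} {0..1} \<phi> \<psi> \<and>
     (\<forall>g\<in>\<G>. \<forall>h\<in>{\<phi> \<circ> g \<circ> \<psi>, \<phi> \<circ> inv_into {0..1} g \<circ> \<psi>}.
        C1_diffeo {0..1} interval_deriv h \<and> (\<forall>x\<in>{0..1}. \<exists>d. interval_deriv h d x \<and> d \<le> exp \<epsilon>))"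
proof -
  interpret fg_nilpotent_bijections "{0..1}" \<Gamma> \<G> by (rule fg)
  have "\<forall>g\<in>\<Gamma>. \<exists>F F'. (\<forall>x\<in>{0..1/2}. F x = g (2 * x) / 2) \<and> (\<forall>x. F (- x) = - F x) \<and>
    (\<forall>x. (F has_real_derivative F' x) (at x)) \<and>
    continuous_on UNIV F' \<and> (\<forall>x. F' x > 0) \<and> (\<forall>x. F (x + 1) = F x + 1)"
    using interval_lift_exists diffeo by blast
  from bchoice[OF this] obtain L where "\<forall>g\<in>\<Gamma>. \<exists>F'. (\<forall>x\<in>{0..1/2}. L g x = g (2 * x) / 2) \<and>
    (\<forall>x. L g (- x) = - L g x) \<and> (\<forall>x. (L g has_real_derivative F' x) (at x)) \<and>
    continuous_on UNIV F' \<and> (\<forall>x. F' x > 0) \<and> (\<forall>x. L g (x + 1) = L g x + 1)" ..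
  from bchoice[OF this] obtain D where "\<forall>g\<in>\<Gamma>. (\<forall>x\<in>{0..1/2}. L g x = g (2 * x) / 2) \<and>
    (\<forall>x. L g (- x) = - L g x) \<and> (\<forall>x. (L g has_real_derivative D g x) (at x)) \<and>
    continuous_on UNIV (D g) \<and> (\<forall>x. D g x > 0) \<and> (\<forall>x. L g (x + 1) = L g x + 1)" ..
  note * = bspec[OF this]
  have LD: "\<And>g x. g \<in> \<Gamma> \<Longrightarrow> x \<in> {0..1/2} \<Longrightarrow> L g x = g (2 * x) / 2"
    "\<And>g x. g \<in> \<Gamma> \<Longrightarrow> (L g has_real_derivative D g x) (at x)"
    "\<And>g. g \<in> \<Gamma> \<Longrightarrow> continuous_on UNIV (D g)"
    "\<And>g x. g \<in> \<Gamma> \<Longrightarrow> D g x > 0" "\<And>g x. g \<in> \<Gamma> \<Longrightarrow> L g (x + 1) = L g x + 1"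
    "\<And>g x. g \<in> \<Gamma> \<Longrightarrow> L g (- x) = - L g x"
    using * by blast+
  have in01: "g x \<in> {0..1}" if "g \<in> \<Gamma>" "x \<in> {0..1}" for g x
    using bij_betwE[OF bij[OF that(1)]] that(2) by blast
  have "L (g \<otimes>\<^bsub>\<Gamma>G\<^esub> h) x = L g (L h x)" if g: "g \<in> \<Gamma>" and h: "h \<in> \<Gamma>" for g h x
  proof (rule odd_degree_one_eqI[of "L (g \<otimes>\<^bsub>\<Gamma>G\<^esub> h)" "\<lambda>x. L g (L h x)"])
    have gh: "g \<otimes>\<^bsub>\<Gamma>G\<^esub> h \<in> \<Gamma>" using subgroup.m_closed[OF sub g h] by simp
    show "L (g \<otimes>\<^bsub>\<Gamma>G\<^esub> h) (- x) = - L (g \<otimes>\<^bsub>\<Gamma>G\<^esub> h) x" "L (g \<otimes>\<^bsub>\<Gamma>G\<^esub> h) (x + 1) = L (g \<otimes>\<^bsub>\<Gamma>G\<^esub> h) x + 1" for x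
      by (rule LD(6)[OF gh], rule LD(5)[OF gh])
    show "L g (L h (- x)) = - L g (L h x)" "L g (L h (x + 1)) = L g (L h x) + 1" for x
      by (simp_all only: LD(6)[OF h] LD(6)[OF g] LD(5)[OF h] LD(5)[OF g])
    fix x :: real assume x: "x \<in> {0..1/2}"
    have x2: "2 * x \<in> {0..1}" using x by auto
    have "h (2 * x) / 2 \<in> {0..1/2}" using in01[OF h x2] by auto
    then have "L g (L h x) = g (2 * (h (2 * x) / 2)) / 2" unfolding LD(1)[OF h x] by (rule LD(1)[OF g])
    then show "L (g \<otimes>\<^bsub>\<Gamma>G\<^esub> h) x = L g (L h x)"
      unfolding LD(1)[OF gh x] using mult_apply[OF g h x2] by simp
  qed
  then obtain n where "lifted_group \<Gamma>G gens L D n"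
    using lifted_group_of_lifts[of L D] LD(2-5) by fastforce
  then interpret lg: lifted_group \<Gamma>G gens L D n .
  obtain \<phi> \<psi> where \<phi>: "strict_mono \<phi>" "continuous_on UNIV \<phi>" "continuous_on UNIV \<psi>" "\<And>x. \<psi> (\<phi> x) = x" "\<And>y. \<phi> (\<psi> y) = y"
      "\<And>x. \<phi> (x + 1) = \<phi> x + 1"
    and odd: "(\<forall>g\<in>carrier \<Gamma>G. \<forall>x. L g (- x) = - L g x) \<longrightarrow> (\<forall>x. \<phi> (- x) = - \<phi> x)"
    and sm: "\<And>s. s \<in> gens \<Longrightarrow> \<exists>f'. continuous_on UNIV f' \<and>
       (\<forall>y. ((\<lambda>y. \<phi> (L s (\<psi> y))) has_real_derivative f' y) (at y) \<and> f' y \<le> exp \<epsilon>)"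
    using lg.smoothing[OF \<epsilon>] by blast
  have odd: "\<phi> (- x) = - \<phi> x" for x using odd LD(6) by simp
  have \<phi>0: "\<phi> 0 = 0" using odd[of 0] by simp
  have \<phi>h: "\<phi> (1/2) = 1/2" using odd[of "1/2"] \<phi>(6)[of "- (1/2)"] by simp
  have \<psi>0: "\<psi> 0 = 0" using \<phi>(4)[of 0] \<phi>0 by simp
  have \<psi>h: "\<psi> (1/2) = 1/2" using \<phi>(4)[of "1/2"] \<phi>h by simp
  have \<phi>_le: "\<phi> x \<le> \<phi> y \<longleftrightarrow> x \<le> y" for x y using strict_mono_less_eq[OF \<phi>(1)] .
  have \<psi>_le: "\<psi> x \<le> \<psi> y \<longleftrightarrow> x \<le> y" for x y using \<phi>_le[of "\<psi> x" "\<psi> y"] by (simp add: \<phi>(5))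
  define \<phi>I where "\<phi>I = (\<lambda>x. 2 * \<phi> (x / 2))"
  define \<psi>I where "\<psi>I = (\<lambda>x. 2 * \<psi> (x / 2))"
  have map: "\<phi>I x \<in> {0..1}" "\<psi>I x \<in> {0..1}" if "x \<in> {0..1}" for x
    using \<phi>_le[of 0 "x / 2"] \<phi>_le[of "x / 2" "1/2"] \<psi>_le[of 0 "x / 2"] \<psi>_le[of "x / 2" "1/2"] that
    by (auto simp: \<phi>I_def \<psi>I_def \<phi>0 \<phi>h \<psi>0 \<psi>h)
  have inv: "\<psi>I (\<phi>I x) = x" "\<phi>I (\<psi>I x) = x" for x by (simp_all add: \<phi>I_def \<psi>I_def \<phi>(4,5))
  have cont: "continuous_on {0..1} \<phi>I" "continuous_on {0..1} \<psi>I"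
    unfolding \<phi>I_def \<psi>I_def
    by (intro continuous_on_mult continuous_on_const continuous_on_compose2[OF \<phi>(2)]
        continuous_on_compose2[OF \<phi>(3)] continuous_on_divide continuous_on_id; simp)+
  have homeo: "homeomorphism {0..1} {0..1} \<phi>I \<psi>I"
    by (rule homeomorphismI) (use cont map inv in auto)
  have cong: "interval_deriv f' d x"
    if "x \<in> {0..1}" "\<And>y. y \<in> {0..1} \<Longrightarrow> f' y = f y" "interval_deriv f d x" for f f' d x
    using that(3) unfolding interval_deriv_def
    by (rule has_field_derivative_transform_within[OF _ zero_less_one that(1)]) (simp add: that(2))
  have deriv: "\<exists>f'. continuous_on {0..1} f' \<and> (\<forall>x\<in>{0..1}. interval_deriv (\<phi>I \<circ> s \<circ> \<psi>I) (f' x) x \<and> f' x \<le> exp \<epsilon>)"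
    if s: "s \<in> gens" for s
  proof -
    have s\<Gamma>: "s \<in> \<Gamma>" using s gens_sub by blast
    obtain f' where f': "continuous_on UNIV f'" "\<And>y. ((\<lambda>y. \<phi> (L s (\<psi> y))) has_real_derivative f' y) (at y)"
      "\<And>y. f' y \<le> exp \<epsilon>"
      using sm[OF s] by blast
    have "continuous_on {0..1} (\<lambda>x. f' (x / 2))"
      by (intro continuous_on_compose2[OF f'(1)] continuous_on_divide continuous_on_id continuous_on_const) auto
    moreover have "interval_deriv (\<phi>I \<circ> s \<circ> \<psi>I) (f' (x / 2)) x" if x: "x \<in> {0..1}" for x
    proof (rule cong[OF x])
      have "((\<lambda>x. x / 2) has_real_derivative 1 / 2) (at x)" by (auto intro!: derivative_eq_intros)
      from DERIV_cmult[OF DERIV_chain2[OF f'(2) this], of 2]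
      have "((\<lambda>x. 2 * \<phi> (L s (\<psi> (x / 2)))) has_real_derivative f' (x / 2)) (at x)" by simp
      then show "interval_deriv (\<lambda>x. 2 * \<phi> (L s (\<psi> (x / 2)))) (f' (x / 2)) x"
        unfolding interval_deriv_def by (rule has_field_derivative_at_within)
      fix y :: real assume "y \<in> {0..1}"
      then have "\<psi> (y / 2) \<in> {0..1/2}" using map(2)[of y] by (auto simp: \<psi>I_def)
      then have eq: "L s (\<psi> (y / 2)) = s (\<psi>I y) / 2" unfolding \<psi>I_def by (rule LD(1)[OF s\<Gamma>])
      show "(\<phi>I \<circ> s \<circ> \<psi>I) y = 2 * \<phi> (L s (\<psi> (y / 2)))"
        unfolding eq by (simp only: o_apply \<phi>I_def)
    qed
    ultimately show ?thesis using f'(3) by (intro exI[of _ "\<lambda>x. f' (x / 2)"]) simp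
  qed
  have "\<forall>g\<in>\<G>. \<forall>h\<in>{\<phi>I \<circ> g \<circ> \<psi>I, \<phi>I \<circ> inv_into {0..1} g \<circ> \<psi>I}.
        C1_diffeo {0..1} interval_deriv h \<and> (\<forall>x\<in>{0..1}. \<exists>d. interval_deriv h d x \<and> d \<le> exp \<epsilon>)"
  proof (rule conjugates_C1_diffeo)
    show "interval_deriv f' d x"
      if "x \<in> {0..1}" "\<And>y. y \<in> {0..1} \<Longrightarrow> f' y = f y" "interval_deriv f d x" for f f' d x
      by (rule cong[OF that])
  qed (use map inv deriv in auto)
  then show ?thesis using homeo by blast
qed

section \<open>Conjugation close to isometries\<close>

theorem mainTheorem2:
  fixes \<epsilon> :: real
  assumes "\<epsilon> > 0"
  shows
    "(\<forall>(\<Gamma> :: (circle \<Rightarrow> circle) set) \<G>.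
        subgroup \<Gamma> (BijGroup UNIV) \<and>
        nilpotent_group (BijGroup UNIV\<lparr>carrier := \<Gamma>\<rparr>) \<and>
        (\<forall>g\<in>\<Gamma>. C1_diffeo UNIV circle_deriv g \<and> orientation_preserving UNIV circle_deriv g) \<and>
        finite \<G> \<and> \<G> \<subseteq> \<Gamma> \<and> generate (BijGroup UNIV) \<G> = \<Gamma>
        \<longrightarrow> (\<exists>\<phi> \<psi>. homeomorphism UNIV UNIV \<phi> \<psi> \<and>
              (\<forall>g\<in>\<G>. \<forall>h\<in>{\<phi> \<circ> g \<circ> \<psi>, \<phi> \<circ> inv_into UNIV g \<circ> \<psi>}.
                 C1_diffeo UNIV circle_deriv h \<and>
                 (\<forall>x. \<exists>d. circle_deriv h d x \<and> d \<le> exp \<epsilon>))))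
     \<and>
     (\<forall>(\<Gamma> :: (real \<Rightarrow> real) set) \<G>.
        subgroup \<Gamma> (BijGroup {0..1}) \<and>
        nilpotent_group (BijGroup {0..1}\<lparr>carrier := \<Gamma>\<rparr>) \<and>
        (\<forall>g\<in>\<Gamma>. C1_diffeo {0..1} interval_deriv g \<and> orientation_preserving {0..1} interval_deriv g) \<and>
        finite \<G> \<and> \<G> \<subseteq> \<Gamma> \<and> generate (BijGroup {0..1}) \<G> = \<Gamma>
        \<longrightarrow> (\<exists>\<phi> \<psi>. homeomorphism {0..1} {0..1} \<phi> \<psi> \<and>
              (\<forall>g\<in>\<G>. \<forall>h\<in>{\<phi> \<circ> g \<circ> \<psi>, \<phi> \<circ> inv_into {0..1} g \<circ> \<psi>}.
                 C1_diffeo {0..1} interval_deriv h \<and>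
                 (\<forall>x\<in>{0..1}. \<exists>d. interval_deriv h d x \<and> d \<le> exp \<epsilon>))))"
proof (intro conjI allI impI; elim conjE)
  fix \<Gamma> \<G> :: "(circle \<Rightarrow> circle) set"
  assume "subgroup \<Gamma> (BijGroup UNIV)" "nilpotent_group (BijGroup UNIV\<lparr>carrier := \<Gamma>\<rparr>)"
    "finite \<G>" "\<G> \<subseteq> \<Gamma>" "generate (BijGroup UNIV) \<G> = \<Gamma>"
    and d: "\<forall>g\<in>\<Gamma>. C1_diffeo UNIV circle_deriv g \<and> orientation_preserving UNIV circle_deriv g"
  then have "fg_nilpotent_bijections UNIV \<Gamma> \<G>" by (intro fg_nilpotent_bijections.intro)
  from circle_case[OF assms this] d
  show "\<exists>\<phi> \<psi>. homeomorphism UNIV UNIV \<phi> \<psi> \<and>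
              (\<forall>g\<in>\<G>. \<forall>h\<in>{\<phi> \<circ> g \<circ> \<psi>, \<phi> \<circ> inv_into UNIV g \<circ> \<psi>}.
                 C1_diffeo UNIV circle_deriv h \<and> (\<forall>x. \<exists>d. circle_deriv h d x \<and> d \<le> exp \<epsilon>))"
    by simp
next
  fix \<Gamma> \<G> :: "(real \<Rightarrow> real) set"
  assume "subgroup \<Gamma> (BijGroup {0..1})" "nilpotent_group (BijGroup {0..1}\<lparr>carrier := \<Gamma>\<rparr>)"
    "finite \<G>" "\<G> \<subseteq> \<Gamma>" "generate (BijGroup {0..1}) \<G> = \<Gamma>"
    and d: "\<forall>g\<in>\<Gamma>. C1_diffeo {0..1} interval_deriv g \<and> orientation_preserving {0..1} interval_deriv g"
  then have "fg_nilpotent_bijections {0..1} \<Gamma> \<G>" by (intro fg_nilpotent_bijections.intro)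
  from interval_case[OF assms this] d
  show "\<exists>\<phi> \<psi>. homeomorphism {0..1} {0..1} \<phi> \<psi> \<and>
              (\<forall>g\<in>\<G>. \<forall>h\<in>{\<phi> \<circ> g \<circ> \<psi>, \<phi> \<circ> inv_into {0..1} g \<circ> \<psi>}.
                 C1_diffeo {0..1} interval_deriv h \<and>
                 (\<forall>x\<in>{0..1}. \<exists>d. interval_deriv h d x \<and> d \<le> exp \<epsilon>))"
    by blast
qed

end
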